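(* Let $n\ge 2$, and consider products of the geometric crystals $X_M$ and $X_N$, identified with weighted networks on a cylinder in which factors $X_M$ correspond to whirl wire cycles and factors $X_N$ to curl wire cycles crossing $n$ horizontal wires. The whurl moves and whirl-curl moves, applied to two adjacent wire cycles, are exactly the $R$-matrices for products of $X_M$ and $X_N$. That is, the birational maps $R_{A,B}:X_A\times X_B\to X_B\times X_A$, $A,B\in\{M,N\}$, given by these moves (formulas in the context) commute with the geometric crystal structures: $\varepsilon_i\circ R_{A,B}=\varepsilon_i$, $\varphi_i\circ R_{A,B}=\varphi_i$ and $e_i^c\circ R_{A,B}=R_{A,B}\circ e_i^c$ for all $i\in\mathbb Z/n\mathbb Z$; and they satisfy the braid relation $$(R_{12}\times1)\circ(1\times R_{23})\circ(R_{12}\times1)=(1\times R_{23})\circ(R_{12}\times 1)\circ(1\times R_{23})$$ on every triple product $X_A\times X_B\times X_C$, $A,B,C\in\{M,N\}$ (where $R_{12},R_{23}$ denote the map $R$ applied to the first two, respectively last two, factors).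
   Context: $X_M=\{x=(x^{(1)},\dots,x^{(n)}):x^{(i)}\in\mathbb C^*\}$ (upper indices always mod $n$) with $\varepsilon_i(x)=x^{(i+1)}$, $\varphi_i(x)=x^{(i)}$, and $e_i^c$ multiplying $x^{(i)}$ by $c$ and $x^{(i+1)}$ by $c^{-1}$. $X_N$ is the same variety with $\varepsilon_i(x)=x^{(i)}$, $\varphi_i(x)=x^{(i+1)}$, and $e_i^c$ multiplying $x^{(i)}$ by $c^{-1}$ and $x^{(i+1)}$ by $c$. The weight function is $\gamma_i=\varphi_i/\varepsilon_i$. The product $X\times X'$ has $$\varepsilon_k(x,x')=\frac{\varepsilon_k(x)\varepsilon_k(x')}{\varphi_k(x')+\varepsilon_k(x)},\quad \varphi_k(x,x')=\frac{\varphi_k(x)\varphi_k(x')}{\varepsilon_k(x)+\varphi_k(x')},\quad e_k^c(x,x')=(e_k^{c^+}x,e_k^{c/c^+}x'),\quad c^+=\frac{c\varphi_k(x')+\varepsilon_k(x)}{\varphi_k(x')+\varepsilon_k(x)}.$$ An $R$-matrix for products $X\times Y$ of geometric crystals is a birational map $X\times Y\to Y\times X$ which commutes with all the crystal structures and satisfies the braid relation above. The network: $n$ horizontal wires oriented left to right, numbered cyclically from top to bottom, crossed by vertical wire cycles going once around the cylinder; a whirl is oriented up, a curl is oriented down; $x^{(i)}$ is the weight of the crossing of a given cycle with the $i$-th horizontal wire. For two adjacent cycles with weights $x$ (left) and $y$ (right), the whurl move (cycles of the same type) or whirl-curl move (cycles of different types) swaps the two cycles, the new weights $x'$ (left) and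 $y'$ (right) defining $R_{A,B}(x,y)=(x',y')$, as follows. $R_{M,M}$: with $L_i=\sum_{s=0}^{n-1}\prod_{r=1}^{s}y^{(i+r-1)}\prod_{r=s+1}^{n-1}x^{(i+r)}$, $$x'^{(i)}=\frac{y^{(i)}L_{i+1}}{L_i},\qquad y'^{(i)}=\frac{x^{(i)}L_i}{L_{i+1}}.$$ $R_{N,N}$: with $K_i=\sum_{s=0}^{n-1}\prod_{r=1}^{s}y^{(i+1-r)}\prod_{r=s+1}^{n-1}x^{(i-r)}$, $$x'^{(i)}=\frac{y^{(i)}K_{i-1}}{K_i},\qquad y'^{(i)}=\frac{x^{(i)}K_i}{K_{i-1}}.$$ $R_{M,N}$: $$x'^{(i)}=\frac{y^{(i)}(x^{(i-1)}+y^{(i-1)})}{x^{(i)}+y^{(i)}},\qquad y'^{(i)}=\frac{x^{(i)}(x^{(i-1)}+y^{(i-1)})}{x^{(i)}+y^{(i)}}.$$ $R_{N,M}$: $$x'^{(i)}=\frac{y^{(i)}(x^{(i+1)}+y^{(i+1)})}{x^{(i)}+y^{(i)}},\qquad y'^{(i)}=\frac{x^{(i)}(x^{(i+1)}+y^{(i+1)})}{x^{(i)}+y^{(i)}}.$$ *)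

theory Defs
  imports "HOL-Analysis.Analysis" "HOL-Number_Theory.Cong" "HOL-Library.Monad_Syntax"
begin

section \<open>Varieties and rational maps\<close>

text \<open>
  A variety is presented by its set of points and by coordinate functions, its embedding in an
  affine space (possibly with redundant coordinates).  Only irreducible varieties occur below
  (tori and their products), so a nonempty Zariski-open subset is automatically dense.
\<close>

record 'p variety =
  points :: "'p set"
  coords :: "('p \<Rightarrow> complex) set"

inductive_set polys :: "('p \<Rightarrow> complex) set \<Rightarrow> ('p \<Rightarrow> complex) set" for C where
  const: "(\<lambda>_. a) \<in> polys C"
| coord: "h \<in> C \<Longrightarrow> h \<in> polys C"
| add: "f \<in> polys C \<Longrightarrow> g \<in> polys C \<Longrightarrow> (\<lambda>p. f p + g p) \<in> polys C"
| mult: "f \<in> polys C \<Longrightarrow> g \<in> polys C \<Longrightarrow> (\<lambda>p. f p * g p) \<in> polys C"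

definition zariski :: "('p, 'm) variety_scheme \<Rightarrow> 'p topology" where
  "zariski V = topology_generated_by {{p \<in> points V. f p \<noteq> 0} | f. f \<in> polys (coords V)}"

definition regular_on :: "('p, 'm) variety_scheme \<Rightarrow> 'p set \<Rightarrow> ('p \<Rightarrow> complex) \<Rightarrow> bool" where
  "regular_on V D h \<longleftrightarrow>
     (\<forall>p\<in>D. \<exists>U. openin (zariski V) U \<and> p \<in> U \<and> U \<subseteq> D \<and>
        (\<exists>a\<in>polys (coords V). \<exists>b\<in>polys (coords V). \<forall>q\<in>U. b q \<noteq> 0 \<and> h q = a q / b q))"

text \<open>
  A rational map is a partial function whose domain of definition (within the points of the
  source) is open and nonempty, and which is regular there.  The value \<open>None\<close> means that some
  denominator vanishes; composition of rational maps is \<open>\<circ>\<^sub>m\<close>.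
\<close>

definition rational_map ::
    "('p, 'm) variety_scheme \<Rightarrow> ('q, 'k) variety_scheme \<Rightarrow> ('p \<rightharpoonup> 'q) \<Rightarrow> bool" where
  "rational_map V W f \<longleftrightarrow>
     (let D = dom f \<inter> points V in
        openin (zariski V) D \<and> D \<noteq> {} \<and>
        (\<forall>p\<in>D. the (f p) \<in> points W) \<and>
        (\<forall>h\<in>coords W. regular_on V D (\<lambda>p. h (the (f p)))))"

text \<open>Equality of rational maps: both sides are defined and agree on a dense open set.\<close>

definition rat_eq :: "('p, 'm) variety_scheme \<Rightarrow> ('p \<rightharpoonup> 'q) \<Rightarrow> ('p \<rightharpoonup> 'q) \<Rightarrow> bool" where
  "rat_eq V f g \<longleftrightarrow>
     (\<exists>U. openin (zariski V) U \<and> U \<noteq> {} \<and> (\<forall>p\<in>U. \<exists>q. f p = Some q \<and> g p = Some q))"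

definition birational_map ::
    "('p, 'm) variety_scheme \<Rightarrow> ('q, 'k) variety_scheme \<Rightarrow> ('p \<rightharpoonup> 'q) \<Rightarrow> bool" where
  "birational_map V W f \<longleftrightarrow> rational_map V W f \<and>
     (\<exists>g. rational_map W V g \<and> rat_eq V (g \<circ>\<^sub>m f) Some \<and> rat_eq W (f \<circ>\<^sub>m g) Some)"

definition prod_coords ::
    "('p \<Rightarrow> complex) set \<Rightarrow> ('q \<Rightarrow> complex) set \<Rightarrow> ('p \<times> 'q \<Rightarrow> complex) set" where
  "prod_coords C D = (\<lambda>h. h \<circ> fst) ` C \<union> (\<lambda>h. h \<circ> snd) ` D"

definition prod_variety ::
    "('p, 'm) variety_scheme \<Rightarrow> ('q, 'k) variety_scheme \<Rightarrow> ('p \<times> 'q) variety" where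
  "prod_variety V W =
     \<lparr>points = points V \<times> points W, coords = prod_coords (coords V) (coords W)\<rparr>"

definition quot :: "complex \<Rightarrow> complex \<Rightarrow> complex option" where
  "quot a b = (if b = 0 then None else Some (a / b))"


section \<open>The geometric crystals\<close>

text \<open>\<open>act X i c\<close> is the map $e_i^c$; it is only meaningful for \<open>c \<noteq> 0\<close>.\<close>

record 'p crystal = "'p variety" +
  eps :: "int \<Rightarrow> 'p \<rightharpoonup> complex"
  phi :: "int \<Rightarrow> 'p \<rightharpoonup> complex"
  act :: "int \<Rightarrow> complex \<Rightarrow> 'p \<rightharpoonup> 'p"

definition weight :: "'p crystal \<Rightarrow> int \<Rightarrow> 'p \<rightharpoonup> complex" where
  "weight X k p = do {a \<leftarrow> phi X k p; b \<leftarrow> eps X k p; quot a b}"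

text \<open>
  A tuple with entries in $\mathbb{C}^*$ and upper indices modulo \<open>n\<close> is an \<open>n\<close>-periodic
  function on the integers without zeros.
\<close>

type_synonym tuple = "int \<Rightarrow> complex"

definition torus :: "nat \<Rightarrow> tuple set" where
  "torus n = {x. \<forall>i. x i \<noteq> 0 \<and> x (i + int n) = x i}"

definition torus_coords :: "(tuple \<Rightarrow> complex) set" where
  "torus_coords = range (\<lambda>i x. x i)"

definition rescale :: "nat \<Rightarrow> int \<Rightarrow> complex \<Rightarrow> tuple \<Rightarrow> tuple" where
  "rescale n i c x = (\<lambda>j. if [j = i] (mod int n) then c * x j
                          else if [j = i + 1] (mod int n) then inverse c * x j
                          else x j)"

definition X_M :: "nat \<Rightarrow> tuple crystal" where
  "X_M n = \<lparr>points = torus n, coords = torus_coords,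
            eps = (\<lambda>i x. Some (x (i + 1))),
            phi = (\<lambda>i x. Some (x i)),
            act = (\<lambda>i c x. Some (rescale n i c x))\<rparr>"

definition X_N :: "nat \<Rightarrow> tuple crystal" where
  "X_N n = \<lparr>points = torus n, coords = torus_coords,
            eps = (\<lambda>i x. Some (x i)),
            phi = (\<lambda>i x. Some (x (i + 1))),
            act = (\<lambda>i c x. Some (rescale n i (inverse c) x))\<rparr>"

definition prod_crystal :: "'p crystal \<Rightarrow> 'q crystal \<Rightarrow> ('p \<times> 'q) crystal" (infixr "\<otimes>\<^sub>c" 70) where
  "X \<otimes>\<^sub>c Y =
     \<lparr>points = points X \<times> points Y,
      coords = prod_coords (coords X) (coords Y),
      eps = (\<lambda>k (x, y). do {
               ex \<leftarrow> eps X k x; ey \<leftarrow> eps Y k y; py \<leftarrow> phi Y k y;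
               quot (ex * ey) (py + ex)}),
      phi = (\<lambda>k (x, y). do {
               ex \<leftarrow> eps X k x; px \<leftarrow> phi X k x; py \<leftarrow> phi Y k y;
               quot (px * py) (ex + py)}),
      act = (\<lambda>k c (x, y). do {
               ex \<leftarrow> eps X k x; py \<leftarrow> phi Y k y;
               c1 \<leftarrow> quot (c * py + ex) (py + ex);
               c2 \<leftarrow> quot c c1;
               x' \<leftarrow> act X k c1 x; y' \<leftarrow> act Y k c2 y;
               Some (x', y')})\<rparr>"


section \<open>Whurl and whirl-curl moves\<close>

text \<open>
  A network on the cylinder with \<open>n\<close> horizontal wires is given by the left-to-right sequence of
  its vertical wire cycles, each with its type and the tuple of its crossing weights.  The
  identification with products of crystals sends whirls to $X_M$ and curls to $X_N$.
\<close>

datatype cycle = Whirl | Curl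

fun crystal_of :: "nat \<Rightarrow> cycle \<Rightarrow> tuple crystal" where
  "crystal_of n Whirl = X_M n"
| "crystal_of n Curl = X_N n"

definition whurl_L :: "nat \<Rightarrow> tuple \<Rightarrow> tuple \<Rightarrow> int \<Rightarrow> complex" where
  "whurl_L n x y i =
     (\<Sum>s = 0..n-1. (\<Prod>r = 1..s. y (i + int r - 1)) * (\<Prod>r = s+1..n-1. x (i + int r)))"

definition whurl_K :: "nat \<Rightarrow> tuple \<Rightarrow> tuple \<Rightarrow> int \<Rightarrow> complex" where
  "whurl_K n x y i =
     (\<Sum>s = 0..n-1. (\<Prod>r = 1..s. y (i + 1 - int r)) * (\<Prod>r = s+1..n-1. x (i - int r)))"

text \<open>
  \<open>move n A B (x, y)\<close> are the new weights after swapping a cycle of type \<open>A\<close> (left, weights \<open>x\<close>)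
  with an adjacent cycle of type \<open>B\<close> (right, weights \<open>y\<close>); afterwards the left cycle has type \<open>B\<close>.
\<close>

fun move :: "nat \<Rightarrow> cycle \<Rightarrow> cycle \<Rightarrow> tuple \<times> tuple \<rightharpoonup> tuple \<times> tuple" where
  "move n Whirl Whirl (x, y) =
     (let L = whurl_L n x y in
      if \<forall>i. L i \<noteq> 0
      then Some (\<lambda>i. y i * L (i + 1) / L i, \<lambda>i. x i * L i / L (i + 1))
      else None)"
| "move n Curl Curl (x, y) =
     (let K = whurl_K n x y in
      if \<forall>i. K i \<noteq> 0
      then Some (\<lambda>i. y i * K (i - 1) / K i, \<lambda>i. x i * K i / K (i - 1))
      else None)"
| "move n Whirl Curl (x, y) =
     (if \<forall>i. x i + y i \<noteq> 0
      then Some (\<lambda>i. y i * (x (i - 1) + y (i - 1)) / (x i + y i),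
                 \<lambda>i. x i * (x (i - 1) + y (i - 1)) / (x i + y i))
      else None)"
| "move n Curl Whirl (x, y) =
     (if \<forall>i. x i + y i \<noteq> 0
      then Some (\<lambda>i. y i * (x (i + 1) + y (i + 1)) / (x i + y i),
                 \<lambda>i. x i * (x (i + 1) + y (i + 1)) / (x i + y i))
      else None)"

text \<open>\<open>on_12 f\<close> is $f \times 1$ and \<open>on_23 f\<close> is $1 \times f$ on triple products.\<close>

definition on_12 :: "('p \<times> 'q \<rightharpoonup> 'a \<times> 'b) \<Rightarrow> 'p \<times> 'q \<times> 'r \<rightharpoonup> 'a \<times> 'b \<times> 'r" where
  "on_12 f = (\<lambda>(x, y, z). do {(x', y') \<leftarrow> f (x, y); Some (x', y', z)})"

definition on_23 :: "('q \<times> 'r \<rightharpoonup> 'a \<times> 'b) \<Rightarrow> 'p \<times> 'q \<times> 'r \<rightharpoonup> 'p \<times> 'a \<times> 'b" where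
  "on_23 f = (\<lambda>(x, y, z). do {(y', z') \<leftarrow> f (y, z); Some (x, y', z')})"

end

theory Submission
  imports Defs
begin

text \<open>
  Let \<open>T\<close> be the shift \<open>(T v) i = v (i + 1)\<close> on sequences indexed by the integers.  Attach to a
  whirl with weights \<open>x\<close> the difference operator \<open>T + x\<close>, and to a curl the inverse of \<open>T - x\<close>.
  Every move is then the refactorization of a product of two such operators in which the two
  periods \<open>\<Prod>i<n. x i\<close> and \<open>\<Prod>i<n. y i\<close> change places; after clearing inverses it is always one
  relation, \<open>(T + b) (T + a) = (T + b') (T + a')\<close> with \<open>a\<close> and \<open>a'\<close> nowhere equal, called
  \<open>lax_square\<close> below.  For two cycles of different type this relation is solved by a division.
  For two cycles of the same type it amounts to a first-order linear recursion for
  \<open>1 / (a - a')\<close>, whose periodic solution is unique when the two periods differ, and the sums \<open>L\<close> and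
  \<open>K\<close> solve it up to a scalar.  So wherever the periods of \<open>x\<close> and \<open>y\<close> differ, a move is
  characterized by a square (\<open>move_crossing\<close>, \<open>crossing_move\<close>), and everything else is
  proved about squares.

  Invertibility is then the symmetry of the square, which gives the birational inverse of
  \<open>move n A B\<close> as \<open>move n B A\<close>.  The functions \<open>\<epsilon>\<close> and \<open>\<phi>\<close> are read off from the coefficients of the
  product operator.  For \<open>e_i^c\<close> one checks that acting on both sides of a square gives a square
  again (\<open>act_crossing\<close>); as the action keeps the periods, uniqueness of the refactorization
  turns this into \<open>e_i^c \<circ> R = R \<circ> e_i^c\<close>.

  For the braid relation view the three cycles as the three directions of a cube whose edges
  carry operators \<open>T + a\<close> and whose faces are squares; a whirl is an edge followed along its
  orientation, a curl an edge followed backwards.  A product of three cycles is a path of three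
  edges, one in each direction, a move pushes the path across one face, and the two sides of the
  braid relation push the same path across the two complementary halves of the cube.  Three
  operators \<open>T + a\<close>, \<open>T + b\<close>, \<open>T + c\<close> leaving one corner determine the whole cube, because the two
  ways of computing an edge at distance two from that corner agree (\<open>lift_lift_swap\<close>).  Hence one half of
  the cube extends to the other (\<open>lax_cube\<close>) and both sides end in the same path.  Which half
  contains the three edges at the corner depends on the types of the cycles; reading the network
  from right to left exchanges the two halves, which leaves four of the eight type patterns
  (\<open>braid_crossings_left\<close>).

  The remaining work is to see that these generic identities are identities of rational maps.
  Compositions are defined on Zariski-open sets (\<open>rational_map_compose\<close>), the genericity
  conditions are nonvanishing conditions on regular functions, and all the open sets are nonempty
  since they contain explicit points with constant tuples as entries: on positive constants each move
  just exchanges the two tuples (\<open>move_const\<close>).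
\<close>

section \<open>Regular functions and rational maps\<close>

lemma openin_zariski_nonvanishing:
  "f \<in> polys (coords V) \<Longrightarrow> openin (zariski V) {p \<in> points V. f p \<noteq> 0}"
  unfolding zariski_def by (rule topology_generated_by_Basis) blast

lemma topspace_zariski [simp]: "topspace (zariski V) = points V"
proof -
  have "points V \<in> {{p \<in> points V. f p \<noteq> 0} | f. f \<in> polys (coords V)}"
    using polys.const[of 1 "coords V"] by (intro CollectI exI[of _ "\<lambda>_. 1"]) simp
  then have "\<Union>{{p \<in> points V. f p \<noteq> 0} | f. f \<in> polys (coords V)} = points V"
    by (intro equalityI Union_upper Union_least) auto
  then show ?thesis by (simp only: zariski_def topology_generated_by_topspace)
qed

lemma openin_zariski_points: "openin (zariski V) (points V)"
  using openin_topspace[of "zariski V"] by simp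

lemma regular_onI:
  assumes "\<And>p. p \<in> D \<Longrightarrow> \<exists>U a b. openin (zariski V) U \<and> p \<in> U \<and> U \<subseteq> D \<and>
    a \<in> polys (coords V) \<and> b \<in> polys (coords V) \<and> (\<forall>q\<in>U. b q \<noteq> 0 \<and> h q = a q / b q)"
  shows "regular_on V D h"
  unfolding regular_on_def
proof
  fix p assume "p \<in> D"
  from assms[OF this] obtain U a b where "openin (zariski V) U" "p \<in> U" "U \<subseteq> D"
    "a \<in> polys (coords V)" "b \<in> polys (coords V)" "\<forall>q\<in>U. b q \<noteq> 0 \<and> h q = a q / b q"
    by (elim exE conjE)
  then show "\<exists>U. openin (zariski V) U \<and> p \<in> U \<and> U \<subseteq> D \<and>
      (\<exists>a\<in>polys (coords V). \<exists>b\<in>polys (coords V). \<forall>q\<in>U. b q \<noteq> 0 \<and> h q = a q / b q)"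
    by (intro exI[of _ U] conjI bexI[of _ a] bexI[of _ b])
qed

lemma regular_onD:
  assumes "regular_on V D h" "p \<in> D"
  shows "\<exists>U a b. openin (zariski V) U \<and> p \<in> U \<and> U \<subseteq> D \<and>
    a \<in> polys (coords V) \<and> b \<in> polys (coords V) \<and> (\<forall>q\<in>U. b q \<noteq> 0 \<and> h q = a q / b q)"
proof -
  from bspec[OF assms(1)[unfolded regular_on_def] assms(2)]
  obtain U a b where "openin (zariski V) U" "p \<in> U" "U \<subseteq> D"
    "a \<in> polys (coords V)" "b \<in> polys (coords V)" "\<forall>q\<in>U. b q \<noteq> 0 \<and> h q = a q / b q"
    by (elim exE conjE bexE)
  then show ?thesis by (intro exI[of _ U] exI[of _ a] exI[of _ b] conjI)
qed

text \<open>
  Regularity is a local condition; this form allows the neighbourhood to carry any regularity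
  proof instead of a single fraction.
\<close>

lemma regular_on_local:
  assumes "\<And>p. p \<in> D \<Longrightarrow> \<exists>U. openin (zariski V) U \<and> p \<in> U \<and> U \<subseteq> D \<and> regular_on V U h"
  shows "regular_on V D h"
proof (rule regular_onI)
  fix p assume "p \<in> D"
  then obtain U where U: "p \<in> U" "U \<subseteq> D" "regular_on V U h" using assms by blast
  from regular_onD[OF U(3,1)] obtain U' a b where 1: "openin (zariski V) U'" "p \<in> U'" "U' \<subseteq> U"
    "a \<in> polys (coords V)" "b \<in> polys (coords V)"
    "\<forall>q\<in>U'. b q \<noteq> 0 \<and> h q = a q / b q"
    by (elim exE conjE)
  then show "\<exists>U a b. openin (zariski V) U \<and> p \<in> U \<and> U \<subseteq> D \<and>
      a \<in> polys (coords V) \<and> b \<in> polys (coords V) \<and> (\<forall>q\<in>U. b q \<noteq> 0 \<and> h q = a q / b q)"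
    using U(2) by (intro exI[of _ U'] exI[of _ a] exI[of _ b]) auto
qed

lemma regular_on_subset:
  assumes "regular_on V D h" "openin (zariski V) E" "E \<subseteq> D"
  shows "regular_on V E h"
proof (rule regular_onI)
  fix p assume p: "p \<in> E"
  then have "p \<in> D" using assms(3) by blast
  from regular_onD[OF assms(1) \<open>p \<in> D\<close>] obtain U a b where "openin (zariski V) U" "p \<in> U" "U \<subseteq> D"
    "a \<in> polys (coords V)" "b \<in> polys (coords V)"
    "\<forall>q\<in>U. b q \<noteq> 0 \<and> h q = a q / b q"
    by (elim exE conjE)
  with p assms(2) show "\<exists>U a b. openin (zariski V) U \<and> p \<in> U \<and> U \<subseteq> E \<and>
      a \<in> polys (coords V) \<and> b \<in> polys (coords V) \<and> (\<forall>q\<in>U. b q \<noteq> 0 \<and> h q = a q / b q)"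
    by (intro exI[of _ "U \<inter> E"] exI[of _ a] exI[of _ b]) auto
qed

lemma regular_on_cong:
  "(\<And>p. p \<in> D \<Longrightarrow> g p = h p) \<Longrightarrow> regular_on V D g \<longleftrightarrow> regular_on V D h"
  unfolding regular_on_def by (intro ball_cong refl ex_cong1 conj_cong bex_cong) auto

lemma regular_on_poly:
  assumes "openin (zariski V) D" "f \<in> polys (coords V)"
  shows "regular_on V D f"
  using assms polys.const[of 1 "coords V"]
  by (intro regular_onI exI[of _ D] exI[of _ f] exI[of _ "\<lambda>_. 1"]) simp

lemma regular_on_const: "openin (zariski V) D \<Longrightarrow> regular_on V D (\<lambda>_. c)"
  by (intro regular_on_poly polys.const)

lemma regular_on_coord: "openin (zariski V) D \<Longrightarrow> h \<in> coords V \<Longrightarrow> regular_on V D h"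
  by (intro regular_on_poly polys.coord)

lemma regular_on_add:
  assumes "regular_on V D g" "regular_on V D h"
  shows "regular_on V D (\<lambda>p. g p + h p)"
proof (rule regular_onI)
  fix p assume p: "p \<in> D"
  from regular_onD[OF assms(1) p] obtain U a b where 1: "openin (zariski V) U" "p \<in> U" "U \<subseteq> D"
    "a \<in> polys (coords V)" "b \<in> polys (coords V)"
    "\<forall>q\<in>U. b q \<noteq> 0 \<and> g q = a q / b q"
    by (elim exE conjE)
  from regular_onD[OF assms(2) p] obtain U' a' b' where 2: "openin (zariski V) U'" "p \<in> U'" "U' \<subseteq> D"
    "a' \<in> polys (coords V)" "b' \<in> polys (coords V)"
    "\<forall>q\<in>U'. b' q \<noteq> 0 \<and> h q = a' q / b' q"
    by (elim exE conjE)
  have "(\<lambda>q. a q * b' q + a' q * b q) \<in> polys (coords V)" "(\<lambda>q. b q * b' q) \<in> polys (coords V)"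
    by (intro polys.add polys.mult 1 2)+
  moreover have "b q * b' q \<noteq> 0 \<and> g q + h q = (a q * b' q + a' q * b q) / (b q * b' q)"
    if "q \<in> U \<inter> U'" for q
    using 1(6) 2(6) that by (auto simp: field_simps)
  ultimately show "\<exists>U a b. openin (zariski V) U \<and> p \<in> U \<and> U \<subseteq> D \<and>
      a \<in> polys (coords V) \<and> b \<in> polys (coords V) \<and> (\<forall>q\<in>U. b q \<noteq> 0 \<and> g q + h q = a q / b q)"
    using 1(1-3) 2(1-3)
    by (intro exI[of _ "U \<inter> U'"] exI[of _ "\<lambda>q. a q * b' q + a' q * b q"]
          exI[of _ "\<lambda>q. b q * b' q"]) auto
qed

lemma regular_on_mult:
  assumes "regular_on V D g" "regular_on V D h"
  shows "regular_on V D (\<lambda>p. g p * h p)"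
proof (rule regular_onI)
  fix p assume p: "p \<in> D"
  from regular_onD[OF assms(1) p] obtain U a b where 1: "openin (zariski V) U" "p \<in> U" "U \<subseteq> D"
    "a \<in> polys (coords V)" "b \<in> polys (coords V)"
    "\<forall>q\<in>U. b q \<noteq> 0 \<and> g q = a q / b q"
    by (elim exE conjE)
  from regular_onD[OF assms(2) p] obtain U' a' b' where 2: "openin (zariski V) U'" "p \<in> U'" "U' \<subseteq> D"
    "a' \<in> polys (coords V)" "b' \<in> polys (coords V)"
    "\<forall>q\<in>U'. b' q \<noteq> 0 \<and> h q = a' q / b' q"
    by (elim exE conjE)
  have "(\<lambda>q. a q * a' q) \<in> polys (coords V)" "(\<lambda>q. b q * b' q) \<in> polys (coords V)"
    by (intro polys.add polys.mult 1 2)+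
  moreover have "b q * b' q \<noteq> 0 \<and> g q * h q = (a q * a' q) / (b q * b' q)"
    if "q \<in> U \<inter> U'" for q
    using 1(6) 2(6) that by auto
  ultimately show "\<exists>U a b. openin (zariski V) U \<and> p \<in> U \<and> U \<subseteq> D \<and>
      a \<in> polys (coords V) \<and> b \<in> polys (coords V) \<and> (\<forall>q\<in>U. b q \<noteq> 0 \<and> g q * h q = a q / b q)"
    using 1(1-3) 2(1-3)
    by (intro exI[of _ "U \<inter> U'"] exI[of _ "\<lambda>q. a q * a' q"]
          exI[of _ "\<lambda>q. b q * b' q"]) auto
qed

lemma regular_on_inverse:
  assumes "regular_on V D h" "\<And>p. p \<in> D \<Longrightarrow> h p \<noteq> 0"
  shows "regular_on V D (\<lambda>p. inverse (h p))"
proof (rule regular_onI)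
  fix p assume p: "p \<in> D"
  from regular_onD[OF assms(1) p] obtain U a b where 1: "openin (zariski V) U" "p \<in> U" "U \<subseteq> D"
    "a \<in> polys (coords V)" "b \<in> polys (coords V)"
    "\<forall>q\<in>U. b q \<noteq> 0 \<and> h q = a q / b q"
    by (elim exE conjE)
  have "a q \<noteq> 0 \<and> inverse (h q) = b q / a q" if q: "q \<in> U" for q
  proof -
    have "h q \<noteq> 0" using assms(2) 1(3) q by blast
    with 1(6) q show ?thesis by auto
  qed
  with 1(1-5) show "\<exists>U a b. openin (zariski V) U \<and> p \<in> U \<and> U \<subseteq> D \<and>
      a \<in> polys (coords V) \<and> b \<in> polys (coords V) \<and> (\<forall>q\<in>U. b q \<noteq> 0 \<and> inverse (h q) = a q / b q)"
    by (intro exI[of _ U] exI[of _ b] exI[of _ a] conjI ballI) simp_all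
qed

lemma regular_on_divide:
  assumes "regular_on V D g" "regular_on V D h" "\<And>p. p \<in> D \<Longrightarrow> h p \<noteq> 0"
  shows "regular_on V D (\<lambda>p. g p / h p)"
  unfolding divide_inverse by (intro regular_on_mult regular_on_inverse assms)

lemma regular_on_diff:
  assumes "openin (zariski V) D" "regular_on V D g" "regular_on V D h"
  shows "regular_on V D (\<lambda>p. g p - h p)"
  using regular_on_add[OF assms(2) regular_on_mult[OF regular_on_const[OF assms(1), of "-1"] assms(3)]]
  by simp

lemma regular_on_sum:
  assumes "openin (zariski V) D" "\<And>i. i \<in> I \<Longrightarrow> regular_on V D (h i)"
  shows "regular_on V D (\<lambda>p. \<Sum>i\<in>I. h i p)"
  using assms
  by (induction I rule: infinite_finite_induct) (auto intro: regular_on_const regular_on_add)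

lemma regular_on_prod:
  assumes "openin (zariski V) D" "\<And>i. i \<in> I \<Longrightarrow> regular_on V D (h i)"
  shows "regular_on V D (\<lambda>p. \<Prod>i\<in>I. h i p)"
  using assms
  by (induction I rule: infinite_finite_induct) (auto intro: regular_on_const regular_on_mult)

text \<open>
  Locally the function is a fraction, so its zero set is that of the numerator.  All openness
  statements about genericity conditions below come from here.
\<close>

lemma openin_nonvanishing:
  assumes "openin (zariski V) D" "regular_on V D h"
  shows "openin (zariski V) {p \<in> D. h p \<noteq> 0}"
proof (subst openin_subopen, clarify)
  fix p assume p: "p \<in> D" "h p \<noteq> 0"
  from regular_onD[OF assms(2) p(1)] obtain U a b where 1: "openin (zariski V) U" "p \<in> U" "U \<subseteq> D"
    "a \<in> polys (coords V)" "b \<in> polys (coords V)"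
    "\<forall>q\<in>U. b q \<noteq> 0 \<and> h q = a q / b q"
    by (elim exE conjE)
  have "openin (zariski V) (U \<inter> {q \<in> points V. a q \<noteq> 0})"
    using 1 by (intro openin_Int openin_zariski_nonvanishing)
  moreover have "p \<in> U \<inter> {q \<in> points V. a q \<noteq> 0}"
    using 1 p openin_subset[OF assms(1)] by auto
  moreover have "U \<inter> {q \<in> points V. a q \<noteq> 0} \<subseteq> {p \<in> D. h p \<noteq> 0}"
    using 1 by auto
  ultimately show "\<exists>T. openin (zariski V) T \<and> p \<in> T \<and> T \<subseteq> {p \<in> D. h p \<noteq> 0}" by blast
qed

lemma rational_mapD:
  assumes "rational_map V W f"
  shows "openin (zariski V) (dom f \<inter> points V)"
    and "\<And>p. p \<in> dom f \<inter> points V \<Longrightarrow> the (f p) \<in> points W"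
    and "\<And>h. h \<in> coords W \<Longrightarrow> regular_on V (dom f \<inter> points V) (\<lambda>p. h (the (f p)))"
  using assms unfolding rational_map_def by (auto simp: Let_def)

lemma regular_on_poly_rational_map:
  assumes "rational_map V W f" "g \<in> polys (coords W)"
  shows "regular_on V (dom f \<inter> points V) (\<lambda>p. g (the (f p)))"
  using assms(2)
  by induction (use rational_mapD[OF assms(1)] in
    \<open>auto intro: regular_on_const regular_on_add regular_on_mult\<close>)

text \<open>
  Rational maps are continuous on their domain: it is enough to pull back the basic open sets
  \<open>{q. g q \<noteq> 0}\<close> with \<open>g\<close> a polynomial, and such a pullback is the nonvanishing set of the regular
  function \<open>g \<circ> f\<close>.
\<close>

lemma openin_rational_preimage:
  assumes f: "rational_map V W f" and E: "openin (zariski W) E"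
  shows "openin (zariski V) {p \<in> dom f \<inter> points V. the (f p) \<in> E}"
proof -
  let ?D = "dom f \<inter> points V"
  have "continuous_map (subtopology (zariski V) ?D) (zariski W) (\<lambda>p. the (f p))"
    unfolding zariski_def[of W]
  proof (rule continuous_on_generated_topo)
    fix U assume "U \<in> {{p \<in> points W. g p \<noteq> 0} |g. g \<in> polys (coords W)}"
    then obtain g where g: "g \<in> polys (coords W)" and U: "U = {p \<in> points W. g p \<noteq> 0}" by blast
    have "openin (zariski V) {p \<in> ?D. g (the (f p)) \<noteq> 0}"
      using f g by (intro openin_nonvanishing regular_on_poly_rational_map rational_mapD)
    moreover have "{p \<in> ?D. g (the (f p)) \<noteq> 0} = (\<lambda>p. the (f p)) -` U \<inter> ?D"
      using rational_mapD(2)[OF f] unfolding U by auto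
    ultimately show "openin (subtopology (zariski V) ?D)
        ((\<lambda>p. the (f p)) -` U \<inter> topspace (subtopology (zariski V) ?D))"
      by (auto simp: openin_subtopology Int_assoc)
  next
    have "(\<lambda>p. the (f p)) ` topspace (subtopology (zariski V) ?D) \<subseteq> topspace (zariski W)"
      using rational_mapD(2)[OF f] by auto
    then show "(\<lambda>p. the (f p)) ` topspace (subtopology (zariski V) ?D)
        \<subseteq> \<Union> {{p \<in> points W. g p \<noteq> 0} |g. g \<in> polys (coords W)}"
      unfolding zariski_def[of W] topology_generated_by_topspace .
  qed
  from openin_continuous_map_preimage[OF this E]
  have "openin (subtopology (zariski V) ?D) {p \<in> ?D. the (f p) \<in> E}" by (simp add: Int_ac)
  then show ?thesis using openin_open_subtopology rational_mapD(1)[OF f] by blast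
qed

text \<open>
  Near a point, \<open>h\<close> is a fraction of polynomials \<open>a / b\<close>, and \<open>a \<circ> f\<close>, \<open>b \<circ> f\<close> are regular on the
  open preimage of that neighbourhood.
\<close>

lemma regular_on_compose:
  assumes f: "rational_map V W f" and E: "openin (zariski W) E" and h: "regular_on W E h"
  shows "regular_on V {p \<in> dom f \<inter> points V. the (f p) \<in> E} (\<lambda>p. h (the (f p)))"
proof (rule regular_on_local)
  let ?D = "dom f \<inter> points V"
  fix p assume p: "p \<in> {p \<in> ?D. the (f p) \<in> E}"
  then have "the (f p) \<in> E" by simp
  from regular_onD[OF h \<open>the (f p) \<in> E\<close>] obtain U a b where 1: "openin (zariski W) U" "the (f p) \<in> U" "U \<subseteq> E"
    "a \<in> polys (coords W)" "b \<in> polys (coords W)"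
    "\<forall>q\<in>U. b q \<noteq> 0 \<and> h q = a q / b q"
    by (elim exE conjE)
  let ?U = "{p \<in> ?D. the (f p) \<in> U}"
  have U: "openin (zariski V) ?U" by (rule openin_rational_preimage[OF f 1(1)])
  have "regular_on V ?U (\<lambda>p. g (the (f p)))" if "g \<in> polys (coords W)" for g
    using regular_on_poly_rational_map[OF f that] U by (rule regular_on_subset) blast
  then have "regular_on V ?U (\<lambda>p. a (the (f p)) / b (the (f p)))"
    using 1 by (intro regular_on_divide) auto
  then have "regular_on V ?U (\<lambda>p. h (the (f p)))"
    using 1(6) by (subst regular_on_cong[where h = "\<lambda>p. a (the (f p)) / b (the (f p))"]) auto
  then show "\<exists>U. openin (zariski V) U \<and> p \<in> U \<and> U \<subseteq> {p \<in> ?D. the (f p) \<in> E} \<and>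
      regular_on V U (\<lambda>p. h (the (f p)))"
    using U p 1(2,3) by (intro exI[of _ ?U]) auto
qed

text \<open>
  The point \<open>p\<close> is there because the composite of two rational maps may be nowhere defined.
\<close>

lemma rational_map_compose:
  assumes f: "rational_map V W f" and g: "rational_map W Z g"
    and p: "p \<in> points V" "f p = Some q" "g q = Some r"
  shows "rational_map V Z (g \<circ>\<^sub>m f)"
proof -
  let ?E = "dom g \<inter> points W"
  have D: "dom (g \<circ>\<^sub>m f) \<inter> points V = {p \<in> dom f \<inter> points V. the (f p) \<in> ?E}"
    using rational_mapD(2)[OF f] by (fastforce simp: map_comp_def split: option.splits)
  have *: "the ((g \<circ>\<^sub>m f) p) = the (g (the (f p)))" if "p \<in> dom (g \<circ>\<^sub>m f) \<inter> points V" for p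
    using that by (auto simp: map_comp_def split: option.splits)
  show ?thesis unfolding rational_map_def Let_def
  proof (intro conjI ballI)
    show "openin (zariski V) (dom (g \<circ>\<^sub>m f) \<inter> points V)"
      unfolding D using openin_rational_preimage[OF f rational_mapD(1)[OF g]] .
    have "p \<in> dom (g \<circ>\<^sub>m f) \<inter> points V" using p by (simp add: map_comp_def dom_def)
    then show "dom (g \<circ>\<^sub>m f) \<inter> points V \<noteq> {}" by blast
    show "the ((g \<circ>\<^sub>m f) p) \<in> points Z" if "p \<in> dom (g \<circ>\<^sub>m f) \<inter> points V" for p
      using that rational_mapD(2)[OF g] *[OF that] unfolding D by auto
    show "regular_on V (dom (g \<circ>\<^sub>m f) \<inter> points V) (\<lambda>p. h (the ((g \<circ>\<^sub>m f) p)))"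
      if "h \<in> coords Z" for h
      using regular_on_compose[OF f rational_mapD(1)[OF g] rational_mapD(3)[OF g that]]
      by (subst regular_on_cong[where h = "\<lambda>p. h (the (g (the (f p))))"]) (simp_all add: D *)
  qed
qed

lemma rational_map_total:
  assumes "\<And>p. p \<in> points V \<Longrightarrow> f p \<in> points W" "\<And>h. h \<in> coords W \<Longrightarrow> h \<circ> f \<in> coords V"
    "points V \<noteq> {}"
  shows "rational_map V W (\<lambda>p. Some (f p))"
  using assms openin_zariski_points[of V] regular_on_coord[OF openin_zariski_points[of V]]
  by (auto simp: rational_map_def Let_def dom_def comp_def)

lemma points_prod_variety [simp]: "points (prod_variety V W) = points V \<times> points W"
  and coords_prod_variety [simp]: "coords (prod_variety V W) = prod_coords (coords V) (coords W)"
  by (simp_all add: prod_variety_def)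

lemma prod_coordsE:
  assumes "h \<in> prod_coords C D"
  obtains g where "g \<in> C" "h = g \<circ> fst" | g where "g \<in> D" "h = g \<circ> snd"
  using assms by (auto simp: prod_coords_def)

lemma prod_coords_fst: "g \<in> C \<Longrightarrow> g \<circ> fst \<in> prod_coords C D"
  by (auto simp: prod_coords_def)

lemma prod_coords_snd: "g \<in> D \<Longrightarrow> g \<circ> snd \<in> prod_coords C D"
  by (auto simp: prod_coords_def)

text \<open>
  The first two components of the new map are those of \<open>f\<close> after the projection forgetting the
  third factor, and the third is a projection, so regularity follows by composition.
\<close>

lemma rational_map_on_12:
  assumes f: "rational_map (prod_variety V W) (prod_variety V' W') f" and "points Z \<noteq> {}"
  shows "rational_map (prod_variety V (prod_variety W Z)) (prod_variety V' (prod_variety W' Z))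
    (on_12 f)"
proof -
  let ?V = "prod_variety V (prod_variety W Z)"
  let ?D = "dom (on_12 f) \<inter> points ?V"
  define \<pi> :: "'a \<times> 'b \<times> 'i \<Rightarrow> ('a \<times> 'b) option" where "\<pi> = (\<lambda>p. Some (fst p, fst (snd p)))"
  obtain p0 where p0: "p0 \<in> dom f \<inter> points (prod_variety V W)"
    using f unfolding rational_map_def Let_def by blast
  obtain z0 where z0: "z0 \<in> points Z" using assms(2) by blast
  have \<pi>: "rational_map ?V (prod_variety V W) \<pi>"
    unfolding \<pi>_def
  proof (rule rational_map_total)
    show "h \<circ> (\<lambda>p. (fst p, fst (snd p))) \<in> coords ?V" if "h \<in> coords (prod_variety V W)" for h
    proof -
      from that have "h \<in> prod_coords (coords V) (coords W)" by simp
      then show ?thesis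
      proof (cases rule: prod_coordsE)
        case (1 g)
        then have eq: "h \<circ> (\<lambda>p. (fst p, fst (snd p))) = g \<circ> fst" by auto
        show ?thesis unfolding eq using 1 by (simp add: prod_coords_fst)
      next
        case (2 g)
        then have eq: "h \<circ> (\<lambda>p. (fst p, fst (snd p))) = (g \<circ> fst) \<circ> snd" by auto
        show ?thesis unfolding eq using 2 by (simp add: prod_coords_fst prod_coords_snd)
      qed
    qed
  qed (use p0 z0 in auto)
  have D: "?D = {p \<in> dom \<pi> \<inter> points ?V. the (\<pi> p) \<in> dom f \<inter> points (prod_variety V W)}"
    by (force simp: \<pi>_def on_12_def split: Option.bind_splits)
  have val: "the (on_12 f p) = (fst (the (f (the (\<pi> p)))), snd (the (f (the (\<pi> p)))), snd (snd p))"
    if "p \<in> ?D" for p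
    using that by (auto simp: \<pi>_def on_12_def split: Option.bind_splits)
  have reg: "regular_on ?V ?D (\<lambda>p. h (the (f (the (\<pi> p)))))"
    if "h \<in> coords (prod_variety V' W')" for h
    unfolding D using regular_on_compose[OF \<pi> rational_mapD(1)[OF f] rational_mapD(3)[OF f that]] .
  have open_D: "openin (zariski ?V) ?D"
    unfolding D by (rule openin_rational_preimage[OF \<pi> rational_mapD(1)[OF f]])
  show ?thesis unfolding rational_map_def Let_def
  proof (intro conjI ballI)
    show "?D \<noteq> {}"
      unfolding D using p0 z0
      by (auto simp: \<pi>_def intro!: exI[of _ "fst p0"] exI[of _ "snd p0"] exI[of _ z0])
    show "the (on_12 f p) \<in> points (prod_variety V' (prod_variety W' Z))" if "p \<in> ?D" for p
      unfolding val[OF that] using that rational_mapD(2)[OF f, of "the (\<pi> p)"] unfolding D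
      by (auto simp: mem_Times_iff)
    show "regular_on ?V ?D (\<lambda>p. h (the (on_12 f p)))"
      if h: "h \<in> coords (prod_variety V' (prod_variety W' Z))" for h
    proof -
      from h have "h \<in> prod_coords (coords V') (prod_coords (coords W') (coords Z))" by simp
      then consider g where "g \<in> coords V'" "h = g \<circ> fst" | g where "g \<in> coords W'" "h = g \<circ> fst \<circ> snd"
        | g where "g \<in> coords Z" "h = g \<circ> snd \<circ> snd"
        by (auto simp: prod_coords_def)
      then show ?thesis
      proof cases
        case (1 g)
        show ?thesis
          using reg[of "g \<circ> fst"] 1
          by (subst regular_on_cong[where h = "\<lambda>p. g (fst (the (f (the (\<pi> p)))))"])
            (auto simp: val prod_coords_fst)
      next
        case (2 g)
        show ?thesis
          using reg[of "g \<circ> snd"] 2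
          by (subst regular_on_cong[where h = "\<lambda>p. g (snd (the (f (the (\<pi> p)))))"])
            (auto simp: val prod_coords_snd)
      next
        case (3 g)
        have "(g \<circ> snd) \<circ> snd \<in> coords ?V"
          unfolding coords_prod_variety by (intro prod_coords_snd 3(1))
        then have "regular_on ?V ?D (\<lambda>p. g (snd (snd p)))"
          using regular_on_coord[OF open_D] by (fastforce simp: comp_def)
        then show ?thesis
          using 3 by (subst regular_on_cong[where h = "\<lambda>p. g (snd (snd p))"]) (auto simp: val)
      qed
    qed
  qed (rule open_D)
qed

lemma rational_map_on_23:
  assumes f: "rational_map (prod_variety W Z) (prod_variety W' Z') f" and "points V \<noteq> {}"
  shows "rational_map (prod_variety V (prod_variety W Z)) (prod_variety V (prod_variety W' Z'))
    (on_23 f)"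
proof -
  let ?V = "prod_variety V (prod_variety W Z)"
  let ?D = "dom (on_23 f) \<inter> points ?V"
  define \<pi> :: "'i \<times> 'a \<times> 'b \<Rightarrow> ('a \<times> 'b) option" where "\<pi> = (\<lambda>p. Some (snd p))"
  obtain p0 where p0: "p0 \<in> dom f \<inter> points (prod_variety W Z)"
    using f unfolding rational_map_def Let_def by blast
  obtain v0 where v0: "v0 \<in> points V" using assms(2) by blast
  have \<pi>: "rational_map ?V (prod_variety W Z) \<pi>"
    unfolding \<pi>_def
    by (rule rational_map_total) (use p0 v0 in \<open>auto simp: prod_coords_snd\<close>)
  have D: "?D = {p \<in> dom \<pi> \<inter> points ?V. the (\<pi> p) \<in> dom f \<inter> points (prod_variety W Z)}"
    by (force simp: \<pi>_def on_23_def split: Option.bind_splits)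
  have val: "the (on_23 f p) = (fst p, the (f (the (\<pi> p))))" if "p \<in> ?D" for p
    using that by (auto simp: \<pi>_def on_23_def split: Option.bind_splits)
  have reg: "regular_on ?V ?D (\<lambda>p. h (the (f (the (\<pi> p)))))"
    if "h \<in> coords (prod_variety W' Z')" for h
    unfolding D using regular_on_compose[OF \<pi> rational_mapD(1)[OF f] rational_mapD(3)[OF f that]] .
  have open_D: "openin (zariski ?V) ?D"
    unfolding D by (rule openin_rational_preimage[OF \<pi> rational_mapD(1)[OF f]])
  show ?thesis unfolding rational_map_def Let_def
  proof (intro conjI ballI)
    show "?D \<noteq> {}"
      unfolding D using p0 v0
      by (auto simp: \<pi>_def intro!: exI[of _ "fst p0"] exI[of _ "snd p0"] exI[of _ v0])
    show "the (on_23 f p) \<in> points (prod_variety V (prod_variety W' Z'))" if "p \<in> ?D" for p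
      unfolding val[OF that] using that rational_mapD(2)[OF f, of "the (\<pi> p)"] unfolding D
      by (auto simp: mem_Times_iff)
    show "regular_on ?V ?D (\<lambda>p. h (the (on_23 f p)))"
      if h: "h \<in> coords (prod_variety V (prod_variety W' Z'))" for h
    proof -
      from h have "h \<in> prod_coords (coords V) (coords (prod_variety W' Z'))" by simp
      then show ?thesis
      proof (cases rule: prod_coordsE)
        case (1 g)
        have "regular_on ?V ?D (\<lambda>p. g (fst p))"
          using regular_on_coord[OF open_D, of "g \<circ> fst"] 1
          by (simp add: prod_coords_fst) (simp add: comp_def)
        then show ?thesis
          using 1 by (subst regular_on_cong[where h = "\<lambda>p. g (fst p)"]) (auto simp: val)
      next
        case (2 g)
        then show ?thesis
          using reg[of g]
          by (subst regular_on_cong[where h = "\<lambda>p. g (the (f (the (\<pi> p))))"]) (auto simp: val)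
      qed
    qed
  qed (rule open_D)
qed

lemma rat_eqI:
  assumes "openin (zariski V) U" "p \<in> U" "\<And>q. q \<in> U \<Longrightarrow> \<exists>r. f q = Some r \<and> g q = Some r"
  shows "rat_eq V f g"
  using assms unfolding rat_eq_def by blast

section \<open>Periodic tuples and the recursions for the whurl sums\<close>

definition periodic :: "nat \<Rightarrow> tuple \<Rightarrow> bool" where
  "periodic n x \<longleftrightarrow> (\<forall>i. x (i + int n) = x i)"

text \<open>
  The period of a tuple.  It is the spectral invariant of a cycle: up to the sign \<open>(-1)^n\<close> it
  is the number \<open>\<lambda>\<close> for which solutions of \<open>v (i + 1) + x i * v i = 0\<close> satisfy
  \<open>v (i + n) = \<lambda> * v i\<close>.
\<close>

definition period_prod :: "nat \<Rightarrow> tuple \<Rightarrow> complex" where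
  "period_prod n x = (\<Prod>j<n. x (int j))"

lemma torus_iff: "x \<in> torus n \<longleftrightarrow> (\<forall>i. x i \<noteq> 0) \<and> periodic n x"
  by (auto simp: torus_def periodic_def)

lemma torus_uminus: "(\<lambda>i. - x i) \<in> torus n \<longleftrightarrow> x \<in> torus n"
  by (simp add: torus_def)

lemma periodic_shift: "periodic n x \<Longrightarrow> periodic n (\<lambda>i. x (i + k))"
  by (simp add: periodic_def algebra_simps) (metis add.assoc add.commute)

lemma periodic_cong:
  assumes "periodic n x" "[i = j] (mod int n)"
  shows "x i = x j"
proof -
  have step: "x (i + int n * int m) = x i" for i m
  proof (induction m)
    case (Suc m)
    have "x (i + int n * int (Suc m)) = x ((i + int n * int m) + int n)"
      by (simp add: algebra_simps)
    then show ?case using assms(1) Suc by (simp add: periodic_def)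
  qed simp
  obtain k where k: "j = i + int n * k" using assms(2) by (metis cong_iff_lin)
  show ?thesis
  proof (cases "k \<ge> 0")
    case True
    then show ?thesis using k step[of i "nat k"] by simp
  next
    case False
    then show ?thesis using k step[of j "nat (- k)"] by simp
  qed
qed

lemma period_prod_shift:
  assumes "periodic n x"
  shows "(\<Prod>j<n. x (i + int j)) = period_prod n x"
proof -
  have step: "(\<Prod>j<n. x (k + 1 + int j)) = (\<Prod>j<n. x (k + int j))" for k
  proof (cases n)
    case (Suc m)
    have "(\<Prod>j<n. x (k + 1 + int j)) = (\<Prod>j<m. x (k + int (Suc j))) * x (k + int n)"
      unfolding Suc prod.lessThan_Suc by (simp add: algebra_simps)
    also have "x (k + int n) = x k" using assms by (simp add: periodic_def)
    also have "(\<Prod>j<m. x (k + int (Suc j))) * x k = (\<Prod>j<n. x (k + int j))"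
      unfolding Suc prod.lessThan_Suc_shift by simp
    finally show ?thesis .
  qed simp
  show ?thesis unfolding period_prod_def
  proof (induction i rule: int_induct[of _ 0])
    case (step1 i)
    then show ?case using step[of i] by simp
  next
    case (step2 i)
    then show ?case using step[of "i - 1"] by simp
  qed simp
qed

lemma period_prod_uminus: "period_prod n (\<lambda>i. - x i) = (-1) ^ n * period_prod n x"
proof -
  have "period_prod n (\<lambda>i. - x i) = (\<Prod>j<n. (-1) * x (int j))" by (simp add: period_prod_def)
  then show ?thesis unfolding prod.distrib by (simp add: period_prod_def)
qed

lemma linear_recursion_iterate:
  fixes a b e :: tuple
  assumes "\<And>i. a i * e i = b i * e (i + 1)"
  shows "(\<Prod>j<m. a (i + int j)) * e i = (\<Prod>j<m. b (i + int j)) * e (i + int m)"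
proof (induction m)
  case (Suc m)
  have "(\<Prod>j<Suc m. a (i + int j)) * e i = ((\<Prod>j<m. a (i + int j)) * e i) * a (i + int m)" by simp
  also have "\<dots> = (\<Prod>j<m. b (i + int j)) * (a (i + int m) * e (i + int m))"
    unfolding Suc.IH by simp
  also have "\<dots> = (\<Prod>j<Suc m. b (i + int j)) * e (i + int (Suc m))"
    unfolding assms by (simp add: algebra_simps)
  finally show ?case .
qed simp

text \<open>
  Going once around the cylinder multiplies both sides by the respective period.  When the two
  periods differ, a periodic \<open>e\<close> must vanish; this is the source of all uniqueness statements.
\<close>

lemma linear_recursion_period:
  fixes a b e :: tuple
  assumes "periodic n a" "periodic n b" "periodic n e" "\<And>i. a i * e i = b i * e (i + 1)"
  shows "period_prod n a * e i = period_prod n b * e i"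
  using linear_recursion_iterate[where a = a and b = b and e = e and m = n and i = i, OF assms(4)] assms(1-3)
  by (simp add: period_prod_shift) (simp add: periodic_def)

text \<open>
  Multiplying the summands of \<open>L i\<close> by \<open>x i\<close>, and those of \<open>L (i + 1)\<close> by \<open>y i\<close>, gives products
  \<open>g s\<close> of \<open>s\<close> consecutive entries of \<open>y\<close> and \<open>n - s\<close> consecutive entries of \<open>x\<close>, once for
  \<open>s = 0, \<dots>, n - 1\<close> and once for \<open>s = 1, \<dots>, n\<close>.  The difference telescopes to the two periods.
\<close>

lemma whurl_L_recursion:
  assumes "n \<ge> 1" "periodic n x" "periodic n y"
  shows "x i * whurl_L n x y i - y i * whurl_L n x y (i + 1) = period_prod n x - period_prod n y"
proof -
  obtain m where n: "n = Suc m" using assms(1) by (cases n) auto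
  define g where "g s = (\<Prod>r = 1..s. y (i + int r - 1)) * (\<Prod>r = s+1..n. x (i + int r))" for s
  have "x i * whurl_L n x y i = (\<Sum>s = 0..m. g s)"
    unfolding whurl_L_def sum_distrib_left n diff_Suc_1
  proof (rule sum.cong)
    fix s assume "s \<in> {0..m}"
    moreover have "x (i + int (Suc m)) = x i" using assms(2) unfolding periodic_def n by blast
    ultimately show "x i * ((\<Prod>r = 1..s. y (i + int r - 1)) * (\<Prod>r = s+1..m. x (i + int r))) = g s"
      unfolding g_def n by (subst prod.cl_ivl_Suc) simp
  qed simp
  moreover have "y i * whurl_L n x y (i + 1) = (\<Sum>s = 0..m. g (Suc s))"
    unfolding whurl_L_def sum_distrib_left n diff_Suc_1
  proof (rule sum.cong)
    fix s assume "s \<in> {0..m}"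
    have "(\<Prod>r = 1..Suc s. y (i + int r - 1)) = y i * (\<Prod>r = 1..s. y (i + 1 + int r - 1))"
      using prod.atLeast_Suc_atMost[of 1 "Suc s" "\<lambda>r. y (i + int r - 1)"]
        prod.shift_bounds_cl_Suc_ivl[of "\<lambda>r. y (i + int r - 1)" 1 s] by (simp add: algebra_simps)
    moreover have "(\<Prod>r = Suc s + 1..n. x (i + int r)) = (\<Prod>r = s + 1..m. x (i + 1 + int r))"
      using prod.shift_bounds_cl_Suc_ivl[of "\<lambda>r. x (i + int r)" "s + 1" m]
      unfolding n by (simp add: algebra_simps)
    ultimately show "y i * ((\<Prod>r = 1..s. y (i + 1 + int r - 1)) * (\<Prod>r = s+1..m. x (i + 1 + int r)))
        = g (Suc s)" unfolding g_def by simp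
  qed simp
  moreover have "(\<Sum>s = 0..m. g s) - (\<Sum>s = 0..m. g (Suc s)) = g 0 - g n"
    unfolding n sum_subtractf[symmetric] using sum_telescope[of g m] by (simp add: atMost_atLeast0)
  moreover have "g 0 = period_prod n x"
    using period_prod_shift[OF assms(2), of "i + 1"] unfolding g_def
    by (simp add: prod.atLeast1_atMost_eq add.assoc)
  moreover have "g n = period_prod n y"
    using period_prod_shift[OF assms(3), of i] unfolding g_def by (simp add: prod.atLeast1_atMost_eq)
  ultimately show ?thesis by simp
qed

text \<open>
  The formula for curls is the one for whirls with the horizontal wires numbered in the
  opposite direction, so its recursion is inherited.
\<close>

lemma whurl_K_reflect: "whurl_K n x y i = whurl_L n (\<lambda>j. x (- j)) (\<lambda>j. y (- j)) (- i)"
  unfolding whurl_K_def whurl_L_def by (simp add: algebra_simps)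

lemma periodic_reflect: "periodic n x \<Longrightarrow> periodic n (\<lambda>j. x (- j))"
  unfolding periodic_def by (metis add_diff_cancel minus_add_distrib uminus_add_conv_diff diff_conv_add_uminus)

lemma period_prod_reflect:
  assumes "periodic n x"
  shows "period_prod n (\<lambda>j. x (- j)) = period_prod n x"
proof -
  have "period_prod n x = (\<Prod>j<n. x (1 - int n + int j))"
    using period_prod_shift[OF assms] by simp
  also have "\<dots> = (\<Prod>j<n. x (1 - int n + int (n - Suc j)))"
    by (rule prod.nat_diff_reindex[symmetric])
  also have "\<dots> = period_prod n (\<lambda>j. x (- j))"
    unfolding period_prod_def by (intro prod.cong) (auto simp: of_nat_diff)
  finally show ?thesis by simp
qed

lemma whurl_K_recursion:
  assumes "n \<ge> 1" "periodic n x" "periodic n y"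
  shows "x i * whurl_K n x y i - y i * whurl_K n x y (i - 1) = period_prod n x - period_prod n y"
  using whurl_L_recursion[OF assms(1) periodic_reflect[OF assms(2)] periodic_reflect[OF assms(3)], of "- i"]
  unfolding whurl_K_reflect period_prod_reflect[OF assms(2)] period_prod_reflect[OF assms(3)]
  by simp

lemma periodic_whurl_L:
  assumes "periodic n x" "periodic n y"
  shows "periodic n (whurl_L n x y)"
proof -
  have "y (i + int n + int r - 1) = y (i + int r - 1)" "x (i + int n + int r) = x (i + int r)" for i r
    using assms periodic_def[of n x] periodic_def[of n y]
    by (auto simp: algebra_simps) (metis add.commute add.left_commute add_diff_eq)+
  then show ?thesis unfolding periodic_def[of n "whurl_L n x y"] whurl_L_def by simp
qed

lemma periodic_whurl_K:
  assumes "periodic n x" "periodic n y"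
  shows "periodic n (whurl_K n x y)"
  using periodic_reflect[OF periodic_whurl_L[OF periodic_reflect[OF assms(1)] periodic_reflect[OF assms(2)]]]
  by (simp add: whurl_K_reflect[abs_def])

section \<open>Squares of first-order difference operators\<close>

text \<open>
  Coefficientwise form of \<open>(T + b) (T + a) = (T + b') (T + a')\<close> for the shift
  \<open>(T v) i = v (i + 1)\<close>: the coefficient of \<open>T\<close> at \<open>i\<close> is \<open>a (i + 1) + b i\<close>.  The condition
  \<open>a i \<noteq> a' i\<close> excludes the trivial refactorization.
\<close>

definition lax_square :: "tuple \<Rightarrow> tuple \<Rightarrow> tuple \<Rightarrow> tuple \<Rightarrow> bool" where
  "lax_square a b a' b' \<longleftrightarrow>
     (\<forall>i. a i * b i = a' i * b' i \<and> a (i + 1) + b i = a' (i + 1) + b' i \<and> a i \<noteq> a' i)"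

lemma lax_square_swap: "lax_square a b a' b' \<longleftrightarrow> lax_square a' b' a b"
  unfolding lax_square_def by metis

lemma lax_square_uminus:
  "lax_square (\<lambda>i. - a i) (\<lambda>i. - b i) (\<lambda>i. - a' i) (\<lambda>i. - b' i) \<longleftrightarrow> lax_square a b a' b'"
proof -
  have *: "- p + - q = - r + - s \<longleftrightarrow> p + q = r + s" for p q r s :: complex
    by (metis minus_add_distrib neg_equal_iff_equal)
  show ?thesis unfolding lax_square_def * by simp
qed

text \<open>
  The operator \<open>T + lift a a'\<close> is the one that completes \<open>T + a\<close> to the least common left multiple
  of \<open>T + a\<close> and \<open>T + a'\<close>.
\<close>

definition lift :: "tuple \<Rightarrow> tuple \<Rightarrow> tuple" where
  "lift a a' = (\<lambda>i. a' i * (a' (i + 1) - a (i + 1)) / (a' i - a i))"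

text \<open>
  Elimination of \<open>b\<close>.  The identity determines \<open>b'\<close> from \<open>a\<close> and \<open>a'\<close>, and it is also a linear
  recursion for \<open>a - a'\<close>.
\<close>

lemma lax_square_step:
  fixes a b a' b' :: "int \<Rightarrow> complex"
  assumes "a i * b i = a' i * b' i" "a (i + 1) + b i = a' (i + 1) + b' i"
  shows "b' i * (a i - a' i) = a i * (a (i + 1) - a' (i + 1))"
proof -
  have "b i = a' (i + 1) + b' i - a (i + 1)" using assms(2) by (simp add: eq_diff_eq add.commute)
  with assms(1) have "a i * (a' (i + 1) + b' i - a (i + 1)) = a' i * b' i" by simp
  then show ?thesis by (simp add: algebra_simps)
qed

text \<open>
  A square is freely determined by the two edges leaving its source, as long as these are nowhere
  equal.
\<close>

lemma lax_square_iff: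
  "lax_square a b a' b' \<longleftrightarrow> (\<forall>i. a i \<noteq> a' i) \<and> b = lift a a' \<and> b' = lift a' a"
proof
  assume Q: "lax_square a b a' b'"
  have "b' i = lift a' a i" for i
    using Q lax_square_step[of a i b a' b'] unfolding lax_square_def lift_def
    by (simp add: nonzero_eq_divide_eq)
  moreover have "b i = lift a a' i" for i
  proof -
    have "lax_square a' b' a b" using Q lax_square_swap by blast
    then show ?thesis
      using lax_square_step[of a' i b' a b] unfolding lax_square_def lift_def
      by (simp add: nonzero_eq_divide_eq)
  qed
  ultimately show "(\<forall>i. a i \<noteq> a' i) \<and> b = lift a a' \<and> b' = lift a' a"
    using Q unfolding lax_square_def by blast
next
  assume R: "(\<forall>i. a i \<noteq> a' i) \<and> b = lift a a' \<and> b' = lift a' a"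
  then have ne: "a' i - a i \<noteq> 0" "a i - a' i \<noteq> 0" for i by (auto dest: spec[of _ i])
  have "a i * lift a a' i = a' i * lift a' a i" for i
    unfolding lift_def using ne[of i] by (simp add: divide_simps) (simp add: algebra_simps)
  moreover have "a (i + 1) + lift a a' i = a' (i + 1) + lift a' a i" for i
    unfolding lift_def using ne[of i] by (simp add: divide_simps) (simp add: algebra_simps)
  ultimately show "lax_square a b a' b'" using R unfolding lax_square_def by blast
qed

lemma lift_torus:
  assumes "a \<in> torus n" "a' \<in> torus n" "\<And>i. a i \<noteq> a' i"
  shows "lift a a' \<in> torus n"
proof -
  have "a (i + int n + 1) = a (i + 1)" "a' (i + int n + 1) = a' (i + 1)" for i
    using assms(1,2) periodic_shift[of n a 1] periodic_shift[of n a' 1]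
    by (auto simp: torus_iff periodic_def)
  with assms show ?thesis by (simp add: torus_def lift_def) metis
qed

text \<open>
  By the recursion for \<open>a - a'\<close> a single index with \<open>a k \<noteq> a' k\<close> excludes coincidences at all
  indices.
\<close>

lemma lax_squareI:
  assumes eqs: "\<And>i. a i * b i = a' i * b' i" "\<And>i. a (i + 1) + b i = a' (i + 1) + b' i"
    and nz: "\<And>i. a i \<noteq> 0" "\<And>i. b' i \<noteq> 0" and k: "a k \<noteq> a' k"
  shows "lax_square a b a' b'"
proof -
  have step: "a i \<noteq> a' i \<longleftrightarrow> a (i + 1) \<noteq> a' (i + 1)" for i
    using lax_square_step[of a i b a' b', OF eqs] nz[of i] by auto
  have "a i \<noteq> a' i" for i
  proof (induction i rule: int_induct[of _ k])
    case (step1 i)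
    then show ?case using step by blast
  next
    case (step2 i)
    then show ?case using step[of "i - 1"] by simp
  qed (rule k)
  with eqs show ?thesis unfolding lax_square_def by blast
qed

text \<open>
  Parallel edges have the same period, by one turn of the recursion for \<open>a - a'\<close>.
\<close>

lemma lax_square_period_prod:
  assumes "lax_square a b a' b'" "periodic n a" "periodic n a'" "periodic n b'"
  shows "period_prod n b' = period_prod n a"
proof -
  have "period_prod n b' * (a 0 - a' 0) = period_prod n a * (a 0 - a' 0)"
    using linear_recursion_period[of n b' a "\<lambda>i. a i - a' i" 0] assms lax_square_step[of a _ b a' b']
    by (simp add: lax_square_def periodic_def)
  then show ?thesis using assms(1) by (simp add: lax_square_def)
qed

text \<open>
  Dividing the recursion for \<open>a - a'\<close> shows that \<open>\<kappa> / (a - a')\<close> solves the inhomogeneous recursion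
  satisfied by \<open>l\<close>, and for different periods that recursion has at most one periodic solution.
  This identifies \<open>a'\<close> in terms of \<open>a\<close>, \<open>b\<close> and any solution \<open>l\<close>, such as the sums \<open>L\<close> and \<open>K\<close>.
\<close>

lemma lax_square_unique:
  assumes Q: "lax_square a b a' b'"
    and per: "periodic n a" "periodic n b" "periodic n a'" "periodic n l"
    and ne: "period_prod n a \<noteq> period_prod n b"
    and l: "\<And>i. a i * l i = b i * l (i + 1) + \<kappa>"
  shows "l i * (a i - a' i) = \<kappa>"
proof -
  \<comment> \<open>The difference of two solutions solves the homogeneous recursion.\<close>
  define e where "e i = l i - \<kappa> / (a i - a' i)" for i
  have d: "a i - a' i \<noteq> 0" for i using Q by (simp add: lax_square_def)
  have "a i * e i = b i * e (i + 1)" for i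
  proof -
    have 1: "b' i * (a i - a' i) = a i * (a (i + 1) - a' (i + 1))"
      using Q lax_square_step[of a i b a' b'] by (simp add: lax_square_def)
    have "a (i + 1) + b i = a' (i + 1) + b' i" using Q unfolding lax_square_def by blast
    then have 2: "b i = b' i - (a (i + 1) - a' (i + 1))" by algebra
    have "a i / (a i - a' i) = b' i / (a (i + 1) - a' (i + 1))"
      using 1 d[of i] d[of "i + 1"] by (simp add: frac_eq_eq)
    moreover have "b i / (a (i + 1) - a' (i + 1)) = b' i / (a (i + 1) - a' (i + 1)) - 1"
      unfolding 2 using d[of "i + 1"] by (simp add: diff_divide_distrib)
    ultimately have "a i / (a i - a' i) = b i / (a (i + 1) - a' (i + 1)) + 1" by simp
    then have "\<kappa> * (a i / (a i - a' i)) = \<kappa> * (b i / (a (i + 1) - a' (i + 1))) + \<kappa>"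
      by (simp only: distrib_left mult_1_right)
    then have "a i * (\<kappa> / (a i - a' i)) = b i * (\<kappa> / (a (i + 1) - a' (i + 1))) + \<kappa>"
      by (simp add: mult.commute)
    with l[of i] show ?thesis by (simp add: e_def algebra_simps)
  qed
  moreover have "periodic n e"
    using per by (simp add: periodic_def e_def)
  ultimately have "e i = 0"
    using linear_recursion_period[of n a b e i] per ne by auto
  then show ?thesis using d[of i] by (simp add: e_def)
qed

section \<open>Consistency on the cube\<close>

text \<open>
  If \<open>u\<close>, \<open>v\<close>, \<open>w\<close> are solutions of the first-order equations of \<open>T + a\<close>, \<open>T + b\<close>, \<open>T + c\<close>, then
  their Casorati determinant at \<open>i\<close>, formed with the values at \<open>i\<close>, \<open>i + 1\<close>, \<open>i + 2\<close>, is
  \<open>u i * v i * w i * tau3 a b c i\<close>.  In particular \<open>tau3\<close> is alternating in \<open>a\<close>, \<open>b\<close>, \<open>c\<close>.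
\<close>

definition tau3 :: "tuple \<Rightarrow> tuple \<Rightarrow> tuple \<Rightarrow> tuple" where
  "tau3 a b c = (\<lambda>i. a i * b i * (a (i + 1) - b (i + 1)) + b i * c i * (b (i + 1) - c (i + 1))
     + c i * a i * (c (i + 1) - a (i + 1)))"

lemma tau3_swap: "tau3 b a c i = - tau3 a b c i"
  unfolding tau3_def by (simp add: algebra_simps)

lemma lift_diff:
  assumes "a i \<noteq> b i" "a i \<noteq> c i"
  shows "lift a c i - lift a b i = - tau3 a b c i / ((b i - a i) * (c i - a i))"
proof -
  have "b i - a i \<noteq> 0" "c i - a i \<noteq> 0" using assms by auto
  then show ?thesis
    unfolding lift_def tau3_def by (simp add: divide_simps) (simp add: algebra_simps)
qed

text \<open>
  The right-hand side is visibly symmetric in \<open>a\<close> and \<open>b\<close>: exchanging them changes the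
  signs in numerator and denominator of both quotients.
\<close>

lemma lift_lift:
  assumes ab: "\<And>i. a i \<noteq> b i" and ac: "\<And>i. a i \<noteq> c i" and t: "tau3 a b c i \<noteq> 0"
  shows "lift (lift a b) (lift a c) i =
    c i * (tau3 a b c (i + 1) / tau3 a b c i) * ((b i - a i) / (b (i + 1) - a (i + 1)))"
proof -
  have ne: "b j - a j \<noteq> 0" "c j - a j \<noteq> 0" for j using ab[of j] ac[of j] by auto
  have "lift (lift a b) (lift a c) i = lift a c i * (lift a c (i + 1) - lift a b (i + 1)) /
      (lift a c i - lift a b i)"
    by (simp add: lift_def[of "lift a b"])
  also have "\<dots> = c i * (c (i + 1) - a (i + 1)) / (c i - a i) *
      (- tau3 a b c (i + 1) / ((b (i + 1) - a (i + 1)) * (c (i + 1) - a (i + 1)))) /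
      (- tau3 a b c i / ((b i - a i) * (c i - a i)))"
    unfolding lift_diff[OF ab ac] by (simp add: lift_def)
  also have "\<dots> = c i * (tau3 a b c (i + 1) / tau3 a b c i) * ((b i - a i) / (b (i + 1) - a (i + 1)))"
    using ne t by (simp add: divide_simps)
  finally show ?thesis .
qed

definition apart :: "tuple \<Rightarrow> tuple \<Rightarrow> bool" where
  "apart a b \<longleftrightarrow> (\<forall>i. a i \<noteq> b i)"

lemma apart_sym: "apart a b \<Longrightarrow> apart b a"
  unfolding apart_def by metis

lemma apart_lift_iff:
  assumes "apart a b" "apart a c"
  shows "apart (lift a b) (lift a c) \<longleftrightarrow> (\<forall>i. tau3 a b c i \<noteq> 0)"
proof -
  have "lift a b i \<noteq> lift a c i \<longleftrightarrow> tau3 a b c i \<noteq> 0" for i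
  proof -
    have ne: "a i \<noteq> b i" "a i \<noteq> c i" using assms by (simp_all add: apart_def)
    then have "lift a c i - lift a b i = 0 \<longleftrightarrow> tau3 a b c i = 0"
      using ne unfolding lift_diff[where a = a and b = b and c = c and i = i, OF ne] by simp
    then show ?thesis by auto
  qed
  then show ?thesis unfolding apart_def by simp
qed

text \<open>
  Both conditions say that the alternating expression \<open>tau3 a b c\<close> has no zeros, so a cube can
  degenerate only at all three of its faces through the far corner at once.
\<close>

lemma apart_lift_swap:
  assumes "apart a b" "apart a c" "apart b c" "apart (lift a b) (lift a c)"
  shows "apart (lift b a) (lift b c)"
proof -
  have "\<forall>i. tau3 b a c i \<noteq> 0"
    using assms(4) unfolding apart_lift_iff[OF assms(1,2)] by (simp add: tau3_swap[of b a c])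
  then show ?thesis unfolding apart_lift_iff[OF apart_sym[OF assms(1)] assms(3)] .
qed

text \<open>
  Three-dimensional consistency: an edge at distance two from the source corner of a cube
  can be computed through either of the two faces above it.
\<close>

lemma lift_lift_swap:
  assumes "apart a b" "apart a c" "apart b c" "apart (lift a b) (lift a c)"
  shows "lift (lift a b) (lift a c) = lift (lift b a) (lift b c)"
proof
  fix i
  have ab: "a j \<noteq> b j" "b j \<noteq> a j" and ac: "a j \<noteq> c j" and bc: "b j \<noteq> c j" for j
    using assms(1-3) by (auto simp: apart_def dest: spec[of _ j])
  have t: "tau3 a b c j \<noteq> 0" for j using assms(4) unfolding apart_lift_iff[OF assms(1,2)] by simp
  have t': "tau3 b a c j \<noteq> 0" for j using t[of j] by (simp add: tau3_swap[of b a c])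
  have "(b i - a i) / (b (i + 1) - a (i + 1)) = (a i - b i) / (a (i + 1) - b (i + 1))"
    using minus_divide_divide[of "b i - a i" "b (i + 1) - a (i + 1)"] by (simp only: minus_diff_eq)
  then show "lift (lift a b) (lift a c) i = lift (lift b a) (lift b c) i"
    unfolding lift_lift[OF ab(1) ac t] lift_lift[OF ab(2) bc t'] by (simp add: tau3_swap[of b a c])
qed

text \<open>
  The cube has edges \<open>a\<^sub>1\<close>, \<open>a\<^sub>2\<close>, \<open>a\<^sub>3\<close> leaving the source corner in the three directions,
  \<open>lift a\<^sub>i a\<^sub>j\<close> in direction \<open>j\<close> at the end of \<open>a\<^sub>i\<close>, and \<open>b\<^sub>1\<close>, \<open>b\<^sub>2\<close>, \<open>b\<^sub>3\<close> entering the far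
  corner.  The three faces through the source are squares by construction; the three squares
  asserted are the faces through the far corner.  Each \<open>b\<^sub>k\<close> lies on two of them, and consistency
  says that these two faces ask for the same \<open>b\<^sub>k\<close>.
\<close>

lemma lax_cube:
  assumes "a\<^sub>1 \<in> torus n" "a\<^sub>2 \<in> torus n" "a\<^sub>3 \<in> torus n"
    and "apart a\<^sub>1 a\<^sub>2" "apart a\<^sub>1 a\<^sub>3" "apart a\<^sub>2 a\<^sub>3" "apart (lift a\<^sub>1 a\<^sub>2) (lift a\<^sub>1 a\<^sub>3)"
  obtains b\<^sub>1 b\<^sub>2 b\<^sub>3 where "b\<^sub>1 \<in> torus n" "b\<^sub>2 \<in> torus n" "b\<^sub>3 \<in> torus n"
    "lax_square (lift a\<^sub>1 a\<^sub>2) b\<^sub>3 (lift a\<^sub>1 a\<^sub>3) b\<^sub>2"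
    "lax_square (lift a\<^sub>2 a\<^sub>1) b\<^sub>3 (lift a\<^sub>2 a\<^sub>3) b\<^sub>1"
    "lax_square (lift a\<^sub>3 a\<^sub>1) b\<^sub>2 (lift a\<^sub>3 a\<^sub>2) b\<^sub>1"
proof -
  define b\<^sub>1 where "b\<^sub>1 = lift (lift a\<^sub>2 a\<^sub>3) (lift a\<^sub>2 a\<^sub>1)"
  define b\<^sub>2 where "b\<^sub>2 = lift (lift a\<^sub>1 a\<^sub>3) (lift a\<^sub>1 a\<^sub>2)"
  define b\<^sub>3 where "b\<^sub>3 = lift (lift a\<^sub>1 a\<^sub>2) (lift a\<^sub>1 a\<^sub>3)"
  note s = assms(4-6) assms(4-6)[THEN apart_sym]
  have l1: "apart (lift a\<^sub>1 a\<^sub>3) (lift a\<^sub>1 a\<^sub>2)" by (rule apart_sym[OF assms(7)])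
  have l2: "apart (lift a\<^sub>2 a\<^sub>1) (lift a\<^sub>2 a\<^sub>3)" by (rule apart_lift_swap[OF assms(4-7)])
  have l3: "apart (lift a\<^sub>3 a\<^sub>1) (lift a\<^sub>3 a\<^sub>2)" 
    by (rule apart_lift_swap[OF assms(5,4) apart_sym[OF assms(6)] l1])
  have e3: "b\<^sub>3 = lift (lift a\<^sub>2 a\<^sub>1) (lift a\<^sub>2 a\<^sub>3)"
    unfolding b\<^sub>3_def by (rule lift_lift_swap[OF assms(4-7)])
  have e2: "b\<^sub>2 = lift (lift a\<^sub>3 a\<^sub>1) (lift a\<^sub>3 a\<^sub>2)"
    unfolding b\<^sub>2_def by (rule lift_lift_swap[OF assms(5,4) apart_sym[OF assms(6)] l1])
  have e1: "b\<^sub>1 = lift (lift a\<^sub>3 a\<^sub>2) (lift a\<^sub>3 a\<^sub>1)"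
    unfolding b\<^sub>1_def 
    by (rule lift_lift_swap[OF assms(6) apart_sym[OF assms(4)] apart_sym[OF assms(5)] apart_sym[OF l2]])
  have torus: "lift a b \<in> torus n" if "a \<in> torus n" "b \<in> torus n" "apart a b" for a b
    using that by (intro lift_torus) (auto simp: apart_def)
  show thesis
  proof (rule that[of b\<^sub>1 b\<^sub>2 b\<^sub>3])
    show "b\<^sub>1 \<in> torus n" unfolding b\<^sub>1_def by (intro torus assms(1-3) s apart_sym[OF l2])
    show "b\<^sub>2 \<in> torus n" unfolding b\<^sub>2_def by (intro torus assms(1-3) s l1)
    show "b\<^sub>3 \<in> torus n" unfolding b\<^sub>3_def by (intro torus assms(1-3) s assms(7))
    show "lax_square (lift a\<^sub>1 a\<^sub>2) b\<^sub>3 (lift a\<^sub>1 a\<^sub>3) b\<^sub>2"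
      using assms(7) by (simp add: lax_square_iff apart_def b\<^sub>2_def b\<^sub>3_def)
    show "lax_square (lift a\<^sub>2 a\<^sub>1) b\<^sub>3 (lift a\<^sub>2 a\<^sub>3) b\<^sub>1"
      using l2 by (simp add: lax_square_iff apart_def b\<^sub>1_def e3)
    show "lax_square (lift a\<^sub>3 a\<^sub>1) b\<^sub>2 (lift a\<^sub>3 a\<^sub>2) b\<^sub>1"
      using l3 by (simp add: lax_square_iff apart_def e1 e2)
  qed
qed

section \<open>The moves as refactorizations\<close>

text \<open>
  The relation between the weights before and after a move, written without inverses:
  whirls contribute \<open>T + x\<close> and curls the inverse of \<open>T - x\<close>, and the factor of the left cycle is
  applied first.  For example, for a whirl followed by a curl the equation
  \<open>(T - y)\<^sup>-\<^sup>1 (T + x) = (T + y') (T - x')\<^sup>-\<^sup>1\<close> becomes \<open>(T + x) (T - x') = (T - y) (T + y')\<close>.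
\<close>

fun crossing :: "cycle \<Rightarrow> cycle \<Rightarrow> tuple \<Rightarrow> tuple \<Rightarrow> tuple \<Rightarrow> tuple \<Rightarrow> bool" where
  "crossing Whirl Whirl x y x' y' \<longleftrightarrow> lax_square x y x' y'"
| "crossing Whirl Curl x y x' y' \<longleftrightarrow> lax_square (\<lambda>i. - x' i) x y' (\<lambda>i. - y i)"
| "crossing Curl Whirl x y x' y' \<longleftrightarrow> lax_square (\<lambda>i. - x i) x' y (\<lambda>i. - y' i)"
| "crossing Curl Curl x y x' y' \<longleftrightarrow>
     lax_square (\<lambda>i. - y i) (\<lambda>i. - x i) (\<lambda>i. - y' i) (\<lambda>i. - x' i)"

fun flip :: "cycle \<Rightarrow> cycle" where
  "flip Whirl = Curl"
| "flip Curl = Whirl"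

lemma crossing_inverse:
  assumes "crossing A B x y x' y'"
  shows "crossing B A x' y' x y"
  using assms by (cases A; cases B) (simp_all add: lax_square_swap[of x] lax_square_swap[of "\<lambda>i. - y i"])

text \<open>
  Reading the network from right to left turns whirls into curls: the square is conjugated by
  \<open>v i \<mapsto> (-1)^i * v i\<close>, which negates all four entries, and, for mixed types, its two paths are
  exchanged.
\<close>

lemma crossing_mirror:
  assumes "crossing A B x y x' y'"
  shows "crossing (flip B) (flip A) y x y' x'"
proof (cases A; cases B)
  assume "A = Whirl" "B = Whirl"
  then show ?thesis using assms by (simp add: lax_square_uminus)
next
  assume [simp]: "A = Whirl" "B = Curl"
  have "lax_square (\<lambda>i. - y' i) (\<lambda>i. - (- y i)) (\<lambda>i. - (- x' i)) (\<lambda>i. - x i)"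
    using assms unfolding lax_square_uminus by (simp add: lax_square_swap)
  then show ?thesis by simp
next
  assume [simp]: "A = Curl" "B = Whirl"
  have "lax_square (\<lambda>i. - y i) (\<lambda>i. - (- y' i)) (\<lambda>i. - (- x i)) (\<lambda>i. - x' i)"
    using assms unfolding lax_square_uminus by (simp add: lax_square_swap)
  then show ?thesis by simp
next
  assume "A = Curl" "B = Curl"
  then show ?thesis using assms by (simp add: lax_square_uminus)
qed

lemma period_prod_uminus_eq_iff [simp]:
  "period_prod n (\<lambda>i. - x i) = period_prod n (\<lambda>i. - y i) \<longleftrightarrow> period_prod n x = period_prod n y"
  by (simp add: period_prod_uminus)

text \<open>
  The period travels with its cycle.
\<close>

lemma crossing_period_prod:
  assumes "crossing A B x y x' y'" "x \<in> torus n" "y \<in> torus n" "x' \<in> torus n" "y' \<in> torus n"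
  shows "period_prod n x' = period_prod n y \<and> period_prod n y' = period_prod n x"
proof -
  have prods: "period_prod n b' = period_prod n a \<and> period_prod n a' = period_prod n b"
    if Q: "lax_square a b a' b'" and "a \<in> torus n" "b \<in> torus n" "a' \<in> torus n" "b' \<in> torus n"
    for a b a' b'
    using that lax_square_period_prod[OF Q, of n]
      lax_square_period_prod[OF Q[unfolded lax_square_swap[of a]], of n]
    by (simp add: torus_iff)
  show ?thesis
  proof (cases A; cases B)
    assume "A = Whirl" "B = Whirl"
    then show ?thesis using prods[of x y x' y'] assms by simp
  next
    assume "A = Whirl" "B = Curl"
    then show ?thesis using prods[of "\<lambda>i. - x' i" x y' "\<lambda>i. - y i"] assms
      by (simp add: torus_uminus)
  next
    assume "A = Curl" "B = Whirl"
    then show ?thesis using prods[of "\<lambda>i. - x i" x' y "\<lambda>i. - y' i"] assms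
      by (simp add: torus_uminus)
  next
    assume "A = Curl" "B = Curl"
    then show ?thesis
      using prods[of "\<lambda>i. - y i" "\<lambda>i. - x i" "\<lambda>i. - y' i" "\<lambda>i. - x' i"] assms
      by (simp add: torus_uminus)
  qed
qed

lemma torusD:
  assumes "x \<in> torus n"
  shows "x i \<noteq> 0" "x (i + int n) = x i" "x (i + int n + 1) = x (i + 1)" "x (i + int n - 1) = x (i - 1)"
proof -
  show 1: "x i \<noteq> 0" "x (i + int n) = x i" for i using assms by (simp_all add: torus_def)
  show "x (i + int n + 1) = x (i + 1)" "x (i + int n - 1) = x (i - 1)"
    using 1(2)[of "i + 1"] 1(2)[of "i - 1"] by (simp_all add: algebra_simps)
qed

text \<open>
  For cycles of the same type, additivity is the statement that \<open>x i * L i - y i * L (i + 1)\<close>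
  is the same for \<open>i\<close> and \<open>i + 1\<close>, and its value, the difference of the periods, is also the
  numerator of \<open>x i - x' i\<close>.  For different types the new weights satisfy
  \<open>x' i + y' i = x j + y j\<close> with \<open>j\<close> the neighbour of \<open>i\<close>.
\<close>

lemma move_crossing:
  assumes n: "n \<ge> 1" and x: "x \<in> torus n" and y: "y \<in> torus n"
    and ne: "period_prod n x \<noteq> period_prod n y"
    and mv: "move n A B (x, y) = Some (x', y')"
  shows "x' \<in> torus n \<and> y' \<in> torus n \<and> crossing A B x y x' y'"
proof -
  have per: "periodic n x" "periodic n y" using x y by (auto simp: torus_iff)
  show ?thesis
  proof (cases A; cases B)
    assume [simp]: "A = Whirl" "B = Whirl"
    let ?L = "whurl_L n x y"
    have L: "?L i \<noteq> 0" for i using mv by (simp add: Let_def split: if_splits)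
    have x': "x' = (\<lambda>i. y i * ?L (i + 1) / ?L i)" and y': "y' = (\<lambda>i. x i * ?L i / ?L (i + 1))"
      using mv by (auto simp: Let_def split: if_splits)
    have perL: "?L (i + int n) = ?L i" "?L (i + int n + 1) = ?L (i + 1)" for i
      using periodic_whurl_L[OF per] periodic_shift[OF periodic_whurl_L[OF per], of 1]
      by (auto simp: periodic_def)
    have rec: "x i * ?L i - y i * ?L (i + 1) = period_prod n x - period_prod n y" for i
      by (rule whurl_L_recursion[OF n per])
    have "x' \<in> torus n" "y' \<in> torus n"
      unfolding torus_def x' y' using L torusD[OF x] torusD[OF y] by (simp_all add: perL)
    moreover have "lax_square x y x' y'"
      unfolding lax_square_def
    proof (intro allI conjI)
      fix i
      show "x i * y i = x' i * y' i" unfolding x' y' using L by simp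
      have "x i * ?L i + y (i + 1) * ?L (i + 1 + 1) = (x (i + 1) + y i) * ?L (i + 1)"
        using rec[of i] rec[of "i + 1"] by algebra
      then show "x (i + 1) + y i = x' (i + 1) + y' i"
        unfolding x' y' using L[of "i + 1"]
        by (simp add: add_divide_distrib[symmetric] nonzero_eq_divide_eq add.commute)
      show "x i \<noteq> x' i"
        unfolding x' using rec[of i] ne L[of i] by (auto simp: nonzero_eq_divide_eq)
    qed
    ultimately show ?thesis by simp
  next
    assume [simp]: "A = Curl" "B = Curl"
    let ?K = "whurl_K n x y"
    have K: "?K i \<noteq> 0" for i using mv by (simp add: Let_def split: if_splits)
    have x': "x' = (\<lambda>i. y i * ?K (i - 1) / ?K i)" and y': "y' = (\<lambda>i. x i * ?K i / ?K (i - 1))"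
      using mv by (auto simp: Let_def split: if_splits)
    have perK: "?K (i + int n) = ?K i" "?K (i + int n - 1) = ?K (i - 1)" for i
      using periodic_whurl_K[OF per] periodic_shift[OF periodic_whurl_K[OF per], of "-1"]
      by (auto simp: periodic_def)
    have rec: "x i * ?K i - y i * ?K (i - 1) = period_prod n x - period_prod n y" for i
      by (rule whurl_K_recursion[OF n per])
    have "x' \<in> torus n" "y' \<in> torus n"
      unfolding torus_def x' y' using K torusD[OF x] torusD[OF y] by (simp_all add: perK)
    moreover have "lax_square (\<lambda>i. - y i) (\<lambda>i. - x i) (\<lambda>i. - y' i) (\<lambda>i. - x' i)"
      unfolding lax_square_def
    proof (intro allI conjI)
      fix i
      show "- y i * - x i = - y' i * - x' i" unfolding x' y' using K by simp
      have "x (i + 1) * ?K (i + 1) + y i * ?K (i - 1) = (y (i + 1) + x i) * ?K i"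
        using rec[of i] rec[of "i + 1"] unfolding add_diff_cancel_right' by algebra
      then have "y (i + 1) + x i = y' (i + 1) + x' i"
        unfolding x' y' using K[of i]
        by (simp add: add_divide_distrib[symmetric] nonzero_eq_divide_eq)
      then show "- y (i + 1) + - x i = - y' (i + 1) + - x' i" by (simp add: algebra_simps)
      show "- y i \<noteq> - y' i"
        unfolding y' using rec[of i] ne K[of "i - 1"] by (auto simp: nonzero_eq_divide_eq)
    qed
    ultimately show ?thesis by simp
  next
    assume [simp]: "A = Whirl" "B = Curl"
    have S: "x i + y i \<noteq> 0" for i using mv by (simp split: if_splits)
    have x': "x' = (\<lambda>i. y i * (x (i - 1) + y (i - 1)) / (x i + y i))"
      and y': "y' = (\<lambda>i. x i * (x (i - 1) + y (i - 1)) / (x i + y i))"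
      using mv by (auto split: if_splits)
    have S': "x' i + y' i = x (i - 1) + y (i - 1)" for i
      unfolding x' y' using S[of i] by (simp add: divide_simps) (simp add: algebra_simps)
    have "x' \<in> torus n" "y' \<in> torus n"
      unfolding torus_def x' y' using S by (simp_all add: torusD[OF x] torusD[OF y])
    moreover have "lax_square (\<lambda>i. - x' i) x y' (\<lambda>i. - y i)"
      unfolding lax_square_def
    proof (intro allI conjI)
      fix i
      show "- x' i * x i = y' i * - y i" unfolding x' y' by simp
      show "- x' (i + 1) + x i = y' (i + 1) + - y i" using S'[of "i + 1"] by (simp add: algebra_simps)
      show "- x' i \<noteq> y' i" using S'[of i] S[of "i - 1"] by (simp add: neg_eq_iff_add_eq_0)
    qed
    ultimately show ?thesis by simp
  next
    assume [simp]: "A = Curl" "B = Whirl"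
    have S: "x i + y i \<noteq> 0" for i using mv by (simp split: if_splits)
    have x': "x' = (\<lambda>i. y i * (x (i + 1) + y (i + 1)) / (x i + y i))"
      and y': "y' = (\<lambda>i. x i * (x (i + 1) + y (i + 1)) / (x i + y i))"
      using mv by (auto split: if_splits)
    have S': "x' i + y' i = x (i + 1) + y (i + 1)" for i
      unfolding x' y' using S[of i] by (simp add: divide_simps) (simp add: algebra_simps)
    have "x' \<in> torus n" "y' \<in> torus n"
      unfolding torus_def x' y' using S by (simp_all add: torusD[OF x] torusD[OF y])
    moreover have "lax_square (\<lambda>i. - x i) x' y (\<lambda>i. - y' i)"
      unfolding lax_square_def
    proof (intro allI conjI)
      fix i
      show "- x i * x' i = y i * - y' i" unfolding x' y' by simp
      show "- x (i + 1) + x' i = y (i + 1) + - y' i" using S'[of i] by (simp add: algebra_simps)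
      show "- x i \<noteq> y i" using S[of i] by (simp add: neg_eq_iff_add_eq_0)
    qed
    ultimately show ?thesis by simp
  qed
qed

text \<open>
  The refactorization is unique, so it is the one given by the formulas.  That \<open>L\<close> or \<open>K\<close> has no
  zeros is part of the conclusion: uniqueness writes the difference of the periods as a product
  with \<open>L i\<close> as a factor.
\<close>

lemma crossing_move:
  assumes n: "n \<ge> 1" and x: "x \<in> torus n" and y: "y \<in> torus n"
    and ne: "period_prod n x \<noteq> period_prod n y"
    and x': "x' \<in> torus n" and y': "y' \<in> torus n" and cr: "crossing A B x y x' y'"
  shows "move n A B (x, y) = Some (x', y')"
proof -
  have per: "periodic n x" "periodic n y" "periodic n x'" "periodic n y'"
    using x y x' y' by (auto simp: torus_iff)
  have nz: "x i \<noteq> 0" "y i \<noteq> 0" "x' i \<noteq> 0" "y' i \<noteq> 0" for i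
    using x y x' y' by (auto simp: torus_iff)
  define \<kappa> where "\<kappa> = period_prod n x - period_prod n y"
  have \<kappa>: "\<kappa> \<noteq> 0" using ne by (simp add: \<kappa>_def)
  show ?thesis
  proof (cases A; cases B)
    assume [simp]: "A = Whirl" "B = Whirl"
    let ?L = "whurl_L n x y"
    have Q: "lax_square x y x' y'" using cr by simp
    have rec: "x i * ?L i = y i * ?L (i + 1) + \<kappa>" for i
      using whurl_L_recursion[OF n per(1,2), of i] by (simp add: \<kappa>_def algebra_simps)
    have \<kappa>_eq: "?L i * (x i - x' i) = \<kappa>" for i
      by (rule lax_square_unique[OF Q per(1-3) periodic_whurl_L[OF per(1,2)] ne rec])
    have L: "?L i \<noteq> 0" for i using \<kappa>_eq[of i] \<kappa> by auto
    have 1: "x' i * ?L i = y i * ?L (i + 1)" for i using rec[of i] \<kappa>_eq[of i] by algebra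
    have 2: "y' i * ?L (i + 1) = x i * ?L i" for i
    proof -
      have "x i * y i = x' i * y' i" using Q by (simp add: lax_square_def)
      have "(y i * ?L (i + 1)) * y' i = (x' i * y' i) * ?L i" unfolding 1[symmetric] by simp
      also have "\<dots> = (x i * ?L i) * y i" using \<open>x i * y i = x' i * y' i\<close> by simp
      finally have "(y i * ?L (i + 1)) * y' i = (x i * ?L i) * y i" .
      then show ?thesis using nz(2)[of i] by (simp add: algebra_simps)
    qed
    have "x' = (\<lambda>i. y i * ?L (i + 1) / ?L i)" "y' = (\<lambda>i. x i * ?L i / ?L (i + 1))"
      using 1 2 L by (auto simp: fun_eq_iff nonzero_eq_divide_eq)
    then show ?thesis using L by (simp add: Let_def)
  next
    assume [simp]: "A = Curl" "B = Curl"
    let ?K = "whurl_K n x y"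
    have Q: "lax_square (\<lambda>i. - y i) (\<lambda>i. - x i) (\<lambda>i. - y' i) (\<lambda>i. - x' i)" using cr by simp
    have rec: "- y i * ?K (i - 1) = - x i * ?K (i + 1 - 1) + \<kappa>" for i
      using whurl_K_recursion[OF n per(1,2), of i] by (simp add: \<kappa>_def algebra_simps)
    have perK: "periodic n (\<lambda>i. ?K (i - 1))"
      using periodic_shift[OF periodic_whurl_K[OF per(1,2)], of "-1"] by simp
    have pm: "periodic n (\<lambda>i. - y i)" "periodic n (\<lambda>i. - x i)" "periodic n (\<lambda>i. - y' i)"
      using per by (auto simp: periodic_def)
    have "period_prod n (\<lambda>i. - y i) \<noteq> period_prod n (\<lambda>i. - x i)" using ne by simp
    from lax_square_unique[OF Q pm perK this rec]
    have \<kappa>_eq: "?K (i - 1) * (- y i - - y' i) = \<kappa>" for i .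
    have K: "?K i \<noteq> 0" for i using \<kappa>_eq[of "i + 1"] \<kappa> by auto
    have 1: "y' i * ?K (i - 1) = x i * ?K i" for i
      using rec[of i] \<kappa>_eq[of i] unfolding add_diff_cancel_right' by algebra
    have 2: "x' i * ?K i = y i * ?K (i - 1)" for i
    proof -
      have "x i * y i = x' i * y' i" using Q by (simp add: lax_square_def mult.commute)
      have "(x i * ?K i) * x' i = (x' i * y' i) * ?K (i - 1)" unfolding 1[symmetric] by simp
      also have "\<dots> = (y i * ?K (i - 1)) * x i"
        using \<open>x i * y i = x' i * y' i\<close> by (simp add: mult.commute[of "y i" "x i"])
      finally have "(x i * ?K i) * x' i = (y i * ?K (i - 1)) * x i" .
      then show ?thesis using nz(1)[of i] by (simp add: algebra_simps)
    qed
    have "x' = (\<lambda>i. y i * ?K (i - 1) / ?K i)" "y' = (\<lambda>i. x i * ?K i / ?K (i - 1))"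
      using 1 2 K by (auto simp: fun_eq_iff nonzero_eq_divide_eq)
    then show ?thesis using K by (simp add: Let_def)
  next
    assume [simp]: "A = Whirl" "B = Curl"
    have Q: "lax_square (\<lambda>i. - x' i) x y' (\<lambda>i. - y i)" using cr by simp
    have mult: "x i * x' i = y i * y' i" for i using Q by (simp add: lax_square_def mult.commute)
    have "- x' (i + 1) + x i = y' (i + 1) + - y i" for i using Q unfolding lax_square_def by blast
    then have S': "x' (i + 1) + y' (i + 1) = x i + y i" for i by (simp add: field_simps)
    have S: "x i + y i \<noteq> 0" for i
    proof -
      have "- x' (i + 1) \<noteq> y' (i + 1)" using Q unfolding lax_square_def by blast
      then show ?thesis using S'[of i] by (simp add: neg_eq_iff_add_eq_0)
    qed
    have S'': "x' i + y' i = x (i - 1) + y (i - 1)" for i using S'[of "i - 1"] by simp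
    have "x' i * (x i + y i) = y i * (x (i - 1) + y (i - 1))" for i
      unfolding S''[symmetric] using mult[of i] by (simp add: algebra_simps)
    moreover have "y' i * (x i + y i) = x i * (x (i - 1) + y (i - 1))" for i
      unfolding S''[symmetric] using mult[of i] by (simp add: algebra_simps)
    ultimately have "x' = (\<lambda>i. y i * (x (i - 1) + y (i - 1)) / (x i + y i))"
      "y' = (\<lambda>i. x i * (x (i - 1) + y (i - 1)) / (x i + y i))"
      using S by (auto simp: fun_eq_iff nonzero_eq_divide_eq)
    then show ?thesis using S by simp
  next
    assume [simp]: "A = Curl" "B = Whirl"
    have Q: "lax_square (\<lambda>i. - x i) x' y (\<lambda>i. - y' i)" using cr by simp
    have mult: "x i * x' i = y i * y' i" for i using Q by (simp add: lax_square_def)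
    have "- x (i + 1) + x' i = y (i + 1) + - y' i" for i using Q unfolding lax_square_def by blast
    then have S': "x' i + y' i = x (i + 1) + y (i + 1)" for i by (simp add: field_simps)
    have S: "x i + y i \<noteq> 0" for i
    proof -
      have "- x i \<noteq> y i" using Q unfolding lax_square_def by blast
      then show ?thesis by (simp add: neg_eq_iff_add_eq_0)
    qed
    have "x' i * (x i + y i) = y i * (x (i + 1) + y (i + 1))" for i
      unfolding S'[symmetric] using mult[of i] by (simp add: algebra_simps)
    moreover have "y' i * (x i + y i) = x i * (x (i + 1) + y (i + 1))" for i
      unfolding S'[symmetric] using mult[of i] by (simp add: algebra_simps)
    ultimately have "x' = (\<lambda>i. y i * (x (i + 1) + y (i + 1)) / (x i + y i))"
      "y' = (\<lambda>i. x i * (x (i + 1) + y (i + 1)) / (x i + y i))"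
      using S by (auto simp: fun_eq_iff nonzero_eq_divide_eq)
    then show ?thesis using S by simp
  qed
qed

text \<open>
  The source of all points witnessing that domains are nonempty: positivity keeps the
  denominators away from zero.
\<close>

lemma move_const:
  fixes a b :: real
  assumes "n \<ge> 1" "a > 0" "b > 0"
  shows "move n A B (\<lambda>_. complex_of_real a, \<lambda>_. complex_of_real b) =
    Some (\<lambda>_. complex_of_real b, \<lambda>_. complex_of_real a)"
proof -
  define s where "s = (\<Sum>s = 0..n-1. b ^ s * a ^ (n - 1 - s))"
  have "s > 0" unfolding s_def using assms by (intro sum_pos) auto
  moreover have "whurl_L n (\<lambda>_. complex_of_real a) (\<lambda>_. complex_of_real b) i = complex_of_real s"
    "whurl_K n (\<lambda>_. complex_of_real a) (\<lambda>_. complex_of_real b) i = complex_of_real s" for i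
    unfolding whurl_L_def whurl_K_def s_def by simp_all
  moreover have "complex_of_real a + complex_of_real b \<noteq> 0"
    using assms by (metis add_pos_pos of_real_add of_real_eq_0_iff less_irrefl)
  ultimately show ?thesis by (cases A; cases B) (simp_all add: Let_def)
qed

section \<open>The braid relation for refactorizations\<close>

lemma torus_uminusI: "x \<in> torus n \<Longrightarrow> (\<lambda>i. - x i) \<in> torus n"
  by (simp add: torus_uminus)

text \<open>
  Comparing squares makes two tuples distinct whatever signs they carry in the operators
  \<open>T + x\<close> and \<open>T - x\<close>, so that the condition is the same for all types of cycles.
\<close>

definition generic_pair :: "tuple \<Rightarrow> tuple \<Rightarrow> bool" where
  "generic_pair x y \<longleftrightarrow> (\<forall>i. (x i)\<^sup>2 \<noteq> (y i)\<^sup>2)"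

lemma generic_pair_apart:
  assumes "generic_pair x y"
  shows "apart x y" "apart (\<lambda>i. - x i) y" "apart x (\<lambda>i. - y i)" "apart (\<lambda>i. - x i) (\<lambda>i. - y i)"
  using assms unfolding generic_pair_def apart_def by (metis power2_minus)+

lemma lax_square_apart: "lax_square a b a' b' \<Longrightarrow> apart a a'"
  by (simp add: lax_square_def apart_def)

text \<open>
  The left side of the braid relation moves the path across the three faces at one corner of the
  cube, the one separated from the start of the path in the second direction.  In the patterns
  listed in the last assumption (\<open>MMM\<close>, \<open>MNM\<close>, \<open>MNN\<close>, \<open>NNM\<close>) this corner is the source of the cube or
  adjacent to it, so these faces contain all three edges \<open>a\<^sub>1\<close>, \<open>a\<^sub>2\<close>, \<open>a\<^sub>3\<close> at the source and
  the cube can be completed.  The genericity assumptions supply the distinctness that the known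
  faces leave open: that of the two source edges of a missing face or, if no face at the source is missing,
  the nondegeneracy of the far corner.
\<close>

lemma braid_crossings_left:
  assumes t: "x \<in> torus n" "y \<in> torus n" "z \<in> torus n"
    "y\<^sub>1 \<in> torus n" "x\<^sub>1 \<in> torus n" "z\<^sub>1 \<in> torus n" "x\<^sub>2 \<in> torus n" "z\<^sub>2 \<in> torus n" "y\<^sub>2 \<in> torus n"
    and c: "crossing A B x y y\<^sub>1 x\<^sub>1" "crossing A C x\<^sub>1 z z\<^sub>1 x\<^sub>2" "crossing B C y\<^sub>1 z\<^sub>1 z\<^sub>2 y\<^sub>2"
    and g: "generic_pair y z" "generic_pair x z\<^sub>2" "generic_pair x\<^sub>2 y\<^sub>2"
    and type: "A = Whirl \<and> \<not> (B = Whirl \<and> C = Curl) \<or> A = Curl \<and> B = Curl \<and> C = Whirl"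
  shows "\<exists>z\<^sub>1' y\<^sub>1' x\<^sub>1'. z\<^sub>1' \<in> torus n \<and> y\<^sub>1' \<in> torus n \<and> x\<^sub>1' \<in> torus n \<and>
    crossing B C y z z\<^sub>1' y\<^sub>1' \<and> crossing A C x z\<^sub>1' z\<^sub>2 x\<^sub>1' \<and> crossing A B x\<^sub>1' y\<^sub>1' y\<^sub>2 x\<^sub>2"
proof -
  consider (MMM) "A = Whirl" "B = Whirl" "C = Whirl" | (MNM) "A = Whirl" "B = Curl" "C = Whirl"
    | (MNN) "A = Whirl" "B = Curl" "C = Curl" | (NNM) "A = Curl" "B = Curl" "C = Whirl"
    using type by (cases B; cases C) auto
  then show ?thesis
  proof cases
    case MMM
    have sq: "lax_square x y y\<^sub>1 x\<^sub>1" "lax_square x\<^sub>1 z z\<^sub>1 x\<^sub>2" "lax_square y\<^sub>1 z\<^sub>1 z\<^sub>2 y\<^sub>2"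
      using c MMM by simp_all
    have ap: "apart x z\<^sub>2" by (rule generic_pair_apart[OF g(2)])
    have e: "y = lift x y\<^sub>1" "x\<^sub>1 = lift y\<^sub>1 x" "z = lift x\<^sub>1 z\<^sub>1" "x\<^sub>2 = lift z\<^sub>1 x\<^sub>1"
      "z\<^sub>1 = lift y\<^sub>1 z\<^sub>2" "y\<^sub>2 = lift z\<^sub>2 y\<^sub>1"
      using sq by (simp_all add: lax_square_iff)
    \<comment> \<open>The face above \<open>y\<^sub>1\<close> is known to be nondegenerate; transfer this to the source edge \<open>x\<close>.\<close>
    have "apart (lift y\<^sub>1 x) (lift y\<^sub>1 z\<^sub>2)"
      using lax_square_apart[OF sq(2)] e(2,5) by simp
    from apart_lift_swap[OF apart_sym[OF lax_square_apart[OF sq(1)]] lax_square_apart[OF sq(3)] ap this]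
    have "apart (lift x y\<^sub>1) (lift x z\<^sub>2)" .
    from lax_cube[OF t(1,4,8) lax_square_apart[OF sq(1)] ap lax_square_apart[OF sq(3)] this]
    obtain b\<^sub>1 b\<^sub>2 b\<^sub>3 where b: "b\<^sub>1 \<in> torus n" "b\<^sub>2 \<in> torus n" "b\<^sub>3 \<in> torus n"
      "lax_square (lift x y\<^sub>1) b\<^sub>3 (lift x z\<^sub>2) b\<^sub>2"
      "lax_square (lift y\<^sub>1 x) b\<^sub>3 (lift y\<^sub>1 z\<^sub>2) b\<^sub>1"
      "lax_square (lift z\<^sub>2 x) b\<^sub>2 (lift z\<^sub>2 y\<^sub>1) b\<^sub>1" .
    \<comment> \<open>The completed cube shares a face at the far corner with the given half, so it extends that half.\<close>
    have "b\<^sub>3 = z" "b\<^sub>1 = x\<^sub>2" using b(5) e by (simp_all add: lax_square_iff)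
    moreover have "lax_square x (lift x z\<^sub>2) z\<^sub>2 (lift z\<^sub>2 x)"
      using ap by (simp add: lax_square_iff apart_def)
    moreover have "lift x z\<^sub>2 \<in> torus n" "lift z\<^sub>2 x \<in> torus n"
      using ap t apart_sym[OF ap] by (auto intro!: lift_torus simp: apart_def)
    ultimately show ?thesis
      using b e MMM by (intro exI[of _ "lift x z\<^sub>2"] exI[of _ b\<^sub>2] exI[of _ "lift z\<^sub>2 x"]) simp
  next
    case MNM
    let ?y = "\<lambda>i. - y\<^sub>1 i"
    have sq: "lax_square ?y x x\<^sub>1 (\<lambda>i. - y i)" "lax_square x\<^sub>1 z z\<^sub>1 x\<^sub>2"
      "lax_square ?y z\<^sub>2 z\<^sub>1 (\<lambda>i. - y\<^sub>2 i)"
      using c MNM by simp_all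
    have e: "lift ?y x\<^sub>1 = x" "lift x\<^sub>1 ?y = (\<lambda>i. - y i)" "lift x\<^sub>1 z\<^sub>1 = z" "lift z\<^sub>1 x\<^sub>1 = x\<^sub>2"
      "lift ?y z\<^sub>1 = z\<^sub>2" "lift z\<^sub>1 ?y = (\<lambda>i. - y\<^sub>2 i)"
      using sq by (simp_all add: lax_square_iff)
    have "apart (lift x\<^sub>1 ?y) (lift x\<^sub>1 z\<^sub>1)" unfolding e by (rule generic_pair_apart[OF g(1)])
    from lax_cube[OF t(5) torus_uminusI[OF t(4)] t(6) apart_sym[OF lax_square_apart[OF sq(1)]]
        lax_square_apart[OF sq(2)] lax_square_apart[OF sq(3)] this]
    obtain b\<^sub>1 b\<^sub>2 b\<^sub>3 where b: "b\<^sub>1 \<in> torus n" "b\<^sub>2 \<in> torus n" "b\<^sub>3 \<in> torus n"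
      "lax_square (\<lambda>i. - y i) b\<^sub>3 z b\<^sub>2" "lax_square x b\<^sub>3 z\<^sub>2 b\<^sub>1"
      "lax_square x\<^sub>2 b\<^sub>2 (\<lambda>i. - y\<^sub>2 i) b\<^sub>1" unfolding e .
    then show ?thesis
      using MNM lax_square_swap[of x\<^sub>2]
      by (intro exI[of _ b\<^sub>3] exI[of _ "\<lambda>i. - b\<^sub>2 i"] exI[of _ b\<^sub>1]) (simp add: torus_uminus)
  next
    case MNN
    let ?y = "\<lambda>i. - y\<^sub>2 i" and ?z = "\<lambda>i. - z\<^sub>1 i"
    have sq: "lax_square (\<lambda>i. - y\<^sub>1 i) x x\<^sub>1 (\<lambda>i. - y i)" "lax_square ?z x\<^sub>1 x\<^sub>2 (\<lambda>i. - z i)"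
      "lax_square ?z (\<lambda>i. - y\<^sub>1 i) ?y (\<lambda>i. - z\<^sub>2 i)"
      using c MNN by simp_all
    have e: "lift ?z x\<^sub>2 = x\<^sub>1" "lift x\<^sub>2 ?z = (\<lambda>i. - z i)" "lift ?z ?y = (\<lambda>i. - y\<^sub>1 i)"
      "lift ?y ?z = (\<lambda>i. - z\<^sub>2 i)" "lift (\<lambda>i. - y\<^sub>1 i) x\<^sub>1 = x" "lift x\<^sub>1 (\<lambda>i. - y\<^sub>1 i) = (\<lambda>i. - y i)"
      using sq by (simp_all add: lax_square_iff)
    have ap: "apart x\<^sub>2 ?y" "apart ?z x\<^sub>2" "apart ?z ?y"
      using generic_pair_apart[OF g(3)] lax_square_apart[OF sq(2)] lax_square_apart[OF sq(3)]
      by auto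
    have "apart (lift ?z x\<^sub>2) (lift ?z ?y)" unfolding e by (rule apart_sym[OF lax_square_apart[OF sq(1)]])
    from apart_sym[OF apart_lift_swap[OF ap(2,3,1) this]]
    have "apart (lift x\<^sub>2 ?y) (lift x\<^sub>2 ?z)" .
    from lax_cube[OF t(7) torus_uminusI[OF t(9)] torus_uminusI[OF t(6)] ap(1)
        apart_sym[OF ap(2)] apart_sym[OF ap(3)] this]
    obtain b\<^sub>1 b\<^sub>2 b\<^sub>3 where b: "b\<^sub>1 \<in> torus n" "b\<^sub>2 \<in> torus n" "b\<^sub>3 \<in> torus n"
      "lax_square (lift x\<^sub>2 ?y) b\<^sub>3 (\<lambda>i. - z i) b\<^sub>2"
      "lax_square (lift ?y x\<^sub>2) b\<^sub>3 (\<lambda>i. - z\<^sub>2 i) b\<^sub>1"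
      "lax_square x\<^sub>1 b\<^sub>2 (\<lambda>i. - y\<^sub>1 i) b\<^sub>1" unfolding e .
    have "b\<^sub>1 = x" "b\<^sub>2 = (\<lambda>i. - y i)" using b(6) e by (simp_all add: lax_square_iff)
    moreover have "lax_square ?y (lift ?y x\<^sub>2) x\<^sub>2 (lift x\<^sub>2 ?y)"
      using apart_sym[OF ap(1)] by (simp add: lax_square_iff apart_def)
    moreover have "lift ?y x\<^sub>2 \<in> torus n" "lift x\<^sub>2 ?y \<in> torus n"
      using ap(1) t apart_sym[OF ap(1)] by (auto intro!: lift_torus torus_uminusI simp: apart_def)
    ultimately show ?thesis
      using b MNN lax_square_swap[of "lift x\<^sub>2 ?y"] lax_square_swap[of "lift ?y x\<^sub>2"]
      by (intro exI[of _ "\<lambda>i. - b\<^sub>3 i"] exI[of _ "\<lambda>i. - lift x\<^sub>2 ?y i"] exI[of _ "lift ?y x\<^sub>2"])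
        (simp add: torus_uminus)
  next
    case NNM
    let ?x = "\<lambda>i. - x\<^sub>1 i" and ?y = "\<lambda>i. - y i"
    have sq: "lax_square ?y (\<lambda>i. - x i) ?x (\<lambda>i. - y\<^sub>1 i)" "lax_square ?x z\<^sub>1 z (\<lambda>i. - x\<^sub>2 i)"
      "lax_square (\<lambda>i. - y\<^sub>1 i) z\<^sub>2 z\<^sub>1 (\<lambda>i. - y\<^sub>2 i)"
      using c NNM by simp_all
    have e: "lift ?y ?x = (\<lambda>i. - x i)" "lift ?x ?y = (\<lambda>i. - y\<^sub>1 i)" "lift ?x z = z\<^sub>1"
      "lift z ?x = (\<lambda>i. - x\<^sub>2 i)" "lift (\<lambda>i. - y\<^sub>1 i) z\<^sub>1 = z\<^sub>2" "lift z\<^sub>1 (\<lambda>i. - y\<^sub>1 i) = (\<lambda>i. - y\<^sub>2 i)"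
      using sq by (simp_all add: lax_square_iff)
    have ap: "apart ?x ?y" "apart ?x z" "apart ?y z"
      using generic_pair_apart[OF g(1)] apart_sym[OF lax_square_apart[OF sq(1)]]
        lax_square_apart[OF sq(2)] by auto
    have "apart (lift ?x ?y) (lift ?x z)" unfolding e by (rule lax_square_apart[OF sq(3)])
    from lax_cube[OF torus_uminusI[OF t(5)] torus_uminusI[OF t(2)] t(3) ap this]
    obtain b\<^sub>1 b\<^sub>2 b\<^sub>3 where b: "b\<^sub>1 \<in> torus n" "b\<^sub>2 \<in> torus n" "b\<^sub>3 \<in> torus n"
      "lax_square (\<lambda>i. - y\<^sub>1 i) b\<^sub>3 z\<^sub>1 b\<^sub>2" "lax_square (\<lambda>i. - x i) b\<^sub>3 (lift ?y z) b\<^sub>1"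
      "lax_square (\<lambda>i. - x\<^sub>2 i) b\<^sub>2 (lift z ?y) b\<^sub>1" unfolding e .
    have "b\<^sub>3 = z\<^sub>2" "b\<^sub>2 = (\<lambda>i. - y\<^sub>2 i)" using b(4) e by (simp_all add: lax_square_iff)
    moreover have "lax_square ?y (lift ?y z) z (lift z ?y)"
      using ap(3) by (simp add: lax_square_iff apart_def)
    moreover have "lift ?y z \<in> torus n" "lift z ?y \<in> torus n"
      using ap(3) t apart_sym[OF ap(3)] by (auto intro!: lift_torus torus_uminusI simp: apart_def)
    ultimately show ?thesis
      using b NNM lax_square_swap[of "\<lambda>i. - x\<^sub>2 i"]
      by (intro exI[of _ "lift ?y z"] exI[of _ "\<lambda>i. - lift z ?y i"] exI[of _ "\<lambda>i. - b\<^sub>1 i"])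
        (simp add: torus_uminus)
  qed
qed

section \<open>The crystal structure under refactorizations\<close>

fun eps_at :: "cycle \<Rightarrow> int \<Rightarrow> tuple \<Rightarrow> complex" where
  "eps_at Whirl k x = x (k + 1)"
| "eps_at Curl k x = x k"

abbreviation phi_at :: "cycle \<Rightarrow> int \<Rightarrow> tuple \<Rightarrow> complex" where
  "phi_at A \<equiv> eps_at (flip A)"

fun act_by :: "nat \<Rightarrow> cycle \<Rightarrow> int \<Rightarrow> complex \<Rightarrow> tuple \<Rightarrow> tuple" where
  "act_by n Whirl k c x = rescale n k c x"
| "act_by n Curl k c x = rescale n k (inverse c) x"

lemma crystal_of_simps:
  "points (crystal_of n A) = torus n" "coords (crystal_of n A) = torus_coords"
  "eps (crystal_of n A) k x = Some (eps_at A k x)" "phi (crystal_of n A) k x = Some (phi_at A k x)"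
  "act (crystal_of n A) k c x = Some (act_by n A k c x)"
  by (cases A; simp add: X_M_def X_N_def)+

lemma points_prod_crystal: "points (X \<otimes>\<^sub>c Y) = points X \<times> points Y"
  by (simp add: prod_crystal_def)

lemma coords_prod_crystal: "coords (X \<otimes>\<^sub>c Y) = prod_coords (coords X) (coords Y)"
  by (simp add: prod_crystal_def)

lemma eps_prod_crystal: "eps (crystal_of n A \<otimes>\<^sub>c crystal_of n B) k (x, y) =
    quot (eps_at A k x * eps_at B k y) (phi_at B k y + eps_at A k x)"
  by (simp add: prod_crystal_def crystal_of_simps)

lemma phi_prod_crystal: "phi (crystal_of n A \<otimes>\<^sub>c crystal_of n B) k (x, y) =
    quot (phi_at A k x * phi_at B k y) (eps_at A k x + phi_at B k y)"
  by (simp add: prod_crystal_def crystal_of_simps)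

text \<open>
  The number \<open>c\<^sup>+\<close> by which the action on a product acts on the left factor.
\<close>

definition act_left :: "cycle \<Rightarrow> cycle \<Rightarrow> int \<Rightarrow> complex \<Rightarrow> tuple \<Rightarrow> tuple \<Rightarrow> complex" where
  "act_left A B k c x y = (c * phi_at B k y + eps_at A k x) / (phi_at B k y + eps_at A k x)"

lemma act_prod_crystal: "act (crystal_of n A \<otimes>\<^sub>c crystal_of n B) k c (x, y) =
    (if phi_at B k y + eps_at A k x = 0 \<or> c * phi_at B k y + eps_at A k x = 0 then None
     else Some (act_by n A k (act_left A B k c x y) x, act_by n B k (c / act_left A B k c x y) y))"
  by (simp add: prod_crystal_def crystal_of_simps quot_def act_left_def)

text \<open>
  For equal types numerator and denominator are a product and a coefficient preserved by the square.
  For different types the common denominator changes by the factor that the numerator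
  acquires; the inverse crossing reduces one mixed type to the other.
\<close>

lemma eps_phi_crossing:
  assumes c: "crossing A B x y x' y'" and nz: "\<And>i. x i \<noteq> 0" "\<And>i. y i \<noteq> 0"
  shows "eps (crystal_of n B \<otimes>\<^sub>c crystal_of n A) k (x', y') = eps (crystal_of n A \<otimes>\<^sub>c crystal_of n B) k (x, y)"
    (is ?eps)
    and "phi (crystal_of n B \<otimes>\<^sub>c crystal_of n A) k (x', y') = phi (crystal_of n A \<otimes>\<^sub>c crystal_of n B) k (x, y)"
    (is ?phi)
proof -
  have MN: "x (k + 1) * y k / (y (k + 1) + x (k + 1)) = x' k * y' (k + 1) / (y' k + x' k) \<and>
      x k * y (k + 1) / (x (k + 1) + y (k + 1)) = x' (k + 1) * y' k / (x' k + y' k) \<and>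
      x (k + 1) + y (k + 1) \<noteq> 0 \<and> x' k + y' k \<noteq> 0"
    if "lax_square (\<lambda>i. - x' i) x y' (\<lambda>i. - y i)" for x y x' y'
  proof -
    have mult: "x i * x' i = y i * y' i" for i using that by (simp add: lax_square_def mult.commute)
    have "- x' (i + 1) + x i = y' (i + 1) + - y i" for i using that unfolding lax_square_def by blast
    then have S': "x' (i + 1) + y' (i + 1) = x i + y i" for i by (simp add: field_simps)
    have S: "x' i + y' i \<noteq> 0" for i
    proof -
      have "- x' i \<noteq> y' i" using that unfolding lax_square_def by blast
      then show ?thesis by (simp add: neg_eq_iff_add_eq_0)
    qed
    have Sk: "x k + y k \<noteq> 0" "x (k + 1) + y (k + 1) \<noteq> 0"
      using S[of "k + 1"] S[of "k + 1 + 1"] unfolding S' by simp_all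
    have xk: "x' k * (x k + y k) = y k * (x' k + y' k)" "y' k * (x k + y k) = x k * (x' k + y' k)"
      using mult[of k] by (simp_all add: algebra_simps)
    have xk1: "x' (k + 1) = y (k + 1) * ((x k + y k) / (x (k + 1) + y (k + 1)))"
      "y' (k + 1) = x (k + 1) * ((x k + y k) / (x (k + 1) + y (k + 1)))"
      unfolding S'[of k, symmetric]
      using Sk(2) mult[of "k + 1"] by (simp_all add: nonzero_eq_divide_eq algebra_simps)
    have "x' k * y' (k + 1) / (x' k + y' k)
        = x (k + 1) * (x' k * (x k + y k)) / ((x (k + 1) + y (k + 1)) * (x' k + y' k))"
      unfolding xk1 by simp
    then have "x' k * y' (k + 1) / (x' k + y' k) = x (k + 1) * y k / (x (k + 1) + y (k + 1))"
      unfolding xk using S[of k] by simp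
    moreover have "x' (k + 1) * y' k / (x' k + y' k)
        = y (k + 1) * (y' k * (x k + y k)) / ((x (k + 1) + y (k + 1)) * (x' k + y' k))"
      unfolding xk1 by simp
    then have "x' (k + 1) * y' k / (x' k + y' k) = x k * y (k + 1) / (x (k + 1) + y (k + 1))"
      unfolding xk using S[of k] by simp
    ultimately show ?thesis using Sk S by (simp add: add.commute)
  qed
  have "?eps \<and> ?phi"
  proof (cases A; cases B)
    assume AB: "A = Whirl" "B = Whirl"
    then have Q: "lax_square x y x' y'" using c by simp
    have "x i * y i = x' i * y' i" "x (i + 1) + y i = x' (i + 1) + y' i" for i
      using Q unfolding lax_square_def by blast+
    moreover from this(2) have "y i + x (i + 1) = y' i + x' (i + 1)" for i
      unfolding add.commute[of "y i"] add.commute[of "y' i"] .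
    ultimately show ?thesis using AB unfolding eps_prod_crystal phi_prod_crystal by simp
  next
    assume AB: "A = Curl" "B = Curl"
    then have Q: "lax_square (\<lambda>i. - y i) (\<lambda>i. - x i) (\<lambda>i. - y' i) (\<lambda>i. - x' i)" using c by simp
    have "x i * y i = x' i * y' i" for i using Q by (simp add: lax_square_def mult.commute)
    moreover have "x i + y (i + 1) = x' i + y' (i + 1)" "y (i + 1) + x i = y' (i + 1) + x' i" for i
    proof -
      have "- y (i + 1) + - x i = - y' (i + 1) + - x' i" using Q unfolding lax_square_def by blast
      then show "y (i + 1) + x i = y' (i + 1) + x' i" by (simp only: minus_add_distrib[symmetric] neg_equal_iff_equal)
      then show "x i + y (i + 1) = x' i + y' (i + 1)" by (simp only: ac_simps)
    qed
    ultimately show ?thesis using AB unfolding eps_prod_crystal phi_prod_crystal by simp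
  next
    assume AB: "A = Whirl" "B = Curl"
    then have "lax_square (\<lambda>i. - x' i) x y' (\<lambda>i. - y i)" using c by simp
    from MN[OF this] AB show ?thesis
      unfolding eps_prod_crystal phi_prod_crystal by (simp add: quot_def add.commute)
  next
    assume AB: "A = Curl" "B = Whirl"
    then have "lax_square (\<lambda>i. - x i) x' y (\<lambda>i. - y' i)" using c by simp
    from MN[OF this] AB show ?thesis
      unfolding eps_prod_crystal phi_prod_crystal by (simp add: quot_def add.commute)
  qed
  then show ?eps ?phi by auto
qed

lemma cong_shift_iff: "[i + 1 = k + 1] (mod int n) \<longleftrightarrow> [i = k] (mod int n)"
  by (simp add: cong_add_rcancel)

lemma cong_Suc_exclusive:
  assumes "n \<ge> 2" "[i = k] (mod int n)"
  shows "\<not> [i = k + 1] (mod int n)" "\<not> [i + 1 = k] (mod int n)"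
proof -
  have *: "\<not> [j + 1 = j] (mod int n)" for j
    using assms(1) by (simp add: cong_iff_dvd_diff)
  show "\<not> [i = k + 1] (mod int n)" using * assms(2) by (meson cong_sym cong_trans)
  show "\<not> [i + 1 = k] (mod int n)" using * assms(2) by (meson cong_sym cong_trans)
qed

lemma rescale_at: "[i = k] (mod int n) \<Longrightarrow> rescale n k c x i = c * x i"
  by (simp add: rescale_def)

lemma rescale_at_Suc:
  "n \<ge> 2 \<Longrightarrow> [i = k + 1] (mod int n) \<Longrightarrow> rescale n k c x i = inverse c * x i"
  using cong_Suc_exclusive(1)[of n i k] by (auto simp: rescale_def)

lemma rescale_other:
  "\<not> [i = k] (mod int n) \<Longrightarrow> \<not> [i = k + 1] (mod int n) \<Longrightarrow> rescale n k c x i = x i"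
  by (simp add: rescale_def)

lemma rescale_mult: "rescale n k c x i * rescale n k d y i = rescale n k (c * d) (\<lambda>j. x j * y j) i"
  by (simp add: rescale_def)

lemma rescale_torus:
  assumes "c \<noteq> 0" "x \<in> torus n"
  shows "rescale n k c x \<in> torus n"
proof -
  have "[i + int n = j] (mod int n) \<longleftrightarrow> [i = j] (mod int n)" for i j
    by (simp add: cong_def)
  with assms show ?thesis by (simp add: torus_def rescale_def)
qed

lemma period_prod_rescale:
  assumes n: "n \<ge> 2" and c: "c \<noteq> 0"
  shows "period_prod n (rescale n k c x) = period_prod n x"
proof -
  define f where "f = rescale n k c (\<lambda>_. 1)"
  obtain m where m: "n = Suc (Suc m)" using n by (metis Suc_le_D numeral_2_eq_2 Suc_le_mono)
  have "f \<in> torus n" unfolding f_def by (rule rescale_torus[OF c]) (simp add: torus_def)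
  then have "period_prod n f = (\<Prod>j<n. f (k + int j))"
    by (simp add: period_prod_shift torus_iff)
  also have "\<dots> = f k * f (k + 1) * (\<Prod>j<m. f (k + int (Suc (Suc j))))"
    unfolding m by (simp only: prod.lessThan_Suc_shift) (simp add: algebra_simps)
  also have "(\<Prod>j<m. f (k + int (Suc (Suc j)))) = (\<Prod>j<m. 1)"
  proof (rule prod.cong)
    fix j assume "j \<in> {..<m}"
    then have "\<not> int n dvd 2 + int j" "\<not> int n dvd 1 + int j"
      unfolding m by (auto dest!: zdvd_imp_le)
    then have "\<not> [k + int (Suc (Suc j)) = k] (mod int n)"
      "\<not> [k + int (Suc (Suc j)) = k + 1] (mod int n)"
      by (simp_all add: cong_iff_dvd_diff algebra_simps)
    then show "f (k + int (Suc (Suc j))) = 1" unfolding f_def by (simp add: rescale_other)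
  qed simp
  also have "f k * f (k + 1) * (\<Prod>j<m. 1) = 1"
    unfolding f_def using rescale_at[of k k n c "\<lambda>_. 1"] rescale_at_Suc[OF n, of "k + 1" k c "\<lambda>_. 1"] c
    by simp
  finally have f: "period_prod n f = 1" .
  have "rescale n k c x = (\<lambda>i. f i * x i)" unfolding f_def by (auto simp: rescale_def)
  then have "period_prod n (rescale n k c x) = period_prod n f * period_prod n x"
    by (simp add: period_prod_def prod.distrib)
  with f show ?thesis by simp
qed

lemma periodic_values_cong:
  assumes "x \<in> torus n" "[i = k] (mod int n)"
  shows "x i = x k" "x (i + 1) = x (k + 1)"
proof -
  have per: "periodic n x" using assms(1) by (simp add: torus_iff)
  have "[i + 1 = k + 1] (mod int n)" using assms(2) by (simp only: cong_shift_iff)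
  then show "x i = x k" "x (i + 1) = x (k + 1)"
    using periodic_cong[OF per] assms(2) by blast+
qed

text \<open>
  The effect of \<open>e_k^c\<close> on the coefficients of \<open>(T + y) (T + x)\<close> is expressed by \<open>c\<close> and the
  values \<open>x k * y k / (y k + x (k + 1))\<close> of \<open>\<phi>_k\<close> and \<open>x (k + 1) * y (k + 1) / (y k + x (k + 1))\<close> of
  \<open>\<epsilon>_k\<close> alone.  Since these are invariant under the move, so is the change of the coefficients.
  Writing both corrections as summands treats \<open>n = 2\<close>, where they meet in the same
  coefficient, together with the other cases.
\<close>

lemma act_sum_Whirl_Whirl:
  assumes n: "n \<ge> 2" and c: "c \<noteq> 0" and x: "x \<in> torus n" and y: "y \<in> torus n"
    and ne: "y k + x (k + 1) \<noteq> 0" "c * y k + x (k + 1) \<noteq> 0"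
  defines "c\<^sub>1 \<equiv> (c * y k + x (k + 1)) / (y k + x (k + 1))"
  shows "rescale n k c\<^sub>1 x (i + 1) + rescale n k (c / c\<^sub>1) y i = x (i + 1) + y i
    + (if [i + 1 = k] (mod int n) then (c - 1) * (x k * y k / (y k + x (k + 1))) else 0)
    - (if [i = k + 1] (mod int n)
       then (1 - 1 / c) * (x (k + 1) * y (k + 1) / (y k + x (k + 1))) else 0)"
proof (cases "[i = k] (mod int n)")
  case True
  have c1: "c\<^sub>1 \<noteq> 0" using ne by (simp add: c\<^sub>1_def)
  have "[i + 1 = k + 1] (mod int n)" using True by (simp only: cong_shift_iff)
  then have "rescale n k c\<^sub>1 x (i + 1) + rescale n k (c / c\<^sub>1) y i = (x (k + 1) + c * y k) / c\<^sub>1"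
    using rescale_at[OF True, of "c / c\<^sub>1" y]
      periodic_values_cong[OF x True] periodic_values_cong[OF y True]
    by (simp add: rescale_at_Suc[OF n] divide_inverse algebra_simps)
  also have "\<dots> = x (k + 1) + y k" using ne by (simp add: c\<^sub>1_def add.commute)
  finally show ?thesis
    using cong_Suc_exclusive[OF n True] periodic_values_cong[OF x True] periodic_values_cong[OF y True]
    by simp
next
  case False
  have c1: "c\<^sub>1 \<noteq> 0" using ne by (simp add: c\<^sub>1_def)
  have "rescale n k c\<^sub>1 x (i + 1) = x (i + 1)
      + (if [i + 1 = k] (mod int n) then (c - 1) * (x k * y k / (y k + x (k + 1))) else 0)"
  proof (cases "[i + 1 = k] (mod int n)")
    case True
    have "c\<^sub>1 * x k = x k + (c - 1) * (x k * y k / (y k + x (k + 1)))"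
      unfolding c\<^sub>1_def using ne(1) by (simp add: divide_simps) (simp add: algebra_simps)
    then show ?thesis
      using True rescale_at[OF True, of c\<^sub>1 x] periodic_values_cong(1)[OF x True] by simp
  next
    case F: False
    then show ?thesis using False by (simp add: rescale_other cong_shift_iff)
  qed
  moreover have "rescale n k (c / c\<^sub>1) y i = y i - (if [i = k + 1] (mod int n)
       then (1 - 1 / c) * (x (k + 1) * y (k + 1) / (y k + x (k + 1))) else 0)"
  proof (cases "[i = k + 1] (mod int n)")
    case True
    have "inverse (c / c\<^sub>1) * y (k + 1) =
        y (k + 1) - (1 - 1 / c) * (x (k + 1) * y (k + 1) / (y k + x (k + 1)))"
      unfolding c\<^sub>1_def using ne c by (simp add: divide_simps) (simp add: algebra_simps)
    then show ?thesis
      using True rescale_at_Suc[OF n True, of "c / c\<^sub>1" y] periodic_values_cong(1)[OF y True] by simp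
  next
    case F: False
    then show ?thesis using False by (simp add: rescale_other)
  qed
  ultimately show ?thesis by simp
qed

lemma act_crossing_Whirl_Whirl:
  assumes n: "n \<ge> 2" and c: "c \<noteq> 0"
    and t: "x \<in> torus n" "y \<in> torus n" "x' \<in> torus n" "y' \<in> torus n"
    and Q: "lax_square x y x' y'"
    and ne: "y k + x (k + 1) \<noteq> 0" "c * y k + x (k + 1) \<noteq> 0" "c * y' k + x' (k + 1) \<noteq> 0"
  defines "c\<^sub>1 \<equiv> (c * y k + x (k + 1)) / (y k + x (k + 1))"
    and "c\<^sub>1' \<equiv> (c * y' k + x' (k + 1)) / (y' k + x' (k + 1))"
  shows "lax_square (rescale n k c\<^sub>1 x) (rescale n k (c / c\<^sub>1) y)
    (rescale n k c\<^sub>1' x') (rescale n k (c / c\<^sub>1') y')"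
proof -
  have mult: "x i * y i = x' i * y' i" and add: "x (i + 1) + y i = x' (i + 1) + y' i"
    and ap: "x i \<noteq> x' i" for i
    using Q unfolding lax_square_def by blast+
  have add': "y k + x (k + 1) = y' k + x' (k + 1)" using add[of k] by (simp add: add.commute)
  have c1: "c\<^sub>1 \<noteq> 0" "c\<^sub>1' \<noteq> 0" using ne add' by (simp_all add: c\<^sub>1_def c\<^sub>1'_def)
  show ?thesis
  proof (rule lax_squareI)
    fix i
    show "rescale n k c\<^sub>1 x i * rescale n k (c / c\<^sub>1) y i
        = rescale n k c\<^sub>1' x' i * rescale n k (c / c\<^sub>1') y' i"
      unfolding rescale_mult using c1 by (simp add: mult)
    have ne': "y' k + x' (k + 1) \<noteq> 0" using ne(1) add' by simp
    show "rescale n k c\<^sub>1 x (i + 1) + rescale n k (c / c\<^sub>1) y i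
        = rescale n k c\<^sub>1' x' (i + 1) + rescale n k (c / c\<^sub>1') y' i"
      unfolding act_sum_Whirl_Whirl[OF n c t(1,2) ne(1,2), of i, folded c\<^sub>1_def]
        act_sum_Whirl_Whirl[OF n c t(3,4) ne' ne(3), of i, folded c\<^sub>1'_def] add' mult add[of i] ..
    show "rescale n k c\<^sub>1 x i \<noteq> 0" using rescale_torus[OF c1(1) t(1)] by (simp add: torus_def)
    show "rescale n k (c / c\<^sub>1') y' i \<noteq> 0"
      using rescale_torus[OF _ t(4), of "c / c\<^sub>1'"] c c1(2) by (simp add: torus_def)
  next
    have "c\<^sub>1 * x k = x k + (c - 1) * (x k * y k / (y k + x (k + 1)))"
      unfolding c\<^sub>1_def using ne(1) by (simp add: divide_simps) (simp add: algebra_simps)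
    moreover have "c\<^sub>1' * x' k = x' k + (c - 1) * (x' k * y' k / (y' k + x' (k + 1)))"
      unfolding c\<^sub>1'_def using ne(1) add' by (simp add: divide_simps) (simp add: algebra_simps)
    ultimately have "c\<^sub>1 * x k \<noteq> c\<^sub>1' * x' k" using ap[of k] by (simp add: mult add')
    then show "rescale n k c\<^sub>1 x k \<noteq> rescale n k c\<^sub>1' x' k" by (simp add: rescale_at)
  qed
qed

text \<open>
  Only the coefficient at \<open>i = k\<close> changes.  Both sides multiply it by factors
  \<open>(c * x k + y k) / (x k + y k)\<close> and \<open>(c * y (k + 1) + x (k + 1)) / (x (k + 1) + y (k + 1))\<close>,
  up to the power of \<open>c\<close>; the side before the move has the second as \<open>c\<^sup>+\<close>, the side after the
  move has the first.
\<close>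

lemma act_crossing_Whirl_Curl:
  assumes n: "n \<ge> 2" and c: "c \<noteq> 0"
    and t: "x \<in> torus n" "y \<in> torus n" "x' \<in> torus n" "y' \<in> torus n"
    and Q: "lax_square (\<lambda>i. - x' i) x y' (\<lambda>i. - y i)"
    and ne: "y (k + 1) + x (k + 1) \<noteq> 0" "c * y (k + 1) + x (k + 1) \<noteq> 0"
      "y' k + x' k \<noteq> 0" "c * y' k + x' k \<noteq> 0"
  defines "c\<^sub>1 \<equiv> (c * y (k + 1) + x (k + 1)) / (y (k + 1) + x (k + 1))"
    and "c\<^sub>1' \<equiv> (c * y' k + x' k) / (y' k + x' k)"
  shows "lax_square (\<lambda>i. - rescale n k (inverse c\<^sub>1') x' i) (rescale n k c\<^sub>1 x)
    (rescale n k (c / c\<^sub>1') y') (\<lambda>i. - rescale n k (inverse (c / c\<^sub>1)) y i)"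
proof -
  have mult: "x' i * x i = y' i * y i" for i using Q by (simp add: lax_square_def)
  have "- x' (i + 1) + x i = y' (i + 1) + - y i" for i using Q unfolding lax_square_def by blast
  then have add: "x' (i + 1) + y' (i + 1) = x i + y i" for i by (simp add: field_simps)
  have c1: "c\<^sub>1 \<noteq> 0" "c\<^sub>1' \<noteq> 0" using ne by (simp_all add: c\<^sub>1_def c\<^sub>1'_def)
  have S: "rescale n k c\<^sub>1 x i + rescale n k (inverse (c / c\<^sub>1)) y i =
      (if [i = k] (mod int n) then c\<^sub>1 * (x k + y k / c) else x i + y i)" for i
  proof -
    consider "[i = k] (mod int n)" | "\<not> [i = k] (mod int n)" "[i = k + 1] (mod int n)"
      | "\<not> [i = k] (mod int n)" "\<not> [i = k + 1] (mod int n)" by blast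
    then show ?thesis
    proof cases
      case 1
      then show ?thesis using periodic_values_cong[OF t(1) 1] periodic_values_cong[OF t(2) 1] c
        by (simp add: rescale_at algebra_simps)
    next
      case 2
      have "inverse c\<^sub>1 * x (k + 1) + c / c\<^sub>1 * y (k + 1) = (c * y (k + 1) + x (k + 1)) / c\<^sub>1"
        by (simp add: divide_inverse algebra_simps)
      also have "\<dots> = x (k + 1) + y (k + 1)" using ne by (simp add: c\<^sub>1_def add.commute)
      finally show ?thesis
        using 2 periodic_values_cong(1)[OF t(1) 2(2)] periodic_values_cong(1)[OF t(2) 2(2)]
        by (simp add: rescale_at_Suc[OF n])
    next
      case 3
      then show ?thesis by (simp add: rescale_other)
    qed
  qed
  have S': "rescale n k (inverse c\<^sub>1') x' i + rescale n k (c / c\<^sub>1') y' i =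
      (if [i = k + 1] (mod int n) then c\<^sub>1' * (x' (k + 1) + y' (k + 1) / c) else x' i + y' i)" for i
  proof -
    consider "\<not> [i = k + 1] (mod int n)" "[i = k] (mod int n)" | "[i = k + 1] (mod int n)"
      | "\<not> [i = k] (mod int n)" "\<not> [i = k + 1] (mod int n)" by blast
    then show ?thesis
    proof cases
      case 1
      have "inverse c\<^sub>1' * x' k + c / c\<^sub>1' * y' k = (c * y' k + x' k) / c\<^sub>1'"
        by (simp add: divide_inverse algebra_simps)
      also have "\<dots> = x' k + y' k" using ne by (simp add: c\<^sub>1'_def add.commute)
      finally show ?thesis
        using 1 periodic_values_cong(1)[OF t(3) 1(2)] periodic_values_cong(1)[OF t(4) 1(2)]
        by (simp add: rescale_at)
    next
      case 2
      then show ?thesis using periodic_values_cong[OF t(3) 2] periodic_values_cong[OF t(4) 2] c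
        by (simp add: rescale_at_Suc[OF n] algebra_simps)
    next
      case 3
      then show ?thesis by (simp add: rescale_other)
    qed
  qed
  have key: "c\<^sub>1 * (x k + y k / c) = c\<^sub>1' * (x' (k + 1) + y' (k + 1) / c)"
  proof -
    have Sk: "x k + y k \<noteq> 0"
      using Q add[of k] by (metis lax_square_def neg_eq_iff_add_eq_0)
    have 1: "x' i * (x i + y i) = y i * (x' i + y' i)" "y' i * (x i + y i) = x i * (x' i + y' i)" for i
      using mult[of i] by (simp_all add: algebra_simps)
    have "(c * y' k + x' k) * (x k + y k) = (c * x k + y k) * (y' k + x' k)"
      using 1[of k] by (simp add: algebra_simps)
    then have l: "c\<^sub>1' = (c * x k + y k) / (x k + y k)"
      unfolding c\<^sub>1'_def using Sk ne by (simp add: frac_eq_eq)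
    have "(c * x' (k + 1) + y' (k + 1)) * (y (k + 1) + x (k + 1))
        = (c * y (k + 1) + x (k + 1)) * (x k + y k)"
      unfolding add[of k, symmetric] using 1[of "k + 1"] by (simp add: algebra_simps)
    then have r: "c\<^sub>1 = (c * x' (k + 1) + y' (k + 1)) / (x k + y k)"
      unfolding c\<^sub>1_def using Sk ne by (simp add: frac_eq_eq)
    show ?thesis unfolding l r using c Sk by (simp add: divide_simps) (simp add: algebra_simps)
  qed
  show ?thesis
  proof (rule lax_squareI)
    fix i
    have "rescale n k (inverse c\<^sub>1') x' i * rescale n k c\<^sub>1 x i
        = rescale n k (c / c\<^sub>1') y' i * rescale n k (inverse (c / c\<^sub>1)) y i"
      unfolding rescale_mult mult using c by (simp add: field_simps)
    then show "- rescale n k (inverse c\<^sub>1') x' i * rescale n k c\<^sub>1 x i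
        = rescale n k (c / c\<^sub>1') y' i * - rescale n k (inverse (c / c\<^sub>1)) y i" by simp
    have "rescale n k (inverse c\<^sub>1') x' (i + 1) + rescale n k (c / c\<^sub>1') y' (i + 1)
        = rescale n k c\<^sub>1 x i + rescale n k (inverse (c / c\<^sub>1)) y i"
      unfolding S S' cong_shift_iff key add ..
    then show "- rescale n k (inverse c\<^sub>1') x' (i + 1) + rescale n k c\<^sub>1 x i
        = rescale n k (c / c\<^sub>1') y' (i + 1) + - rescale n k (inverse (c / c\<^sub>1)) y i"
      by (simp add: field_simps)
    show "- rescale n k (inverse c\<^sub>1') x' i \<noteq> 0"
      using rescale_torus[OF _ t(3), of "inverse c\<^sub>1'"] c1 by (simp add: torus_def)
    show "- rescale n k (inverse (c / c\<^sub>1)) y i \<noteq> 0"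
      using rescale_torus[OF _ t(2), of "inverse (c / c\<^sub>1)"] c1 c by (simp add: torus_def)
  next
    have "\<not> [k = k + 1] (mod int n)" using cong_Suc_exclusive[OF n, of k k] by simp
    then have "rescale n k (inverse c\<^sub>1') x' k + rescale n k (c / c\<^sub>1') y' k \<noteq> 0"
      using ne(3) by (simp add: S' add.commute)
    then show "- rescale n k (inverse c\<^sub>1') x' k \<noteq> rescale n k (c / c\<^sub>1') y' k"
      by (simp add: neg_eq_iff_add_eq_0)
  qed
qed

lemma act_defined:
  assumes "act (crystal_of n A \<otimes>\<^sub>c crystal_of n B) k c (x, y) = Some (u, v)"
  shows "phi_at B k y + eps_at A k x \<noteq> 0" "c * phi_at B k y + eps_at A k x \<noteq> 0"
    "u = act_by n A k (act_left A B k c x y) x" "v = act_by n B k (c / act_left A B k c x y) y"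
  using assms unfolding act_prod_crystal by (auto split: if_splits)

lemma act_by_torus:
  "c \<noteq> 0 \<Longrightarrow> x \<in> torus n \<Longrightarrow> act_by n A k c x \<in> torus n"
  by (cases A) (simp_all add: rescale_torus)

lemma act_torus:
  assumes "act (crystal_of n A \<otimes>\<^sub>c crystal_of n B) k c (x, y) = Some (u, v)"
    "c \<noteq> 0" "x \<in> torus n" "y \<in> torus n"
  shows "u \<in> torus n" "v \<in> torus n"
  using act_defined[OF assms(1)] assms(2-4) by (auto intro!: act_by_torus simp: act_left_def)

lemma act_period_prod:
  assumes "act (crystal_of n A \<otimes>\<^sub>c crystal_of n B) k c (x, y) = Some (u, v)" "n \<ge> 2" "c \<noteq> 0"
  shows "period_prod n u = period_prod n x" "period_prod n v = period_prod n y"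
proof -
  have "period_prod n (act_by n A k c x) = period_prod n x" if "c \<noteq> 0" for A c x
    using that assms(2) by (cases A) (simp_all add: period_prod_rescale)
  with act_defined[OF assms(1)] assms(3)
  show "period_prod n u = period_prod n x" "period_prod n v = period_prod n y"
    by (auto simp: act_left_def)
qed

text \<open>
  Reading from right to left replaces \<open>c\<close> by its inverse and exchanges the two factors into which
  \<open>c\<close> is split.
\<close>

lemma act_mirror:
  assumes "act (crystal_of n Curl \<otimes>\<^sub>c crystal_of n Curl) k c (x, y) = Some (u, v)" "c \<noteq> 0"
  shows "act (crystal_of n Whirl \<otimes>\<^sub>c crystal_of n Whirl) k (inverse c) (y, x) = Some (v, u)"
proof -
  have d: "y (k + 1) + x k \<noteq> 0" "c * y (k + 1) + x k \<noteq> 0" using act_defined[OF assms(1)] by simp_all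
  have "inverse c * x k + y (k + 1) = (c * y (k + 1) + x k) / c"
    using assms(2) by (simp add: field_simps)
  then have e: "act_left Whirl Whirl k (inverse c) y x = inverse (c / act_left Curl Curl k c x y)"
    "inverse c / act_left Whirl Whirl k (inverse c) y x = inverse (act_left Curl Curl k c x y)"
    "inverse c * x k + y (k + 1) \<noteq> 0"
    unfolding act_left_def using d assms(2) by (simp_all add: add.commute)
  show ?thesis
    unfolding act_prod_crystal unfolding e(2) unfolding e(1) using e(3) d act_defined(3,4)[OF assms(1)]
    by (simp add: add.commute)
qed

text \<open>
  Whirl-whirl and whirl-curl are computed; the inverse crossing and the mirror image give the
  other two.
\<close>

lemma act_crossing:
  assumes n: "n \<ge> 2" and c: "c \<noteq> 0"
    and t: "x \<in> torus n" "y \<in> torus n" "x' \<in> torus n" "y' \<in> torus n"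
    and cr: "crossing A B x y x' y'"
    and a: "act (crystal_of n A \<otimes>\<^sub>c crystal_of n B) k c (x, y) = Some (u, v)"
    and a': "act (crystal_of n B \<otimes>\<^sub>c crystal_of n A) k c (x', y') = Some (u', v')"
  shows "crossing A B u v u' v'"
proof -
  have MM: "crossing Whirl Whirl u v u' v'"
    if "x \<in> torus n" "y \<in> torus n" "x' \<in> torus n" "y' \<in> torus n"
      "crossing Whirl Whirl x y x' y'" "c \<noteq> 0"
      and a: "act (crystal_of n Whirl \<otimes>\<^sub>c crystal_of n Whirl) k c (x, y) = Some (u, v)"
      and a': "act (crystal_of n Whirl \<otimes>\<^sub>c crystal_of n Whirl) k c (x', y') = Some (u', v')"
    for x y x' y' u v u' v' c
    using act_crossing_Whirl_Whirl[OF n that(6,1-4), of k] that(5) act_defined[OF a] act_defined[OF a']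
    by (simp add: act_left_def)
  have MN: "crossing Whirl Curl u v u' v'"
    if "x \<in> torus n" "y \<in> torus n" "x' \<in> torus n" "y' \<in> torus n"
      "crossing Whirl Curl x y x' y'"
      and a: "act (crystal_of n Whirl \<otimes>\<^sub>c crystal_of n Curl) k c (x, y) = Some (u, v)"
      and a': "act (crystal_of n Curl \<otimes>\<^sub>c crystal_of n Whirl) k c (x', y') = Some (u', v')"
    for x y x' y' u v u' v'
    using act_crossing_Whirl_Curl[OF n c that(1-4), of k] that(5) act_defined[OF a] act_defined[OF a']
    by (simp add: act_left_def)
  show ?thesis
  proof (cases A; cases B)
    assume "A = Whirl" "B = Whirl"
    then show ?thesis using MM[OF t _ c] cr a a' by blast
  next
    assume "A = Whirl" "B = Curl"
    then show ?thesis using MN[OF t] cr a a' by blast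
  next
    assume "A = Curl" "B = Whirl"
    then show ?thesis
      using MN[OF t(3,4,1,2)] cr a a' crossing_inverse by blast
  next
    assume AB: "A = Curl" "B = Curl"
    have "inverse c \<noteq> 0" using c by simp
    from MM[OF t(2,1,4,3) _ this act_mirror act_mirror] AB a a' c crossing_mirror[OF cr]
    have "crossing Whirl Whirl v u v' u'" by simp
    from crossing_mirror[OF this] AB show ?thesis by simp
  qed
qed

section \<open>The moves as birational maps\<close>

text \<open>
  Rational maps, their equality and birationality depend only on points and coordinates of the
  varieties, so all products of crystals can be replaced by products of this torus.
\<close>

definition torus_variety :: "nat \<Rightarrow> tuple variety" where
  "torus_variety n = \<lparr>points = torus n, coords = torus_coords\<rparr>"

abbreviation torus2 :: "nat \<Rightarrow> (tuple \<times> tuple) variety" where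
  "torus2 n \<equiv> prod_variety (torus_variety n) (torus_variety n)"

abbreviation torus3 :: "nat \<Rightarrow> (tuple \<times> tuple \<times> tuple) variety" where
  "torus3 n \<equiv> prod_variety (torus_variety n) (torus2 n)"

lemma torus_variety_simps [simp]:
  "points (torus_variety n) = torus n" "coords (torus_variety n) = torus_coords"
  by (simp_all add: torus_variety_def)

lemma zariski_cong:
  "points V = points V' \<Longrightarrow> coords V = coords V' \<Longrightarrow> zariski V = zariski V'"
  by (simp add: zariski_def)

lemma rat_eq_cong:
  "points V = points V' \<Longrightarrow> coords V = coords V' \<Longrightarrow> rat_eq V f g = rat_eq V' f g"
  by (simp add: rat_eq_def zariski_cong[of V V'])

lemma rational_map_variety_cong:
  assumes "points V = points V'" "coords V = coords V'" "points W = points W'" "coords W = coords W'"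
  shows "rational_map V W f = rational_map V' W' f"
  using assms by (simp add: rational_map_def regular_on_def zariski_cong[of V V'])

lemma birational_map_variety_cong:
  assumes "points V = points V'" "coords V = coords V'" "points W = points W'" "coords W = coords W'"
  shows "birational_map V W f = birational_map V' W' f"
  unfolding birational_map_def rational_map_variety_cong[OF assms]
    rational_map_variety_cong[OF assms(3,4,1,2)] rat_eq_cong[OF assms(1,2)] rat_eq_cong[OF assms(3,4)] ..

lemma points_coords_crystal:
  "points (crystal_of n A \<otimes>\<^sub>c crystal_of n B) = points (torus2 n)"
  "coords (crystal_of n A \<otimes>\<^sub>c crystal_of n B) = coords (torus2 n)"
  by (simp_all add: points_prod_crystal coords_prod_crystal crystal_of_simps)

lemma prod_variety_crystal:
  "prod_variety (crystal_of n A) (prod_variety (crystal_of n B) (crystal_of n C)) = torus3 n"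
  by (simp add: prod_variety_def crystal_of_simps torus_variety_def)

lemma const_torus: "(\<lambda>_. c) \<in> torus n \<longleftrightarrow> c \<noteq> 0"
  by (simp add: torus_def)

text \<open>
  Turns a condition at infinitely many indices into the nonvanishing of one regular function.
\<close>

lemma periodic_all_nonzero_iff:
  assumes "n \<ge> 1" "periodic n f"
  shows "(\<forall>i. f i \<noteq> 0) \<longleftrightarrow> (\<Prod>j<n. f (int j)) \<noteq> 0"
proof -
  have "f i \<noteq> 0" if all: "\<forall>j<n. f (int j) \<noteq> 0" for i
  proof -
    \<comment> \<open>Every index is congruent to one in the range of the product.\<close>
    have "[int (nat (i mod int n)) = i] (mod int n)" using assms(1) by (simp add: cong_def)
    then have "f (int (nat (i mod int n))) = f i" by (rule periodic_cong[OF assms(2)])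
    moreover have "nat (i mod int n) < n" using assms(1) by (simp add: nat_less_iff)
    ultimately show ?thesis using all by metis
  qed
  then show ?thesis by auto
qed

lemma regular_on_fst: "openin (zariski (torus2 n)) D \<Longrightarrow> regular_on (torus2 n) D (\<lambda>p. fst p i)"
  using regular_on_coord[of "torus2 n" D "(\<lambda>x. x i) \<circ> fst"] prod_coords_fst[of "\<lambda>x. x i" torus_coords torus_coords]
  by (simp add: torus_coords_def comp_def)

lemma regular_on_snd: "openin (zariski (torus2 n)) D \<Longrightarrow> regular_on (torus2 n) D (\<lambda>p. snd p i)"
  using regular_on_coord[of "torus2 n" D "(\<lambda>x. x i) \<circ> snd"] prod_coords_snd[of "\<lambda>x. x i" torus_coords torus_coords]
  by (simp add: torus_coords_def comp_def)

text \<open>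
  The common shape of the four moves: all weights are multiplied by quotients of
  neighbouring values of one sequence of denominators, which allows their regularity to be
  treated uniformly.
\<close>

fun move_den :: "nat \<Rightarrow> cycle \<Rightarrow> cycle \<Rightarrow> tuple \<Rightarrow> tuple \<Rightarrow> tuple" where
  "move_den n Whirl Whirl x y = whurl_L n x y"
| "move_den n Curl Curl x y = whurl_K n x y"
| "move_den n _ _ x y = (\<lambda>i. x i + y i)"

lemma move_eq:
  "move n A B (x, y) =
    (let D = move_den n A B x y; s = (if B = Whirl then 1 else -1)
     in if \<forall>i. D i \<noteq> 0
        then Some (\<lambda>i. y i * D (i + s) / D i,
          \<lambda>i. if A = B then x i * D i / D (i + s) else x i * D (i + s) / D i)
        else None)"
  by (cases A; cases B) (simp_all add: Let_def)

lemma periodic_move_den: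
  assumes "x \<in> torus n" "y \<in> torus n"
  shows "periodic n (move_den n A B x y)"
proof -
  have per: "periodic n x" "periodic n y" using assms by (simp_all add: torus_iff)
  then have "periodic n (\<lambda>i. x i + y i)" by (simp add: periodic_def)
  then show ?thesis
    using periodic_whurl_L[OF per] periodic_whurl_K[OF per] by (cases A; cases B) simp_all
qed

lemma regular_on_move_den:
  assumes D: "openin (zariski (torus2 n)) D"
  shows "regular_on (torus2 n) D (\<lambda>p. move_den n A B (fst p) (snd p) i)"
proof -
  have "regular_on (torus2 n) D (\<lambda>p. fst p i + snd p i)"
    by (intro regular_on_add regular_on_fst regular_on_snd D)
  moreover have "regular_on (torus2 n) D (\<lambda>p. whurl_L n (fst p) (snd p) i)"
    unfolding whurl_L_def
    by (intro regular_on_sum regular_on_mult regular_on_prod regular_on_fst regular_on_snd D)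
  moreover have "regular_on (torus2 n) D (\<lambda>p. whurl_K n (fst p) (snd p) i)"
    unfolding whurl_K_def
    by (intro regular_on_sum regular_on_mult regular_on_prod regular_on_fst regular_on_snd D)
  ultimately show ?thesis by (cases A; cases B) simp_all
qed

lemma rational_map_move:
  assumes n: "n \<ge> 1"
  shows "rational_map (torus2 n) (torus2 n) (move n A B)"
proof -
  let ?D = "dom (move n A B) \<inter> points (torus2 n)"
  let ?d = "\<lambda>p. move_den n A B (fst p) (snd p)"
  define s :: int where "s = (if B = Whirl then 1 else -1)"
  have dom: "p \<in> dom (move n A B) \<longleftrightarrow> (\<forall>i. ?d p i \<noteq> 0)" for p
    using move_eq[of n A B "fst p" "snd p"] by (auto simp: Let_def dom_def)
  have val: "the (move n A B p) = (\<lambda>i. snd p i * ?d p (i + s) / ?d p i,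
      \<lambda>i. if A = B then fst p i * ?d p i / ?d p (i + s) else fst p i * ?d p (i + s) / ?d p i)"
    if "p \<in> ?D" for p
  proof -
    have "\<forall>i. ?d p i \<noteq> 0" using that dom by blast
    then show ?thesis
      using move_eq[of n A B "fst p" "snd p"] unfolding Let_def s_def by simp
  qed
  have nz: "?d p i \<noteq> 0" if "p \<in> ?D" for p i using that dom by blast
  have per: "?d p (i + int n) = ?d p i" "?d p (i + int n + s) = ?d p (i + s)" if "p \<in> ?D" for p i
  proof -
    have "periodic n (?d p)" using that by (intro periodic_move_den) auto
    from this periodic_shift[OF this, of s] show "?d p (i + int n) = ?d p i"
      "?d p (i + int n + s) = ?d p (i + s)" by (simp_all add: periodic_def)
  qed
  have D_eq: "?D = {p \<in> points (torus2 n). (\<Prod>j<n. ?d p (int j)) \<noteq> 0}"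
  proof (intro set_eqI)
    fix p
    show "p \<in> ?D \<longleftrightarrow> p \<in> {p \<in> points (torus2 n). (\<Prod>j<n. ?d p (int j)) \<noteq> 0}"
      using periodic_all_nonzero_iff[OF n periodic_move_den[of "fst p" n "snd p" A B]] dom[of p] by auto
  qed
  have open_D: "openin (zariski (torus2 n)) ?D"
    unfolding D_eq by (intro openin_nonvanishing openin_zariski_points regular_on_prod regular_on_move_den)
  show ?thesis unfolding rational_map_def Let_def
  proof (intro conjI ballI)
    have "(\<lambda>_. complex_of_real 1, \<lambda>_. complex_of_real 1) \<in> ?D"
      using move_const[OF n, of 1 1 A B] by (auto simp: const_torus)
    then show "?D \<noteq> {}" by blast
    show "the (move n A B p) \<in> points (torus2 n)" if p: "p \<in> ?D" for p
    proof -
      have t: "fst p \<in> torus n" "snd p \<in> torus n" using p by auto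
      show ?thesis
        unfolding val[OF p] using nz[OF p] per[OF p] torusD(1,2)[OF t(1)] torusD(1,2)[OF t(2)]
        by (auto simp: torus_def)
    qed
    show "regular_on (torus2 n) ?D (\<lambda>p. h (the (move n A B p)))" if "h \<in> coords (torus2 n)" for h
    proof -
      from that have "h \<in> prod_coords torus_coords torus_coords" by simp
      then consider i where "h = (\<lambda>p. fst p i)" | i where "h = (\<lambda>p. snd p i)"
        by (cases rule: prod_coordsE) (auto simp: torus_coords_def comp_def)
      then show ?thesis
      proof cases
        case 1
        have "regular_on (torus2 n) ?D (\<lambda>p. snd p i * ?d p (i + s) / ?d p i)"
          by (intro regular_on_mult regular_on_divide regular_on_snd regular_on_move_den open_D nz)
        then show ?thesis
          using 1 by (subst regular_on_cong[where h = "\<lambda>p. snd p i * ?d p (i + s) / ?d p i"]) (simp_all add: val)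
      next
        case 2
        show ?thesis
        proof (cases "A = B")
          case True
          have "regular_on (torus2 n) ?D (\<lambda>p. fst p i * ?d p i / ?d p (i + s))"
            by (intro regular_on_mult regular_on_divide regular_on_fst regular_on_move_den open_D nz)
          moreover have "snd (the (move n A B p)) i = fst p i * ?d p i / ?d p (i + s)" if "p \<in> ?D" for p
            unfolding val[OF that] snd_conv if_P[OF True] ..
          ultimately show ?thesis
            unfolding 2 by (subst regular_on_cong[where h = "\<lambda>p. fst p i * ?d p i / ?d p (i + s)"])
        next
          case False
          have "regular_on (torus2 n) ?D (\<lambda>p. fst p i * ?d p (i + s) / ?d p i)"
            by (intro regular_on_mult regular_on_divide regular_on_fst regular_on_move_den open_D nz)
          then show ?thesis
            using 2 False
            by (subst regular_on_cong[where h = "\<lambda>p. fst p i * ?d p (i + s) / ?d p i"]) (simp_all add: val)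
        qed
      qed
    qed
  qed (rule open_D)
qed

text \<open>
  The open set on which a move is the same as a crossing.
\<close>

definition generic_domain :: "nat \<Rightarrow> cycle \<Rightarrow> cycle \<Rightarrow> (tuple \<times> tuple) set" where
  "generic_domain n A B = {p \<in> dom (move n A B) \<inter> points (torus2 n).
     period_prod n (fst p) - period_prod n (snd p) \<noteq> 0}"

lemma openin_generic_domain:
  assumes "n \<ge> 1"
  shows "openin (zariski (torus2 n)) (generic_domain n A B)"
  unfolding generic_domain_def period_prod_def
  using rational_mapD(1)[OF rational_map_move[OF assms]]
  by (intro openin_nonvanishing regular_on_diff regular_on_prod regular_on_fst regular_on_snd)

lemma generic_domainD:
  assumes "n \<ge> 1" "p \<in> generic_domain n A B"
  obtains x y x' y' where "p = (x, y)" "move n A B (x, y) = Some (x', y')"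
    "x \<in> torus n" "y \<in> torus n" "x' \<in> torus n" "y' \<in> torus n"
    "period_prod n x \<noteq> period_prod n y" "crossing A B x y x' y'"
proof -
  obtain x y where p: "p = (x, y)" by (cases p)
  with assms(2) obtain x' y' where "move n A B (x, y) = Some (x', y')" "x \<in> torus n" "y \<in> torus n"
    "period_prod n x \<noteq> period_prod n y"
    unfolding generic_domain_def by (cases "move n A B (x, y)") auto
  with p move_crossing[OF assms(1)] that show thesis by blast
qed

lemma const_generic_domain:
  assumes "n \<ge> 1" "a > 0" "b > 0" "a \<noteq> b"
  shows "(\<lambda>_. complex_of_real a, \<lambda>_. complex_of_real b) \<in> generic_domain n A B"
proof -
  have "a ^ n \<noteq> b ^ n" using assms by (simp add: power_eq_iff_eq_base)
  then have "complex_of_real a ^ n \<noteq> complex_of_real b ^ n" by (simp flip: of_real_power)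
  then show ?thesis
    using assms move_const[of n a b A B] unfolding generic_domain_def
    by (auto simp: const_torus period_prod_def)
qed

lemma move_inverse:
  assumes "n \<ge> 1"
  shows "rat_eq (torus2 n) (move n B A \<circ>\<^sub>m move n A B) Some"
proof (rule rat_eqI[OF openin_generic_domain[OF assms]])
  show "(\<lambda>_. complex_of_real 1, \<lambda>_. complex_of_real 2) \<in> generic_domain n A B"
    using assms by (intro const_generic_domain) auto
  fix p assume "p \<in> generic_domain n A B"
  then show "\<exists>r. (move n B A \<circ>\<^sub>m move n A B) p = Some r \<and> Some p = Some r"
  proof (rule generic_domainD[OF assms])
    fix x y x' y' assume p: "p = (x, y)" and 1: "move n A B (x, y) = Some (x', y')"
      and t: "x \<in> torus n" "y \<in> torus n" "x' \<in> torus n" "y' \<in> torus n"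
      and ne: "period_prod n x \<noteq> period_prod n y" and c: "crossing A B x y x' y'"
    have "period_prod n x' \<noteq> period_prod n y'" using crossing_period_prod[OF c t] ne by simp
    from crossing_move[OF assms t(3,4) this t(1,2) crossing_inverse[OF c]]
    show ?thesis by (simp add: p 1)
  qed
qed

lemma birational_map_move:
  assumes "n \<ge> 1"
  shows "birational_map (torus2 n) (torus2 n) (move n A B)"
  unfolding birational_map_def
  using rational_map_move[OF assms] move_inverse[OF assms] by blast

section \<open>Compatibility of the moves with the crystal structures\<close>

definition eps_domain :: "cycle \<Rightarrow> cycle \<Rightarrow> int \<Rightarrow> nat \<Rightarrow> (tuple \<times> tuple) set" where
  "eps_domain A B k n = {p \<in> points (torus2 n). phi_at B k (snd p) + eps_at A k (fst p) \<noteq> 0}"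

lemma regular_on_eps_at:
  assumes "openin (zariski (torus2 n)) D"
  shows "regular_on (torus2 n) D (\<lambda>p. eps_at A k (fst p))"
    "regular_on (torus2 n) D (\<lambda>p. eps_at A k (snd p))"
  using assms by (cases A; simp add: regular_on_fst regular_on_snd)+

lemma openin_eps_domain: "openin (zariski (torus2 n)) (eps_domain A B k n)"
  unfolding eps_domain_def
  by (intro openin_nonvanishing openin_zariski_points regular_on_add regular_on_eps_at)

lemma eps_at_torus: "x \<in> torus n \<Longrightarrow> eps_at A k x \<noteq> 0"
  by (cases A) (auto simp: torus_def)

lemma eps_at_const [simp]: "eps_at A k (\<lambda>_. c) = c"
  by (cases A) auto

text \<open>
  One open set serves \<open>\<epsilon>\<close>, \<open>\<phi>\<close> and the weight; the value \<open>b \<noteq> 0\<close> of \<open>\<epsilon>\<close> makes the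
  quotient \<open>\<phi> / \<epsilon>\<close> defined.
\<close>

lemma eps_phi_move:
  assumes "n \<ge> 1"
  shows "\<exists>U. openin (zariski (torus2 n)) U \<and> U \<noteq> {} \<and>
    (\<forall>p\<in>U. \<exists>q a b. move n A B p = Some q \<and> b \<noteq> 0 \<and>
      phi (crystal_of n B \<otimes>\<^sub>c crystal_of n A) i q = Some a \<and>
      phi (crystal_of n A \<otimes>\<^sub>c crystal_of n B) i p = Some a \<and>
      eps (crystal_of n B \<otimes>\<^sub>c crystal_of n A) i q = Some b \<and>
      eps (crystal_of n A \<otimes>\<^sub>c crystal_of n B) i p = Some b)"
proof (intro exI[of _ "generic_domain n A B \<inter> eps_domain A B i n"] conjI ballI)
  show "openin (zariski (torus2 n)) (generic_domain n A B \<inter> eps_domain A B i n)"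
    by (intro openin_Int openin_generic_domain openin_eps_domain assms)
  have "complex_of_real 2 + complex_of_real 1 \<noteq> 0" by simp
  then have "(\<lambda>_. complex_of_real 1, \<lambda>_. complex_of_real 2) \<in> generic_domain n A B \<inter> eps_domain A B i n"
    using const_generic_domain[of n 1 2 A B] assms by (auto simp: eps_domain_def const_torus)
  then show "generic_domain n A B \<inter> eps_domain A B i n \<noteq> {}" by blast
next
  fix p assume "p \<in> generic_domain n A B \<inter> eps_domain A B i n"
  then have p: "p \<in> generic_domain n A B" "p \<in> eps_domain A B i n" by auto
  from p(1) show "\<exists>q a b. move n A B p = Some q \<and> b \<noteq> 0 \<and>
      phi (crystal_of n B \<otimes>\<^sub>c crystal_of n A) i q = Some a \<and>
      phi (crystal_of n A \<otimes>\<^sub>c crystal_of n B) i p = Some a \<and>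
      eps (crystal_of n B \<otimes>\<^sub>c crystal_of n A) i q = Some b \<and>
      eps (crystal_of n A \<otimes>\<^sub>c crystal_of n B) i p = Some b"
  proof (rule generic_domainD[OF assms])
    fix x y x' y' assume xy: "p = (x, y)" and 1: "move n A B (x, y) = Some (x', y')"
      and t: "x \<in> torus n" "y \<in> torus n" and c: "crossing A B x y x' y'"
    have ne: "phi_at B i y + eps_at A i x \<noteq> 0" "eps_at A i x + phi_at B i y \<noteq> 0"
      using p(2) by (auto simp: xy eps_domain_def add.commute)
    have nz: "x j \<noteq> 0" "y j \<noteq> 0" for j using t by (auto simp: torus_def)
    show ?thesis
      unfolding xy
    proof (intro exI conjI)
      show "move n A B (x, y) = Some (x', y')" by (rule 1)
      show "eps_at A i x * eps_at B i y / (phi_at B i y + eps_at A i x) \<noteq> 0"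
        using ne eps_at_torus[OF t(1)] eps_at_torus[OF t(2)] by simp
      show e: "eps (crystal_of n A \<otimes>\<^sub>c crystal_of n B) i (x, y) =
          Some (eps_at A i x * eps_at B i y / (phi_at B i y + eps_at A i x))"
        using ne by (simp add: eps_prod_crystal quot_def)
      show f: "phi (crystal_of n A \<otimes>\<^sub>c crystal_of n B) i (x, y) =
          Some (phi_at A i x * phi_at B i y / (eps_at A i x + phi_at B i y))"
        using ne by (simp add: phi_prod_crystal quot_def)
      show "eps (crystal_of n B \<otimes>\<^sub>c crystal_of n A) i (x', y') =
          Some (eps_at A i x * eps_at B i y / (phi_at B i y + eps_at A i x))"
        unfolding eps_phi_crossing(1)[OF c nz] by (rule e)
      show "phi (crystal_of n B \<otimes>\<^sub>c crystal_of n A) i (x', y') =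
          Some (phi_at A i x * phi_at B i y / (eps_at A i x + phi_at B i y))"
        unfolding eps_phi_crossing(2)[OF c nz] by (rule f)
    qed
  qed
qed

definition act_domain :: "cycle \<Rightarrow> cycle \<Rightarrow> int \<Rightarrow> complex \<Rightarrow> nat \<Rightarrow> (tuple \<times> tuple) set" where
  "act_domain A B k c n =
     {p \<in> eps_domain A B k n. c * phi_at B k (snd p) + eps_at A k (fst p) \<noteq> 0}"

lemma openin_act_domain: "openin (zariski (torus2 n)) (act_domain A B k c n)"
  unfolding act_domain_def
  by (intro openin_nonvanishing openin_eps_domain regular_on_add regular_on_mult regular_on_const
      regular_on_eps_at)

lemma act_domain_act:
  assumes "(x, y) \<in> act_domain A B k c n"
  obtains u v where "act (crystal_of n A \<otimes>\<^sub>c crystal_of n B) k c (x, y) = Some (u, v)"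
  using assms unfolding act_domain_def eps_domain_def by (auto simp: act_prod_crystal)

text \<open>
  On the generic domain the acted weights \<open>u\<close>, \<open>v\<close> form a crossing with \<open>u'\<close>, \<open>v'\<close>; since their
  periods still differ, the move of \<open>(u, v)\<close> is defined and equals \<open>(u', v')\<close>.
\<close>

lemma act_move:
  assumes n: "n \<ge> 2" and c: "c \<noteq> 0"
  shows "rat_eq (torus2 n) (act (crystal_of n B \<otimes>\<^sub>c crystal_of n A) k c \<circ>\<^sub>m move n A B)
    (move n A B \<circ>\<^sub>m act (crystal_of n A \<otimes>\<^sub>c crystal_of n B) k c)"
proof -
  have n1: "n \<ge> 1" using n by simp
  define W where "W = {p \<in> dom (move n A B) \<inter> points (torus2 n).
    the (move n A B p) \<in> act_domain B A k c n}"
  let ?U = "generic_domain n A B \<inter> act_domain A B k c n \<inter> W"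
  show ?thesis
  proof (rule rat_eqI[of _ ?U])
    show "openin (zariski (torus2 n)) ?U"
      unfolding W_def
      by (intro openin_Int openin_generic_domain[OF n1] openin_act_domain
          openin_rational_preimage[OF rational_map_move[OF n1]])
    \<comment> \<open>The constants \<open>1\<close> and \<open>s\<close> must avoid \<open>c * s = -1\<close> and \<open>c = -s\<close>, where \<open>c\<^sup>+\<close> vanishes before or after the move.\<close>
    define s :: real where "s = 2 + norm c + 1 / norm c"
    have s: "s > 1" "s > norm c" "s * norm c > 1"
    proof -
      have "norm c > 0" using c by simp
      then show "s > 1" "s > norm c" "s * norm c > 1"
        by (auto simp: s_def add_pos_pos algebra_simps)
    qed
    have c1: "c * complex_of_real s + complex_of_real 1 \<noteq> 0"
    proof
      assume "c * complex_of_real s + complex_of_real 1 = 0"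
      then have "c * complex_of_real s = -1" by (simp add: eq_neg_iff_add_eq_0)
      then have "norm c * s = 1" using s(1) by (metis norm_minus_cancel norm_mult norm_of_real norm_one abs_of_pos less_trans zero_less_one)
      then show False using s(3) by (simp add: mult.commute)
    qed
    have c2: "c * complex_of_real 1 + complex_of_real s \<noteq> 0"
    proof
      assume "c * complex_of_real 1 + complex_of_real s = 0"
      then have "c = - complex_of_real s" by (simp add: eq_neg_iff_add_eq_0)
      then have "norm c = s" using s(1) by simp
      then show False using s(2) by simp
    qed
    have "complex_of_real s + complex_of_real 1 \<noteq> 0"
      using s(1) by (metis add_pos_pos less_irrefl less_trans of_real_add of_real_eq_0_iff zero_less_one)
    moreover from this have "complex_of_real 1 + complex_of_real s \<noteq> 0" by (metis add.commute)
    ultimately have c3: "complex_of_real s + complex_of_real 1 \<noteq> 0" "complex_of_real 1 + complex_of_real s \<noteq> 0" .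
    have t: "(\<lambda>_. complex_of_real 1) \<in> torus n" "(\<lambda>_. complex_of_real s) \<in> torus n"
      using s(1) by (auto simp: const_torus)
    have m: "move n A B (\<lambda>_. complex_of_real 1, \<lambda>_. complex_of_real s) =
        Some (\<lambda>_. complex_of_real s, \<lambda>_. complex_of_real 1)"
      using s(1) by (intro move_const n1) auto
    have "(\<lambda>_. complex_of_real 1, \<lambda>_. complex_of_real s) \<in> generic_domain n A B"
      using s(1) by (intro const_generic_domain n1) auto
    moreover have "(\<lambda>_. complex_of_real 1, \<lambda>_. complex_of_real s) \<in> act_domain A B k c n"
      unfolding act_domain_def eps_domain_def using c1 c3 t by simp
    moreover have "(\<lambda>_. complex_of_real 1, \<lambda>_. complex_of_real s) \<in> W"
      unfolding W_def act_domain_def eps_domain_def using c2 c3 t m by (simp add: domIff)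
    ultimately show "(\<lambda>_. complex_of_real 1, \<lambda>_. complex_of_real s) \<in> ?U" by blast
  next
    fix p assume p: "p \<in> ?U"
    then have "p \<in> generic_domain n A B" by blast
    then show "\<exists>r. (act (crystal_of n B \<otimes>\<^sub>c crystal_of n A) k c \<circ>\<^sub>m move n A B) p = Some r \<and>
        (move n A B \<circ>\<^sub>m act (crystal_of n A \<otimes>\<^sub>c crystal_of n B) k c) p = Some r"
    proof (rule generic_domainD[OF n1])
      fix x y x' y' assume xy: "p = (x, y)" and 1: "move n A B (x, y) = Some (x', y')"
        and t: "x \<in> torus n" "y \<in> torus n" "x' \<in> torus n" "y' \<in> torus n"
        and ne: "period_prod n x \<noteq> period_prod n y" and cr: "crossing A B x y x' y'"
      obtain u v where a: "act (crystal_of n A \<otimes>\<^sub>c crystal_of n B) k c (x, y) = Some (u, v)"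
        using p xy by (auto elim: act_domain_act)
      have "(x', y') \<in> act_domain B A k c n" using p xy 1 by (auto simp: W_def)
      then obtain u' v' where a': "act (crystal_of n B \<otimes>\<^sub>c crystal_of n A) k c (x', y') = Some (u', v')"
        by (rule act_domain_act)
      have "period_prod n u \<noteq> period_prod n v" using act_period_prod[OF a n c] ne by simp
      from crossing_move[OF n1 act_torus[OF a c t(1,2)] this act_torus[OF a' c t(3,4)]
          act_crossing[OF n c t cr a a']]
      show ?thesis using 1 a a' xy by simp
    qed
  qed
qed

section \<open>The braid relation as an identity of rational maps\<close>

lemma flip_flip [simp]: "flip (flip A) = A"
  by (cases A) auto

definition braid_left :: "nat \<Rightarrow> cycle \<Rightarrow> cycle \<Rightarrow> cycle \<Rightarrow> tuple \<times> tuple \<times> tuple \<rightharpoonup> tuple \<times> tuple \<times> tuple" where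
  "braid_left n A B C = on_12 (move n B C) \<circ>\<^sub>m on_23 (move n A C) \<circ>\<^sub>m on_12 (move n A B)"

definition braid_right :: "nat \<Rightarrow> cycle \<Rightarrow> cycle \<Rightarrow> cycle \<Rightarrow> tuple \<times> tuple \<times> tuple \<rightharpoonup> tuple \<times> tuple \<times> tuple" where
  "braid_right n A B C = on_23 (move n A B) \<circ>\<^sub>m on_12 (move n A C) \<circ>\<^sub>m on_23 (move n B C)"

lemma on_12_eq_Some:
  "on_12 f (x, y, z) = Some (x', y', z') \<longleftrightarrow> f (x, y) = Some (x', y') \<and> z' = z"
  by (auto simp: on_12_def split: Option.bind_splits)

lemma on_23_eq_Some:
  "on_23 f (x, y, z) = Some (x', y', z') \<longleftrightarrow> f (y, z) = Some (y', z') \<and> x' = x"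
  by (auto simp: on_23_def split: Option.bind_splits)

lemma braid_left_eq_Some:
  "braid_left n A B C (x, y, z) = Some (z\<^sub>2, y\<^sub>2, x\<^sub>2) \<longleftrightarrow>
    (\<exists>y\<^sub>1 x\<^sub>1 z\<^sub>1. move n A B (x, y) = Some (y\<^sub>1, x\<^sub>1) \<and> move n A C (x\<^sub>1, z) = Some (z\<^sub>1, x\<^sub>2) \<and>
      move n B C (y\<^sub>1, z\<^sub>1) = Some (z\<^sub>2, y\<^sub>2))"
  unfolding braid_left_def map_comp_Some_iff by (auto simp: on_12_eq_Some on_23_eq_Some)

lemma braid_right_eq_Some:
  "braid_right n A B C (x, y, z) = Some (z\<^sub>2, y\<^sub>2, x\<^sub>2) \<longleftrightarrow>
    (\<exists>z\<^sub>1 y\<^sub>1 x\<^sub>1. move n B C (y, z) = Some (z\<^sub>1, y\<^sub>1) \<and> move n A C (x, z\<^sub>1) = Some (z\<^sub>2, x\<^sub>1) \<and>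
      move n A B (x\<^sub>1, y\<^sub>1) = Some (y\<^sub>2, x\<^sub>2))"
  unfolding braid_right_def map_comp_Some_iff by (auto simp: on_12_eq_Some on_23_eq_Some)

definition generic_triple :: "nat \<Rightarrow> tuple \<times> tuple \<times> tuple \<Rightarrow> bool" where
  "generic_triple n = (\<lambda>(x, y, z). x \<in> torus n \<and> y \<in> torus n \<and> z \<in> torus n \<and>
     period_prod n x \<noteq> period_prod n y \<and> period_prod n x \<noteq> period_prod n z \<and>
     period_prod n y \<noteq> period_prod n z)"

text \<open>
  The chain of crossings described by the left side of the braid relation, freed from the
  domains of the moves; likewise \<open>right_crossings\<close> for the right side.
\<close>

definition left_crossings where
  "left_crossings n A B C x y z z\<^sub>2 y\<^sub>2 x\<^sub>2 \<longleftrightarrow> (\<exists>y\<^sub>1\<in>torus n. \<exists>x\<^sub>1\<in>torus n. \<exists>z\<^sub>1\<in>torus n.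
     x\<^sub>2 \<in> torus n \<and> z\<^sub>2 \<in> torus n \<and> y\<^sub>2 \<in> torus n \<and>
     crossing A B x y y\<^sub>1 x\<^sub>1 \<and> crossing A C x\<^sub>1 z z\<^sub>1 x\<^sub>2 \<and> crossing B C y\<^sub>1 z\<^sub>1 z\<^sub>2 y\<^sub>2)"

definition right_crossings where
  "right_crossings n A B C x y z z\<^sub>2 y\<^sub>2 x\<^sub>2 \<longleftrightarrow> (\<exists>z\<^sub>1\<in>torus n. \<exists>y\<^sub>1\<in>torus n. \<exists>x\<^sub>1\<in>torus n.
     x\<^sub>2 \<in> torus n \<and> z\<^sub>2 \<in> torus n \<and> y\<^sub>2 \<in> torus n \<and>
     crossing B C y z z\<^sub>1 y\<^sub>1 \<and> crossing A C x z\<^sub>1 z\<^sub>2 x\<^sub>1 \<and> crossing A B x\<^sub>1 y\<^sub>1 y\<^sub>2 x\<^sub>2)"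

lemma braid_left_iff:
  assumes n: "n \<ge> 1" and g: "generic_triple n (x, y, z)"
  shows "braid_left n A B C (x, y, z) = Some (z\<^sub>2, y\<^sub>2, x\<^sub>2) \<longleftrightarrow> left_crossings n A B C x y z z\<^sub>2 y\<^sub>2 x\<^sub>2"
proof
  have t: "x \<in> torus n" "y \<in> torus n" "z \<in> torus n"
    and ne: "period_prod n x \<noteq> period_prod n y" "period_prod n x \<noteq> period_prod n z"
      "period_prod n y \<noteq> period_prod n z"
    using g by (auto simp: generic_triple_def)
  assume "braid_left n A B C (x, y, z) = Some (z\<^sub>2, y\<^sub>2, x\<^sub>2)"
  then obtain y\<^sub>1 x\<^sub>1 z\<^sub>1 where m: "move n A B (x, y) = Some (y\<^sub>1, x\<^sub>1)"
    "move n A C (x\<^sub>1, z) = Some (z\<^sub>1, x\<^sub>2)" "move n B C (y\<^sub>1, z\<^sub>1) = Some (z\<^sub>2, y\<^sub>2)"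
    unfolding braid_left_eq_Some by blast
  note 1 = move_crossing[OF n t(1,2) ne(1) m(1)]
  then have p1: "period_prod n y\<^sub>1 = period_prod n y" "period_prod n x\<^sub>1 = period_prod n x"
    using crossing_period_prod t by blast+
  have 2: "z\<^sub>1 \<in> torus n \<and> x\<^sub>2 \<in> torus n \<and> crossing A C x\<^sub>1 z z\<^sub>1 x\<^sub>2"
    using move_crossing[OF n _ t(3) _ m(2)] 1 p1 ne by simp
  then have p2: "period_prod n z\<^sub>1 = period_prod n z"
    using crossing_period_prod[of A C x\<^sub>1 z z\<^sub>1 x\<^sub>2 n] 1 t by simp
  have "z\<^sub>2 \<in> torus n \<and> y\<^sub>2 \<in> torus n \<and> crossing B C y\<^sub>1 z\<^sub>1 z\<^sub>2 y\<^sub>2"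
    using move_crossing[OF n _ _ _ m(3)] 1 2 p1 p2 ne by simp
  with 1 2 show "left_crossings n A B C x y z z\<^sub>2 y\<^sub>2 x\<^sub>2" unfolding left_crossings_def by blast
next
  have t: "x \<in> torus n" "y \<in> torus n" "z \<in> torus n"
    and ne: "period_prod n x \<noteq> period_prod n y" "period_prod n x \<noteq> period_prod n z"
      "period_prod n y \<noteq> period_prod n z"
    using g by (auto simp: generic_triple_def)
  assume "left_crossings n A B C x y z z\<^sub>2 y\<^sub>2 x\<^sub>2"
  then obtain y\<^sub>1 x\<^sub>1 z\<^sub>1 where s: "y\<^sub>1 \<in> torus n" "x\<^sub>1 \<in> torus n" "z\<^sub>1 \<in> torus n"
      "x\<^sub>2 \<in> torus n" "z\<^sub>2 \<in> torus n" "y\<^sub>2 \<in> torus n"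
    and c: "crossing A B x y y\<^sub>1 x\<^sub>1" "crossing A C x\<^sub>1 z z\<^sub>1 x\<^sub>2" "crossing B C y\<^sub>1 z\<^sub>1 z\<^sub>2 y\<^sub>2"
    unfolding left_crossings_def by blast
  have p: "period_prod n y\<^sub>1 = period_prod n y" "period_prod n x\<^sub>1 = period_prod n x"
    "period_prod n z\<^sub>1 = period_prod n z"
    using crossing_period_prod[OF c(1) t(1,2) s(1,2)] crossing_period_prod[OF c(2) s(2) t(3) s(3,4)]
    by auto
  have "period_prod n x\<^sub>1 \<noteq> period_prod n z" "period_prod n y\<^sub>1 \<noteq> period_prod n z\<^sub>1" using p ne by auto
  then show "braid_left n A B C (x, y, z) = Some (z\<^sub>2, y\<^sub>2, x\<^sub>2)"
    unfolding braid_left_eq_Some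
    using crossing_move[OF n t(1,2) ne(1) s(1,2) c(1)] crossing_move[OF n s(2) t(3) _ s(3,4) c(2)]
      crossing_move[OF n s(1,3) _ s(5,6) c(3)] by blast
qed

lemma braid_right_iff:
  assumes n: "n \<ge> 1" and g: "generic_triple n (x, y, z)"
  shows "braid_right n A B C (x, y, z) = Some (z\<^sub>2, y\<^sub>2, x\<^sub>2) \<longleftrightarrow> right_crossings n A B C x y z z\<^sub>2 y\<^sub>2 x\<^sub>2"
proof
  have t: "x \<in> torus n" "y \<in> torus n" "z \<in> torus n"
    and ne: "period_prod n x \<noteq> period_prod n y" "period_prod n x \<noteq> period_prod n z"
      "period_prod n y \<noteq> period_prod n z"
    using g by (auto simp: generic_triple_def)
  assume "braid_right n A B C (x, y, z) = Some (z\<^sub>2, y\<^sub>2, x\<^sub>2)"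
  then obtain z\<^sub>1 y\<^sub>1 x\<^sub>1 where m: "move n B C (y, z) = Some (z\<^sub>1, y\<^sub>1)"
    "move n A C (x, z\<^sub>1) = Some (z\<^sub>2, x\<^sub>1)" "move n A B (x\<^sub>1, y\<^sub>1) = Some (y\<^sub>2, x\<^sub>2)"
    unfolding braid_right_eq_Some by blast
  note 1 = move_crossing[OF n t(2,3) ne(3) m(1)]
  then have p1: "period_prod n z\<^sub>1 = period_prod n z" "period_prod n y\<^sub>1 = period_prod n y"
    using crossing_period_prod t by blast+
  have 2: "z\<^sub>2 \<in> torus n \<and> x\<^sub>1 \<in> torus n \<and> crossing A C x z\<^sub>1 z\<^sub>2 x\<^sub>1"
    using move_crossing[OF n t(1) _ _ m(2)] 1 p1 ne by simp
  then have p2: "period_prod n x\<^sub>1 = period_prod n x"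
    using crossing_period_prod[of A C x z\<^sub>1 z\<^sub>2 x\<^sub>1 n] 1 t by simp
  have "y\<^sub>2 \<in> torus n \<and> x\<^sub>2 \<in> torus n \<and> crossing A B x\<^sub>1 y\<^sub>1 y\<^sub>2 x\<^sub>2"
    using move_crossing[OF n _ _ _ m(3)] 1 2 p1 p2 ne by simp
  with 1 2 show "right_crossings n A B C x y z z\<^sub>2 y\<^sub>2 x\<^sub>2" unfolding right_crossings_def by blast
next
  have t: "x \<in> torus n" "y \<in> torus n" "z \<in> torus n"
    and ne: "period_prod n x \<noteq> period_prod n y" "period_prod n x \<noteq> period_prod n z"
      "period_prod n y \<noteq> period_prod n z"
    using g by (auto simp: generic_triple_def)
  assume "right_crossings n A B C x y z z\<^sub>2 y\<^sub>2 x\<^sub>2"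
  then obtain z\<^sub>1 y\<^sub>1 x\<^sub>1 where s: "z\<^sub>1 \<in> torus n" "y\<^sub>1 \<in> torus n" "x\<^sub>1 \<in> torus n"
      "x\<^sub>2 \<in> torus n" "z\<^sub>2 \<in> torus n" "y\<^sub>2 \<in> torus n"
    and c: "crossing B C y z z\<^sub>1 y\<^sub>1" "crossing A C x z\<^sub>1 z\<^sub>2 x\<^sub>1" "crossing A B x\<^sub>1 y\<^sub>1 y\<^sub>2 x\<^sub>2"
    unfolding right_crossings_def by blast
  have p: "period_prod n z\<^sub>1 = period_prod n z" "period_prod n y\<^sub>1 = period_prod n y"
    "period_prod n x\<^sub>1 = period_prod n x"
    using crossing_period_prod[OF c(1) t(2,3) s(1,2)] crossing_period_prod[OF c(2) t(1) s(1) s(5,3)]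
    by auto
  have "period_prod n x \<noteq> period_prod n z\<^sub>1" "period_prod n x\<^sub>1 \<noteq> period_prod n y\<^sub>1" using p ne by auto
  then show "braid_right n A B C (x, y, z) = Some (z\<^sub>2, y\<^sub>2, x\<^sub>2)"
    unfolding braid_right_eq_Some
    using crossing_move[OF n t(2,3) ne(3) s(1,2) c(1)] crossing_move[OF n t(1) s(1) _ s(5,3) c(2)]
      crossing_move[OF n s(3,2) _ s(6,4) c(3)] by blast
qed

text \<open>
  Reading from right to left exchanges the two sides of the braid relation, which reduces the
  remaining four type patterns to those treated for the left side.
\<close>

lemma crossings_mirror:
  "left_crossings n A B C x y z z\<^sub>2 y\<^sub>2 x\<^sub>2 \<longleftrightarrow>
   right_crossings n (flip C) (flip B) (flip A) z y x x\<^sub>2 y\<^sub>2 z\<^sub>2"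
proof -
  have c: "crossing (flip B) (flip A) y x y' x' \<longleftrightarrow> crossing A B x y x' y'" for A B x y x' y'
    using crossing_mirror[of A B x y x' y'] crossing_mirror[of "flip B" "flip A" y x y' x'] by auto
  show ?thesis unfolding left_crossings_def right_crossings_def c by blast
qed

text \<open>
  The genericity needed for all type patterns at once, invariant under mirroring; the second
  triple is the outcome of the three moves.
\<close>

definition braid_generic :: "tuple \<times> tuple \<times> tuple \<Rightarrow> tuple \<times> tuple \<times> tuple \<Rightarrow> bool" where
  "braid_generic = (\<lambda>(x, y, z) (z', y', x').
     generic_pair x y \<and> generic_pair y z \<and> generic_pair x z' \<and> generic_pair z x' \<and>
     generic_pair x' y' \<and> generic_pair z' y')"

lemma generic_pair_sym: "generic_pair x y \<longleftrightarrow> generic_pair y x"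
  unfolding generic_pair_def by metis

lemma left_imp_right_crossings:
  assumes "x \<in> torus n" "y \<in> torus n" "z \<in> torus n"
    and "left_crossings n A B C x y z z\<^sub>2 y\<^sub>2 x\<^sub>2" "braid_generic (x, y, z) (z\<^sub>2, y\<^sub>2, x\<^sub>2)"
    and "A = Whirl \<and> \<not> (B = Whirl \<and> C = Curl) \<or> A = Curl \<and> B = Curl \<and> C = Whirl"
  shows "right_crossings n A B C x y z z\<^sub>2 y\<^sub>2 x\<^sub>2"
proof -
  obtain y\<^sub>1 x\<^sub>1 z\<^sub>1 where s: "y\<^sub>1 \<in> torus n" "x\<^sub>1 \<in> torus n" "z\<^sub>1 \<in> torus n"
      "x\<^sub>2 \<in> torus n" "z\<^sub>2 \<in> torus n" "y\<^sub>2 \<in> torus n"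
    and c: "crossing A B x y y\<^sub>1 x\<^sub>1" "crossing A C x\<^sub>1 z z\<^sub>1 x\<^sub>2" "crossing B C y\<^sub>1 z\<^sub>1 z\<^sub>2 y\<^sub>2"
    using assms(4) unfolding left_crossings_def by blast
  have "generic_pair y z" "generic_pair x z\<^sub>2" "generic_pair x\<^sub>2 y\<^sub>2"
    using assms(5) by (auto simp: braid_generic_def)
  from braid_crossings_left[OF assms(1-3) s(1-5,6) c this assms(6)] s(4-6)
  show ?thesis unfolding right_crossings_def by blast
qed

text \<open>
  In four type patterns the left side is completed to the cube and gives the right side; in the other four
  the mirror image of the right side is completed and gives the left side.
\<close>

lemma braid_agree:
  assumes n: "n \<ge> 1" and g: "generic_triple n p"
    and l: "braid_left n A B C p = Some q" and r: "braid_right n A B C p = Some q'"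
    and "braid_generic p q" "braid_generic p q'"
  shows "q' = q"
proof -
  obtain x y z where p: "p = (x, y, z)" by (cases p)
  obtain z\<^sub>2 y\<^sub>2 x\<^sub>2 where q: "q = (z\<^sub>2, y\<^sub>2, x\<^sub>2)" by (cases q)
  obtain z\<^sub>3 y\<^sub>3 x\<^sub>3 where q': "q' = (z\<^sub>3, y\<^sub>3, x\<^sub>3)" by (cases q')
  have t: "x \<in> torus n" "y \<in> torus n" "z \<in> torus n"
    using g by (auto simp: p generic_triple_def)
  have L: "left_crossings n A B C x y z z\<^sub>2 y\<^sub>2 x\<^sub>2"
    using l braid_left_iff[OF n g[unfolded p]] by (simp add: p q)
  have R: "right_crossings n A B C x y z z\<^sub>3 y\<^sub>3 x\<^sub>3"
    using r braid_right_iff[OF n g[unfolded p]] by (simp add: p q')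
  show ?thesis
  proof (cases "A = Whirl \<and> \<not> (B = Whirl \<and> C = Curl) \<or> A = Curl \<and> B = Curl \<and> C = Whirl")
    case True
    from left_imp_right_crossings[OF t L assms(5)[unfolded p q] True]
    have "braid_right n A B C (x, y, z) = Some q" unfolding braid_right_iff[OF n g[unfolded p]] q .
    with r show ?thesis by (simp add: p)
  next
    case False
    then have F: "flip C = Whirl \<and> \<not> (flip B = Whirl \<and> flip A = Curl) \<or>
        flip C = Curl \<and> flip B = Curl \<and> flip A = Whirl"
      by (cases A; cases B; cases C) auto
    have R': "left_crossings n (flip C) (flip B) (flip A) z y x x\<^sub>3 y\<^sub>3 z\<^sub>3"
      using R unfolding crossings_mirror by simp
    have "braid_generic (z, y, x) (x\<^sub>3, y\<^sub>3, z\<^sub>3)"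
      using assms(6) by (auto simp: p q' braid_generic_def generic_pair_sym)
    from left_imp_right_crossings[OF t(3,2,1) R' this F]
    have "left_crossings n A B C x y z z\<^sub>3 y\<^sub>3 x\<^sub>3" unfolding crossings_mirror .
    then have "braid_left n A B C (x, y, z) = Some q'" unfolding braid_left_iff[OF n g[unfolded p]] q' .
    with l show ?thesis by (simp add: p)
  qed
qed

lemma generic_pair_iff:
  assumes "n \<ge> 1" "x \<in> torus n" "y \<in> torus n"
  shows "generic_pair x y \<longleftrightarrow> (\<Prod>j<n. x (int j) * x (int j) - y (int j) * y (int j)) \<noteq> 0"
proof -
  have "periodic n (\<lambda>i. x i * x i - y i * y i)" using assms by (simp add: torus_def periodic_def)
  from periodic_all_nonzero_iff[OF assms(1) this] show ?thesis
    by (simp add: generic_pair_def power2_eq_square)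
qed

lemma rational_map_on_12_move:
  "n \<ge> 1 \<Longrightarrow> rational_map (torus3 n) (torus3 n) (on_12 (move n A B))"
  by (rule rational_map_on_12[OF rational_map_move]) (auto intro: exI[of _ "\<lambda>_. 1"] simp: torus_def)

lemma rational_map_on_23_move:
  "n \<ge> 1 \<Longrightarrow> rational_map (torus3 n) (torus3 n) (on_23 (move n A B))"
  by (rule rational_map_on_23[OF rational_map_move]) (auto intro: exI[of _ "\<lambda>_. 1"] simp: torus_def)

lemma braid_const:
  fixes a b c :: real
  assumes n: "n \<ge> 1" and "a > 0" "b > 0" "c > 0"
  defines "p \<equiv> (\<lambda>_. complex_of_real a, \<lambda>_. complex_of_real b, \<lambda>_. complex_of_real c)"
    and "q \<equiv> (\<lambda>_. complex_of_real c, \<lambda>_. complex_of_real b, \<lambda>_. complex_of_real a)"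
  shows "braid_left n A B C p = Some q" "braid_right n A B C p = Some q"
  unfolding p_def q_def braid_left_eq_Some braid_right_eq_Some
  using move_const[OF n] assms(2-4) by blast+

lemma rational_map_braid:
  assumes n: "n \<ge> 1"
  shows "rational_map (torus3 n) (torus3 n) (braid_left n A B C)"
    "rational_map (torus3 n) (torus3 n) (braid_right n A B C)"
proof -
  let ?p = "(\<lambda>_. complex_of_real 1, \<lambda>_. complex_of_real 1, \<lambda>_. complex_of_real 1)"
  have p: "?p \<in> points (torus3 n)" by (simp add: const_torus)
  have m: "on_12 (move n A B) ?p = Some ?p" "on_23 (move n A B) ?p = Some ?p" for A B
    using move_const[OF n, of 1 1 A B] by (auto simp: on_12_eq_Some on_23_eq_Some)
  note r = rational_map_on_12_move[OF n] rational_map_on_23_move[OF n]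
  have "(on_12 (move n B C) \<circ>\<^sub>m on_23 (move n A C)) ?p = Some ?p"
    "(on_23 (move n A B) \<circ>\<^sub>m on_12 (move n A C)) ?p = Some ?p"
    by (simp_all only: map_comp_simps m)
  then show "rational_map (torus3 n) (torus3 n) (braid_left n A B C)"
    "rational_map (torus3 n) (torus3 n) (braid_right n A B C)"
    unfolding braid_left_def braid_right_def
    using rational_map_compose[OF r(1) rational_map_compose[OF r(2,1) p m(2,1)] p m(1)]
      rational_map_compose[OF r(2) rational_map_compose[OF r(1,2) p m(1,2)] p m(2)] by blast+
qed

lemma regular_on_torus3:
  assumes "openin (zariski (torus3 n)) D"
  shows "regular_on (torus3 n) D (\<lambda>p. fst p i)" "regular_on (torus3 n) D (\<lambda>p. fst (snd p) i)"
    "regular_on (torus3 n) D (\<lambda>p. snd (snd p) i)"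
proof -
  have h: "(\<lambda>x. x i) \<in> torus_coords" by (simp add: torus_coords_def)
  have "(\<lambda>x. x i) \<circ> fst \<in> coords (torus3 n)" "((\<lambda>x. x i) \<circ> fst) \<circ> snd \<in> coords (torus3 n)"
    "((\<lambda>x. x i) \<circ> snd) \<circ> snd \<in> coords (torus3 n)"
    by (simp_all only: coords_prod_variety torus_variety_simps prod_coords_fst prod_coords_snd h)
  from this[THEN regular_on_coord[OF assms]] show "regular_on (torus3 n) D (\<lambda>p. fst p i)"
    "regular_on (torus3 n) D (\<lambda>p. fst (snd p) i)" "regular_on (torus3 n) D (\<lambda>p. snd (snd p) i)"
    by (simp_all add: comp_def)
qed

lemma openin_generic_triple: "openin (zariski (torus3 n)) {p. generic_triple n p}"
proof -
  have "{p. generic_triple n p} = {p \<in> points (torus3 n).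
      (period_prod n (fst p) - period_prod n (fst (snd p))) *
      ((period_prod n (fst p) - period_prod n (snd (snd p))) *
       (period_prod n (fst (snd p)) - period_prod n (snd (snd p)))) \<noteq> 0}"
    by (auto simp: generic_triple_def)
  also have "openin (zariski (torus3 n)) \<dots>"
    unfolding period_prod_def
    by (intro openin_nonvanishing openin_zariski_points regular_on_mult regular_on_diff
        regular_on_prod regular_on_torus3)
  finally show ?thesis .
qed

lemma openin_braid_generic:
  assumes n: "n \<ge> 1" and F: "rational_map (torus3 n) (torus3 n) F"
  shows "openin (zariski (torus3 n)) {p \<in> dom F \<inter> points (torus3 n). braid_generic p (the (F p))}"
proof -
  let ?D = "dom F \<inter> points (torus3 n)"
  define d :: "tuple \<Rightarrow> tuple \<Rightarrow> complex"
    where "d u v = (\<Prod>j<n. u (int j) * u (int j) - v (int j) * v (int j))" for u v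
  have D: "openin (zariski (torus3 n)) ?D" by (rule rational_mapD(1)[OF F])
  have o: "regular_on (torus3 n) ?D (\<lambda>p. fst (the (F p)) i)"
    "regular_on (torus3 n) ?D (\<lambda>p. fst (snd (the (F p))) i)"
    "regular_on (torus3 n) ?D (\<lambda>p. snd (snd (the (F p))) i)" for i
  proof -
    have h: "(\<lambda>x. x i) \<in> torus_coords" by (simp add: torus_coords_def)
    have "(\<lambda>x. x i) \<circ> fst \<in> coords (torus3 n)" "((\<lambda>x. x i) \<circ> fst) \<circ> snd \<in> coords (torus3 n)"
      "((\<lambda>x. x i) \<circ> snd) \<circ> snd \<in> coords (torus3 n)"
      by (simp_all only: coords_prod_variety torus_variety_simps prod_coords_fst prod_coords_snd h)
    from this[THEN rational_mapD(3)[OF F]] show "regular_on (torus3 n) ?D (\<lambda>p. fst (the (F p)) i)"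
      "regular_on (torus3 n) ?D (\<lambda>p. fst (snd (the (F p))) i)"
      "regular_on (torus3 n) ?D (\<lambda>p. snd (snd (the (F p))) i)"
      by (simp_all add: comp_def)
  qed
  have "{p \<in> ?D. braid_generic p (the (F p))} = {p \<in> ?D.
      d (fst p) (fst (snd p)) * d (fst (snd p)) (snd (snd p)) *
      d (fst p) (fst (the (F p))) * d (snd (snd p)) (snd (snd (the (F p)))) *
      d (snd (snd (the (F p)))) (fst (snd (the (F p)))) *
      d (fst (the (F p))) (fst (snd (the (F p)))) \<noteq> 0}"
  proof (rule Collect_cong, rule conj_cong[OF refl])
    fix p assume p: "p \<in> ?D"
    then have q: "the (F p) \<in> points (torus3 n)" by (rule rational_mapD(2)[OF F])
    have gp: "generic_pair u v \<longleftrightarrow> d u v \<noteq> 0" if "u \<in> torus n" "v \<in> torus n" for u v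
      unfolding d_def by (rule generic_pair_iff[OF n that])
    show "braid_generic p (the (F p)) \<longleftrightarrow>
      d (fst p) (fst (snd p)) * d (fst (snd p)) (snd (snd p)) *
      d (fst p) (fst (the (F p))) * d (snd (snd p)) (snd (snd (the (F p)))) *
      d (snd (snd (the (F p)))) (fst (snd (the (F p)))) *
      d (fst (the (F p))) (fst (snd (the (F p)))) \<noteq> 0"
      using p q gp unfolding braid_generic_def by (auto simp: case_prod_unfold mem_Times_iff)
  qed
  also have "openin (zariski (torus3 n)) \<dots>"
    unfolding d_def
    by (intro openin_nonvanishing regular_on_mult regular_on_diff regular_on_prod regular_on_torus3 o D)
  finally show ?thesis .
qed

lemma braid_relation:
  assumes n: "n \<ge> 1"
  shows "rat_eq (torus3 n) (braid_left n A B C) (braid_right n A B C)"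
proof -
  define U where "U F = {p \<in> dom F \<inter> points (torus3 n). braid_generic p (the (F p))}"
    for F :: "tuple \<times> tuple \<times> tuple \<rightharpoonup> tuple \<times> tuple \<times> tuple"
  let ?U = "{p. generic_triple n p} \<inter> U (braid_left n A B C) \<inter> U (braid_right n A B C)"
  let ?p = "(\<lambda>_. complex_of_real 1, \<lambda>_. complex_of_real 2, \<lambda>_. complex_of_real 3)"
  let ?q = "(\<lambda>_. complex_of_real 3, \<lambda>_. complex_of_real 2, \<lambda>_. complex_of_real 1)"
  show ?thesis
  proof (rule rat_eqI[of _ ?U ?p])
    show "openin (zariski (torus3 n)) ?U"
      unfolding U_def
      by (intro openin_Int openin_generic_triple openin_braid_generic n rational_map_braid)
    have v: "braid_left n A B C ?p = Some ?q" "braid_right n A B C ?p = Some ?q"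
      by (rule braid_const[OF n]; simp)+
    have "complex_of_real a ^ n \<noteq> complex_of_real b ^ n" if "a > 0" "b > 0" "a \<noteq> b" for a b :: real
      using that n by (simp add: power_eq_iff_eq_base flip: of_real_power)
    from this[of 1 2] this[of 1 3] this[of 2 3] have "generic_triple n ?p"
      by (simp add: generic_triple_def const_torus period_prod_def)
    moreover have "braid_generic ?p ?q" by (simp add: braid_generic_def generic_pair_def)
    moreover have "?p \<in> points (torus3 n)" by (simp add: const_torus)
    ultimately show "?p \<in> ?U" using v by (auto simp: U_def dom_def)
    fix p assume p: "p \<in> ?U"
    then obtain q q' where q: "braid_left n A B C p = Some q" "braid_right n A B C p = Some q'"
      by (auto simp: U_def)
    with p have "q' = q" by (intro braid_agree[OF n _ q]) (auto simp: U_def)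
    with q show "\<exists>r. braid_left n A B C p = Some r \<and> braid_right n A B C p = Some r" by blast
  qed
qed

theorem proposition11p8:
  fixes n :: nat
  assumes "n \<ge> 2"
  defines "X \<equiv> crystal_of n"
    and "R \<equiv> move n"
  shows "(\<forall>A B. birational_map (X A \<otimes>\<^sub>c X B) (X B \<otimes>\<^sub>c X A) (R A B)) \<and>
    (\<forall>A B i. rat_eq (X A \<otimes>\<^sub>c X B) (eps (X B \<otimes>\<^sub>c X A) i \<circ>\<^sub>m R A B) (eps (X A \<otimes>\<^sub>c X B) i)) \<and>
    (\<forall>A B i. rat_eq (X A \<otimes>\<^sub>c X B) (phi (X B \<otimes>\<^sub>c X A) i \<circ>\<^sub>m R A B) (phi (X A \<otimes>\<^sub>c X B) i)) \<and>
    (\<forall>A B i. rat_eq (X A \<otimes>\<^sub>c X B) (weight (X B \<otimes>\<^sub>c X A) i \<circ>\<^sub>m R A B) (weight (X A \<otimes>\<^sub>c X B) i)) \<and>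
    (\<forall>A B i c. c \<noteq> 0 \<longrightarrow>
       rat_eq (X A \<otimes>\<^sub>c X B) (act (X B \<otimes>\<^sub>c X A) i c \<circ>\<^sub>m R A B) (R A B \<circ>\<^sub>m act (X A \<otimes>\<^sub>c X B) i c)) \<and>
    (\<forall>A B C. rat_eq (prod_variety (X A) (prod_variety (X B) (X C)))
       (on_12 (R B C) \<circ>\<^sub>m on_23 (R A C) \<circ>\<^sub>m on_12 (R A B))
       (on_23 (R A B) \<circ>\<^sub>m on_12 (R A C) \<circ>\<^sub>m on_23 (R B C)))"
proof -
  have n: "n \<ge> 1" using assms(1) by simp
  have "birational_map (X A \<otimes>\<^sub>c X B) (X B \<otimes>\<^sub>c X A) (R A B)" for A B
    using birational_map_move[OF n] unfolding X_def R_def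
    by (subst birational_map_variety_cong[of _ "torus2 n" _ "torus2 n"])
      (simp_all only: points_coords_crystal)
  moreover have "rat_eq (X A \<otimes>\<^sub>c X B) (eps (X B \<otimes>\<^sub>c X A) i \<circ>\<^sub>m R A B) (eps (X A \<otimes>\<^sub>c X B) i) \<and>
      rat_eq (X A \<otimes>\<^sub>c X B) (phi (X B \<otimes>\<^sub>c X A) i \<circ>\<^sub>m R A B) (phi (X A \<otimes>\<^sub>c X B) i) \<and>
      rat_eq (X A \<otimes>\<^sub>c X B) (weight (X B \<otimes>\<^sub>c X A) i \<circ>\<^sub>m R A B) (weight (X A \<otimes>\<^sub>c X B) i)" for A B i
  proof -
    obtain U where U: "openin (zariski (torus2 n)) U" "U \<noteq> {}"
      and e: "\<And>p. p \<in> U \<Longrightarrow> \<exists>q a b. R A B p = Some q \<and> b \<noteq> 0 \<and>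
        phi (X B \<otimes>\<^sub>c X A) i q = Some a \<and> phi (X A \<otimes>\<^sub>c X B) i p = Some a \<and>
        eps (X B \<otimes>\<^sub>c X A) i q = Some b \<and> eps (X A \<otimes>\<^sub>c X B) i p = Some b"
      using eps_phi_move[OF n, of A B i] unfolding X_def R_def by blast
    obtain p where "p \<in> U" using U(2) by blast
    note I = rat_eqI[OF U(1) this]
    have "rat_eq (torus2 n) (eps (X B \<otimes>\<^sub>c X A) i \<circ>\<^sub>m R A B) (eps (X A \<otimes>\<^sub>c X B) i)"
      by (rule I) (use e in fastforce)
    moreover have "rat_eq (torus2 n) (phi (X B \<otimes>\<^sub>c X A) i \<circ>\<^sub>m R A B) (phi (X A \<otimes>\<^sub>c X B) i)"
      by (rule I) (use e in fastforce)
    moreover have "rat_eq (torus2 n) (weight (X B \<otimes>\<^sub>c X A) i \<circ>\<^sub>m R A B) (weight (X A \<otimes>\<^sub>c X B) i)"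
      by (rule I) (use e in \<open>fastforce simp: weight_def quot_def\<close>)
    ultimately show ?thesis unfolding X_def rat_eq_cong[OF points_coords_crystal] by blast
  qed
  moreover have "rat_eq (X A \<otimes>\<^sub>c X B) (act (X B \<otimes>\<^sub>c X A) i c \<circ>\<^sub>m R A B)
      (R A B \<circ>\<^sub>m act (X A \<otimes>\<^sub>c X B) i c)" if "c \<noteq> 0" for A B i c
    unfolding X_def R_def rat_eq_cong[OF points_coords_crystal] by (rule act_move[OF assms(1) that])
  moreover have "rat_eq (prod_variety (X A) (prod_variety (X B) (X C)))
       (on_12 (R B C) \<circ>\<^sub>m on_23 (R A C) \<circ>\<^sub>m on_12 (R A B))
       (on_23 (R A B) \<circ>\<^sub>m on_12 (R A C) \<circ>\<^sub>m on_23 (R B C))" for A B C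
    using braid_relation[OF n, of A B C]
    unfolding X_def R_def prod_variety_crystal braid_left_def braid_right_def .
  ultimately show ?thesis by blast
qed

end
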